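(* Assume that $p<n$ is fixed, that conditions (Reg1)-(Reg3) (stated in the context) hold, and that the true underlying structure is sparse (defined in the context). Choose the adaptive weights $w_1^{(j)}=\|\tilde{\boldsymbol\beta}_j\|_2^{-\gamma}$ for some arbitrarily chosen $\gamma>0$, where $\tilde{\boldsymbol\beta}$ is the unpenalized maximum likelihood estimator. Furthermore, let $\lambda_n^1 n^{-1/2}\to0$ and $\lambda_n^1n^{(\gamma-1)/2}\to\infty$, and assume $$a_n^0:=\max\{\lambda_n^0w_0^{(j,rs)}:\ 1\le r<s\le p_j,\ j=1,\dots,J\}\to0\qquad(n\to\infty).$$ Then there exists an $L_0$-FGL estimator $\hat{\boldsymbol\beta}=\operatorname*{arg\,min}_{\boldsymbol\beta}\{-L_n(\boldsymbol\beta)+P_\lambda(\boldsymbol\beta)\}$ satisfying $$\sqrt n\,(\hat{\boldsymbol\beta}_{A^*}-\boldsymbol\beta^*_{A^*})\to_dN(\boldsymbol 0,\boldsymbol\Sigma),\qquad\boldsymbol\Sigma=\boldsymbol I_{11}^{-1},$$ where the subscript $A^*$ denotes the subvector of active coordinates.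
   Context: Setting: there are $J$ categorical covariates (factors); factor $j$ has $p_j+1$ levels $0,1,\dots,p_j$, level $0$ being the reference category, and $p=\sum_{j=1}^Jp_j$; $J$ and the $p_j$ are fixed. The parameter vector is $\boldsymbol\beta=(\beta_0,\boldsymbol\beta_1,\dots,\boldsymbol\beta_J)\in\mathbb R^{p+1}$ with intercept $\beta_0$, $\boldsymbol\beta_j=(\beta_{j,1},\dots,\beta_{j,p_j})$ and the convention $\beta_{j,0}=0$. Observations $\boldsymbol v_i=(y_i,\boldsymbol x_i)$, $i=1,\dots,n$, are i.i.d. copies of $\boldsymbol v=(y,\boldsymbol x)$ with $y\in\{0,1\}$ and $\boldsymbol x=(1,\boldsymbol x_1,\dots,\boldsymbol x_J)\in\mathbb R^{p+1}$, where $\boldsymbol x_j\in\{0,1\}^{p_j}$ is the dummy coding of factor $j$ (its $k$-th entry is $1$ iff factor $j$ takes level $k$). The data follow the logistic regression model $\mathbb E(y\mid\boldsymbol x)=\exp(\boldsymbol x^T\boldsymbol\beta)/(1+\exp(\boldsymbol x^T\boldsymbol\beta))$ with true parameter $\boldsymbol\beta=\boldsymbol\beta^*$. The log likelihood is $L_n(\boldsymbol\beta)=\sum_{i=1}^n\log f(\boldsymbol v_i,\boldsymbol\beta)$. Penalty: $$P_\lambda(\boldsymbol\beta)=\lambda_n^1\sum_{j=1}^Jw_1^{(j)}\|\boldsymbol\beta_j\|_2+\lambda_n^0\sum_{j=1}^J\sum_{0\le r<s\le p_j}w_0^{(j,rs)}\|\beta_{j,r}-\beta_{j,s}\|_0,$$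 with tuning parameters $\lambda_n^1,\lambda_n^0\ge0$, positive weights $w_0^{(j,rs)}$, and $\|t\|_0=0$ if $t=0$, $\|t\|_0=1$ if $t\ne0$ for $t\in\mathbb R$. An $L_0$-FGL estimator is a minimizer of $-L_n+P_\lambda$. Sparsity: the true underlying structure is sparse if, without loss of generality (after relabelling factors), the true active set $A^*=\{j:\boldsymbol\beta_j^*\ne\boldsymbol0\}$ can be written as $A^*=\{1,\dots,j_0\}$ with $j_0<J$. The Fisher information is then partitioned as $\boldsymbol I_F(\boldsymbol\beta^* )=\begin{bmatrix}\boldsymbol I_{11}&\boldsymbol I_{12}\\\boldsymbol I_{21}&\boldsymbol I_{22}\end{bmatrix}$, where $\boldsymbol I_{11}$ is the block of the active coordinates, i.e. of $\boldsymbol\beta_{A^*}=(\beta_0,\boldsymbol\beta_1,\dots,\boldsymbol\beta_{j_0})$ (the unpenalized intercept being counted among the active coordinates). Regularity conditions. (Reg1) The density can be written as $f(\boldsymbol v,\boldsymbol\beta)=h(y)\exp(y\,\boldsymbol x^T\boldsymbol\beta-\varphi(\boldsymbol x^T\boldsymbol\beta))$; for binary logistic regression $h(y)=1$ and $\varphi(\eta)=\ln(1+\exp(\eta))$. (Reg2) The Fisher information matrix $\boldsymbol I_F(\boldsymbol\beta)$ is finite and positive definite at $\boldsymbol\beta=\boldsymbol\beta^*$, where $\boldsymbol I_F(\boldsymbol\beta^* )=\mathbb E(\varphi''(\boldsymbol x^T\boldsymbol\beta^* )\boldsymbol x\boldsymbol x^T)$. (Reg3) There is an open set $\mathcal O$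 (depending on $n$) with $\boldsymbol\beta^*\in\mathcal O$ and a function $M(\boldsymbol x)\in\mathbb R$ such that for all $\boldsymbol\beta\in\mathcal O$: $|\varphi'''(\boldsymbol x^T\boldsymbol\beta)|\le M(\boldsymbol x)<\infty$, and $\mathbb E(M(\boldsymbol x)|x_jx_kx_l|)<\infty$ for all $1\le j,k,l\le p$. $\to_d$ denotes convergence in distribution as $n\to\infty$.
   Formalization: If all factors are binary, the maximum defining a_n^0 is over an empty set and undefined; there it is taken over the pairs (0,s) instead. The weights w_0 are fixed constants, and the estimator is a minimizer wherever one exists, which holds with probability tending to 1. *)

theory Defs
  imports "HOL-Probability.Probability"
begin

text \<open>
  Parameter and covariate vectors live in \<open>real ^ 'c option\<close>. The coordinate \<open>None\<close> is the
  intercept; the remaining coordinates \<open>Some c\<close> are named by a bijection \<open>idx\<close> from the pairs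
  \<open>(j, k)\<close>, where \<open>j\<close> in \<open>{1..J}\<close> is a factor and \<open>k\<close> in \<open>{1..p j}\<close> one of its non-reference
  levels. Hence \<open>CARD('c)\<close> is the sum of the \<open>p j\<close>.
\<close>

definition dummy_coords :: "nat set \<Rightarrow> (nat \<Rightarrow> nat) \<Rightarrow> (nat \<times> nat) set" where
  "dummy_coords F p = (SIGMA j:F. {1..p j})"

definition coord_layout :: "nat \<Rightarrow> (nat \<Rightarrow> nat) \<Rightarrow> (nat \<times> nat \<Rightarrow> 'c::finite) \<Rightarrow> bool" where
  "coord_layout J p idx \<longleftrightarrow> bij_betw idx (dummy_coords {1..J} p) UNIV"

definition coef :: "(nat \<times> nat \<Rightarrow> 'c::finite) \<Rightarrow> real ^ 'c option \<Rightarrow> nat \<Rightarrow> nat \<Rightarrow> real" where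
  "coef idx \<beta> j r = (if r = 0 then 0 else \<beta> $ Some (idx (j, r)))"

definition block_norm ::
    "(nat \<Rightarrow> nat) \<Rightarrow> (nat \<times> nat \<Rightarrow> 'c::finite) \<Rightarrow> real ^ 'c option \<Rightarrow> nat \<Rightarrow> real" where
  "block_norm p idx \<beta> j = L2_set (coef idx \<beta> j) {1..p j}"

definition active_set ::
    "nat \<Rightarrow> (nat \<Rightarrow> nat) \<Rightarrow> (nat \<times> nat \<Rightarrow> 'c::finite) \<Rightarrow> real ^ 'c option \<Rightarrow> nat set" where
  "active_set J p idx \<beta> = {j \<in> {1..J}. \<exists>k\<in>{1..p j}. coef idx \<beta> j k \<noteq> 0}"

text \<open>The coordinates of the subvector of active coefficients, including the intercept.\<close>

definition active_coords ::
    "nat \<Rightarrow> (nat \<Rightarrow> nat) \<Rightarrow> (nat \<times> nat \<Rightarrow> 'c::finite) \<Rightarrow> real ^ 'c option \<Rightarrow> 'c option set" where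
  "active_coords J p idx \<beta> =
     insert None ((\<lambda>jk. Some (idx jk)) ` dummy_coords (active_set J p idx \<beta>) p)"

text \<open>
  Vectors indexed by a type \<open>'a\<close> stand for the subvectors of active coordinates, via an
  enumeration \<open>act\<close> of these coordinates.
\<close>

definition subvec :: "('a::finite \<Rightarrow> 'b::finite) \<Rightarrow> real ^ 'b \<Rightarrow> real ^ 'a" where
  "subvec act v = (\<chi> i. v $ act i)"

definition submat :: "('a::finite \<Rightarrow> 'b::finite) \<Rightarrow> real ^ 'b ^ 'b \<Rightarrow> real ^ 'a ^ 'a" where
  "submat act A = (\<chi> i k. A $ act i $ act k)"

definition dummy_coded ::
    "nat \<Rightarrow> (nat \<Rightarrow> nat) \<Rightarrow> (nat \<times> nat \<Rightarrow> 'c::finite) \<Rightarrow> real ^ 'c option \<Rightarrow> bool" where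
  "dummy_coded J p idx x \<longleftrightarrow>
     x $ None = 1 \<and>
     (\<exists>level :: nat \<Rightarrow> nat. \<forall>j\<in>{1..J}. level j \<le> p j \<and>
        (\<forall>k\<in>{1..p j}. x $ Some (idx (j, k)) = of_bool (level j = k)))"

text \<open>The possible values of an observation \<open>(y, x)\<close>.\<close>

definition obs_space ::
    "nat \<Rightarrow> (nat \<Rightarrow> nat) \<Rightarrow> (nat \<times> nat \<Rightarrow> 'c::finite) \<Rightarrow> (real \<times> (real ^ 'c option)) set" where
  "obs_space J p idx = {0, 1} \<times> {x. dummy_coded J p idx x}"

definition \<phi> :: "real \<Rightarrow> real" where
  "\<phi> \<eta> = ln (1 + exp \<eta>)"

text \<open>The exponential-family form of the density, with base factor \<open>h y = 1\<close>.\<close>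

definition obs_density :: "real \<times> (real ^ 'b::finite) \<Rightarrow> real ^ 'b \<Rightarrow> real" where
  "obs_density v \<beta> = exp (fst v * (snd v \<bullet> \<beta>) - \<phi> (snd v \<bullet> \<beta>))"

lemma obs_density_bernoulli:
  fixes x \<beta> :: "real ^ 'b::finite"
  shows "obs_density (1, x) \<beta> = exp (x \<bullet> \<beta>) / (1 + exp (x \<bullet> \<beta>))"
    and "obs_density (0, x) \<beta> = 1 - exp (x \<bullet> \<beta>) / (1 + exp (x \<bullet> \<beta>))"
proof -
  have pos: "0 < 1 + exp (x \<bullet> \<beta>)"
    by (simp add: add_pos_pos)
  show "obs_density (1, x) \<beta> = exp (x \<bullet> \<beta>) / (1 + exp (x \<bullet> \<beta>))"
    using pos by (simp add: obs_density_def \<phi>_def exp_diff)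
  show "obs_density (0, x) \<beta> = 1 - exp (x \<bullet> \<beta>) / (1 + exp (x \<bullet> \<beta>))"
    using pos by (simp add: obs_density_def \<phi>_def exp_minus field_simps)
qed

definition logistic_model ::
    "'w measure \<Rightarrow> ('w \<Rightarrow> real) \<Rightarrow> ('w \<Rightarrow> real ^ 'b::finite) \<Rightarrow> real ^ 'b \<Rightarrow> bool" where
  "logistic_model M Y X \<beta> \<longleftrightarrow>
     (AE \<omega> in M. real_cond_exp M (vimage_algebra (space M) X borel) Y \<omega> =
        exp (X \<omega> \<bullet> \<beta>) / (1 + exp (X \<omega> \<bullet> \<beta>)))"

text \<open>
  Samples are lists of observations; an estimator is a function of the sample.
\<close>

definition sample :: "(nat \<Rightarrow> 'w \<Rightarrow> 'v) \<Rightarrow> nat \<Rightarrow> 'w \<Rightarrow> 'v list" where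
  "sample V n \<omega> = map (\<lambda>i. V i \<omega>) [0..<n]"

definition loglik :: "(real \<times> (real ^ 'b::finite)) list \<Rightarrow> real ^ 'b \<Rightarrow> real" where
  "loglik vs \<beta> = (\<Sum>v\<leftarrow>vs. ln (obs_density v \<beta>))"

definition is_mle :: "(real \<times> (real ^ 'b::finite)) list \<Rightarrow> real ^ 'b \<Rightarrow> bool" where
  "is_mle vs b \<longleftrightarrow> is_arg_max (loglik vs) (\<lambda>_. True) b"

text \<open>
  A maximum likelihood estimate need not exist for every sample (for instance if all responses
  coincide), so an estimator is only required to maximise the likelihood where a maximiser exists.
\<close>

definition mle_estimator ::
    "nat \<Rightarrow> (nat \<Rightarrow> nat) \<Rightarrow> (nat \<times> nat \<Rightarrow> 'c::finite) \<Rightarrow>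
     ((real \<times> (real ^ 'c option)) list \<Rightarrow> real ^ 'c option) \<Rightarrow> bool" where
  "mle_estimator J p idx T \<longleftrightarrow>
     (\<forall>vs. set vs \<subseteq> obs_space J p idx \<and> (\<Sum>j=1..J. p j) < length vs \<and> (\<exists>b. is_mle vs b)
        \<longrightarrow> is_mle vs (T vs))"

definition l0_norm :: "real \<Rightarrow> real" where
  "l0_norm t = (if t = 0 then 0 else 1)"

definition penalty ::
    "nat \<Rightarrow> (nat \<Rightarrow> nat) \<Rightarrow> (nat \<times> nat \<Rightarrow> 'c::finite) \<Rightarrow> real \<Rightarrow> real \<Rightarrow>
     (nat \<Rightarrow> real) \<Rightarrow> (nat \<Rightarrow> nat \<Rightarrow> nat \<Rightarrow> real) \<Rightarrow> real ^ 'c option \<Rightarrow> real" where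
  "penalty J p idx l1 l0 w1 w0 \<beta> =
     l1 * (\<Sum>j=1..J. w1 j * block_norm p idx \<beta> j) +
     l0 * (\<Sum>j=1..J. \<Sum>s\<le>p j. \<Sum>r<s. w0 j r s * l0_norm (coef idx \<beta> j r - coef idx \<beta> j s))"

text \<open>
  The objective for the sample \<open>vs\<close>, with sequences of tuning parameters \<open>lam1\<close>, \<open>lam0\<close> taken at
  the sample size and adaptive group weights computed from the preliminary estimator \<open>T\<close>.
\<close>

definition fgl_objective ::
    "nat \<Rightarrow> (nat \<Rightarrow> nat) \<Rightarrow> (nat \<times> nat \<Rightarrow> 'c::finite) \<Rightarrow>
     (nat \<Rightarrow> real) \<Rightarrow> (nat \<Rightarrow> real) \<Rightarrow> real \<Rightarrow> (nat \<Rightarrow> nat \<Rightarrow> nat \<Rightarrow> real) \<Rightarrow>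
     ((real \<times> (real ^ 'c option)) list \<Rightarrow> real ^ 'c option) \<Rightarrow>
     (real \<times> (real ^ 'c option)) list \<Rightarrow> real ^ 'c option \<Rightarrow> real" where
  "fgl_objective J p idx lam1 lam0 \<gamma> w0 T vs \<beta> =
     - loglik vs \<beta> +
     penalty J p idx (lam1 (length vs)) (lam0 (length vs))
       (\<lambda>j. block_norm p idx (T vs) j powr (- \<gamma>)) w0 \<beta>"

definition is_fgl ::
    "nat \<Rightarrow> (nat \<Rightarrow> nat) \<Rightarrow> (nat \<times> nat \<Rightarrow> 'c::finite) \<Rightarrow>
     (nat \<Rightarrow> real) \<Rightarrow> (nat \<Rightarrow> real) \<Rightarrow> real \<Rightarrow> (nat \<Rightarrow> nat \<Rightarrow> nat \<Rightarrow> real) \<Rightarrow>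
     ((real \<times> (real ^ 'c option)) list \<Rightarrow> real ^ 'c option) \<Rightarrow>
     (real \<times> (real ^ 'c option)) list \<Rightarrow> real ^ 'c option \<Rightarrow> bool" where
  "is_fgl J p idx lam1 lam0 \<gamma> w0 T vs b \<longleftrightarrow>
     is_arg_min (fgl_objective J p idx lam1 lam0 \<gamma> w0 T vs) (\<lambda>_. True) b"

definition fgl_estimator ::
    "nat \<Rightarrow> (nat \<Rightarrow> nat) \<Rightarrow> (nat \<times> nat \<Rightarrow> 'c::finite) \<Rightarrow>
     (nat \<Rightarrow> real) \<Rightarrow> (nat \<Rightarrow> real) \<Rightarrow> real \<Rightarrow> (nat \<Rightarrow> nat \<Rightarrow> nat \<Rightarrow> real) \<Rightarrow>
     ((real \<times> (real ^ 'c option)) list \<Rightarrow> real ^ 'c option) \<Rightarrow>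
     ((real \<times> (real ^ 'c option)) list \<Rightarrow> real ^ 'c option) \<Rightarrow> bool" where
  "fgl_estimator J p idx lam1 lam0 \<gamma> w0 T B \<longleftrightarrow>
     (\<forall>vs. set vs \<subseteq> obs_space J p idx \<and> (\<Sum>j=1..J. p j) < length vs \<and>
           (\<exists>b. is_fgl J p idx lam1 lam0 \<gamma> w0 T vs b)
        \<longrightarrow> is_fgl J p idx lam1 lam0 \<gamma> w0 T vs (B vs))"

text \<open>
  The maximum runs over the pairs \<open>r < s\<close> of non-reference levels. It is a maximum over the empty
  set when every factor is binary; only in that case the pairs with the reference level, which
  are then the only penalised ones, are used instead.
\<close>

definition level_pairs :: "nat \<Rightarrow> (nat \<Rightarrow> nat) \<Rightarrow> nat \<Rightarrow> (nat \<times> nat \<times> nat) set" where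
  "level_pairs J p m = {(j, r, s). j \<in> {1..J} \<and> m \<le> r \<and> r < s \<and> s \<le> p j}"

definition max_l0_weight ::
    "nat \<Rightarrow> (nat \<Rightarrow> nat) \<Rightarrow> real \<Rightarrow> (nat \<Rightarrow> nat \<Rightarrow> nat \<Rightarrow> real) \<Rightarrow> real" where
  "max_l0_weight J p l0 w0 =
     Max ((\<lambda>(j, r, s). l0 * w0 j r s) `
       (if level_pairs J p 1 \<noteq> {} then level_pairs J p 1 else level_pairs J p 0))"

definition pos_def_matrix :: "real ^ 'b ^ 'b::finite \<Rightarrow> bool" where
  "pos_def_matrix A \<longleftrightarrow> transpose A = A \<and> (\<forall>z. z \<noteq> 0 \<longrightarrow> 0 < z \<bullet> (A *v z))"

definition fisher_info ::
    "'w measure \<Rightarrow> ('w \<Rightarrow> real ^ 'b::finite) \<Rightarrow> real ^ 'b \<Rightarrow> real ^ 'b ^ 'b" where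
  "fisher_info M X \<beta> =
     (\<chi> i k. \<integral>\<omega>. (deriv ^^ 2) \<phi> (X \<omega> \<bullet> \<beta>) * (X \<omega> $ i * X \<omega> $ k) \<partial>M)"

definition reg2 :: "'w measure \<Rightarrow> ('w \<Rightarrow> real ^ 'b::finite) \<Rightarrow> real ^ 'b \<Rightarrow> bool" where
  "reg2 M X \<beta> \<longleftrightarrow>
     (\<forall>i k. integrable M (\<lambda>\<omega>. (deriv ^^ 2) \<phi> (X \<omega> \<bullet> \<beta>) * (X \<omega> $ i * X \<omega> $ k))) \<and>
     pos_def_matrix (fisher_info M X \<beta>)"

definition reg3 :: "'w measure \<Rightarrow> ('w \<Rightarrow> real ^ 'c::finite option) \<Rightarrow> real ^ 'c option \<Rightarrow> bool" where
  "reg3 M X \<beta>0 \<longleftrightarrow>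
     (\<exists>(U :: nat \<Rightarrow> (real ^ 'c option) set) (B :: real ^ 'c option \<Rightarrow> real).
        (\<forall>n. open (U n) \<and> \<beta>0 \<in> U n \<and>
           (\<forall>\<beta>\<in>U n. \<forall>\<omega>\<in>space M. \<bar>(deriv ^^ 3) \<phi> (X \<omega> \<bullet> \<beta>)\<bar> \<le> B (X \<omega>))) \<and>
        (\<forall>j k l. integrable M
           (\<lambda>\<omega>. B (X \<omega>) * \<bar>X \<omega> $ Some j * X \<omega> $ Some k * X \<omega> $ Some l\<bar>)))"

text \<open>The normal distribution with mean \<open>\<mu>\<close> and positive definite covariance matrix \<open>S\<close>.\<close>

definition mv_normal :: "real ^ 'a::finite \<Rightarrow> real ^ 'a ^ 'a \<Rightarrow> (real ^ 'a) measure" where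
  "mv_normal \<mu> S = density lborel
     (\<lambda>z. ennreal (exp (- ((z - \<mu>) \<bullet> (matrix_inv S *v (z - \<mu>))) / 2) /
                    sqrt ((2 * pi) ^ CARD('a) * det S)))"

definition conv_in_distribution ::
    "'w measure \<Rightarrow> (nat \<Rightarrow> 'w \<Rightarrow> 'b::euclidean_space) \<Rightarrow> 'b measure \<Rightarrow> bool" where
  "conv_in_distribution M Z D \<longleftrightarrow>
     (\<forall>n. Z n \<in> borel_measurable M) \<and>
     (\<forall>g :: 'b \<Rightarrow> real. continuous_on UNIV g \<and> bounded (range g) \<longrightarrow>
        (\<lambda>n. \<integral>\<omega>. g (Z n \<omega>) \<partial>M) \<longlonglongrightarrow> (\<integral>z. g z \<partial>D))"

end

theory Submission
  imports Defs
begin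

text \<open>
  Write a parameter near the truth \<open>\<beta>\<close> as \<open>\<beta> + u / sqrt n\<close>. As a function of the scaled error \<open>u\<close>, the
  increase of the negative log likelihood is convex and, uniformly on balls, close to the
  quadratic form \<open>- (W \<bullet> u) + u \<bullet> (I *v u) / 2\<close>, where \<open>W\<close> is the scaled score and \<open>I\<close> the Fisher information
  (\<open>loglik_expansion\<close>, \<open>whp_local_quadratic\<close>). The group penalty of an active factor contributes a
  term of order \<open>lam1 n / sqrt n\<close>, which vanishes (\<open>whp_active_weight\<close>). That of an inactive factor has a
  slope at zero that tends to infinity, because its adaptive weight is a negative power of a norm
  of order \<open>1 / sqrt n\<close> (\<open>whp_inactive_weight\<close>). The fusion penalty takes values between zero and a fixed
  multiple of \<open>lam0 n\<close>, which tends to zero; although discontinuous and not convex, it can therefore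
  move the minimum only negligibly.

  Hence, up to events of small probability, every minimizer \<open>u\<close> of the objective lies in a ball whose
  radius depends only on \<open>I\<close> and on a bound for \<open>W\<close>, and its active part is close to \<open>inverse I11\<close> times the active part of \<open>W\<close>. These
  deterministic statements are \<open>minimizer_in_ball\<close> and \<open>minimizer_near_quadratic_minimizer\<close>. The active
  part of \<open>W\<close> is a scaled sum of independent bounded vectors with covariance \<open>I11\<close>, so the central
  limit theorem (\<open>multivariate_clt\<close>) and Slutsky's theorem (\<open>conv_in_distribution_slutsky\<close>) give the
  normal limit with covariance \<open>inverse I11\<close>. Existence of minimizers follows from the same
  localisation and from lower semicontinuity of the objective.

  The weights come from the maximum likelihood estimator, to which the same argument applies
  without penalties. It gives the order \<open>1 / sqrt n\<close> of its error and, since the normal limit has no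
  mass on hyperplanes, that its inactive blocks are not exactly zero, up to small probability.

  The limit theorem for vectors is obtained from the one-dimensional one through characteristic
  functions. Bounded continuous functions are approximated by trigonometric sums with the
  Stone-Weierstrass theorem (\<open>conv_in_distribution_if_char\<close>), and the characteristic function of the
  multivariate normal distribution is computed by a linear change of variables to independent
  standard normal coordinates (\<open>mv_normal_eq_distr\<close>).
\<close>

section \<open>Linear change of variables for Lebesgue measure\<close>

lemma borel_measurable_vec_lambda:
  fixes f :: "'i \<Rightarrow> 'n::finite \<Rightarrow> real"
  assumes "\<And>i. (\<lambda>x. f x i) \<in> borel_measurable M"
  shows "(\<lambda>x. \<chi> i. f x i) \<in> borel_measurable M"
  using assms by (subst borel_measurable_euclidean_space) (auto simp: Basis_vec_def inner_axis)

lemma borel_measurable_vec_nth [measurable]: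
  "(\<lambda>x :: real ^ 'n. x $ i) \<in> borel_measurable borel"
  by (intro borel_measurable_continuous_onI continuous_intros)

lemma borel_measurable_matrix_vector_mult [measurable]:
  fixes A :: "real ^ 'n ^ 'm"
  shows "(*v) A \<in> borel_measurable borel"
  by (intro borel_measurable_continuous_onI linear_continuous_on
      matrix_vector_mul_bounded_linear)

lemma prod_Basis_vec:
  fixes f :: "real ^ 'n \<Rightarrow> 'a::comm_monoid_mult"
  shows "(\<Prod>b\<in>Basis. f b) = (\<Prod>i\<in>UNIV. f (axis i 1))"
proof -
  have "Basis = (\<lambda>i :: 'n. axis i (1::real)) ` UNIV"
    by (auto simp: Basis_vec_def)
  moreover have "inj (\<lambda>i :: 'n. axis i (1::real))"
    by (auto simp: inj_on_def axis_eq_axis)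
  ultimately show ?thesis
    using prod.reindex[of "\<lambda>i :: 'n. axis i (1::real)" UNIV f] by (simp add: o_def)
qed

lemma lborel_eq_distr_PiM:
  "(lborel :: (real ^ 'n) measure) = distr (\<Pi>\<^sub>M i\<in>UNIV. lborel) borel (\<lambda>f. \<chi> i. f i)"
proof (rule lborel_eqI)
  interpret product_sigma_finite "\<lambda>_::'n. lborel :: real measure" ..
  have [measurable]: "(\<lambda>f. \<chi> i. f i) \<in> (\<Pi>\<^sub>M i\<in>UNIV. lborel) \<rightarrow>\<^sub>M (borel :: (real ^ 'n) measure)"
    by (rule borel_measurable_vec_lambda) simp
  show "sets (distr (\<Pi>\<^sub>M i\<in>UNIV. lborel) borel (\<lambda>f. \<chi> i. f i)) = sets (borel :: (real ^ 'n) measure)"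
    by simp
  fix l u :: "real ^ 'n"
  assume le: "\<And>b. b \<in> Basis \<Longrightarrow> l \<bullet> b \<le> u \<bullet> b"
  have le': "l $ i \<le> u $ i" for i
    using le[of "axis i 1"] by (simp add: inner_axis axis_in_Basis_iff)
  have "emeasure (distr (\<Pi>\<^sub>M i\<in>UNIV. lborel) borel (\<lambda>f. \<chi> i. f i)) (box l u)
      = emeasure (\<Pi>\<^sub>M i\<in>(UNIV :: 'n set). (lborel :: real measure)) (\<Pi>\<^sub>E i\<in>UNIV. {l $ i <..< u $ i})"
    by (subst emeasure_distr)
      (auto simp: mem_box_cart PiE_def Pi_iff space_PiM intro!: arg_cong2[where f = emeasure])
  also have "\<dots> = (\<Prod>i\<in>UNIV. emeasure lborel {l $ i <..< u $ i})"
    by (rule emeasure_PiM) auto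
  also have "\<dots> = (\<Prod>b\<in>Basis. (u - l) \<bullet> b)"
    by (simp add: le' prod_ennreal prod_Basis_vec inner_axis)
  finally show "emeasure (distr (\<Pi>\<^sub>M i\<in>UNIV. lborel) borel (\<lambda>f. \<chi> i. f i)) (box l u)
      = (\<Prod>b\<in>Basis. (u - l) \<bullet> b)" .
qed

lemma nn_integral_lborel_diagonal:
  fixes A :: "real ^ 'n ^ 'n"
  assumes off: "\<And>i j. i \<noteq> j \<Longrightarrow> A $ i $ j = 0" and det: "det A \<noteq> 0"
    and [measurable]: "F \<in> borel_measurable borel"
  shows "(\<integral>\<^sup>+x. F x \<partial>lborel) = ennreal \<bar>det A\<bar> * (\<integral>\<^sup>+x. F (A *v x) \<partial>lborel)"
proof -
  define c where "c b = (A *v b) \<bullet> b" for b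
  have detA: "det A = (\<Prod>i\<in>UNIV. A $ i $ i)"
    by (rule det_diagonal) (rule off)
  have mul: "(A *v x) $ i = A $ i $ i * x $ i" for x i
  proof -
    have "(A *v x) $ i = (\<Sum>j\<in>UNIV. if j = i then A $ i $ i * x $ i else 0)"
      unfolding matrix_vector_mult_def vec_lambda_beta by (rule sum.cong) (auto simp: off)
    then show ?thesis by simp
  qed
  have caxis: "c (axis i 1) = A $ i $ i" for i
    by (simp add: c_def inner_axis mul)
  have nz: "A $ i $ i \<noteq> 0" for i
    using det by (simp add: detA)
  have T: "0 + (\<Sum>j\<in>Basis. (c j * (x \<bullet> j)) *\<^sub>R j) = A *v x" for x
  proof -
    have "A *v x = (\<Sum>b\<in>Basis. ((A *v x) \<bullet> b) *\<^sub>R b)"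
      by (simp add: euclidean_representation)
    also have "\<dots> = (\<Sum>b\<in>Basis. (c b * (x \<bullet> b)) *\<^sub>R b)"
      by (rule sum.cong) (auto simp: Basis_vec_def inner_axis caxis mul)
    finally show ?thesis by simp
  qed
  have nz': "c j \<noteq> 0" if "j \<in> Basis" for j
    using that by (auto simp: Basis_vec_def caxis nz)
  have "(lborel :: (real ^ 'n) measure)
      = density (distr lborel borel ((*v) A)) (\<lambda>_. ennreal \<bar>det A\<bar>)"
    using lborel_affine_euclidean[of c 0, OF nz']
    by (simp only: T prod_Basis_vec caxis detA abs_prod prod_ennreal abs_ge_zero)
  then have "(\<integral>\<^sup>+x. F x \<partial>lborel)
      = (\<integral>\<^sup>+x. F x \<partial>density (distr lborel borel ((*v) A)) (\<lambda>_. ennreal \<bar>det A\<bar>))"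
    by (rule arg_cong[where f = "\<lambda>N. integral\<^sup>N N F"])
  also have "\<dots> = ennreal \<bar>det A\<bar> * (\<integral>\<^sup>+x. F (A *v x) \<partial>lborel)"
    by (simp add: nn_integral_density nn_integral_distr nn_integral_cmult)
  finally show ?thesis .
qed

lemma nn_integral_lborel_swap:
  fixes F :: "real ^ 'n \<Rightarrow> ennreal"
  assumes [measurable]: "F \<in> borel_measurable borel"
  shows "(\<integral>\<^sup>+x. F x \<partial>lborel)
      = (\<integral>\<^sup>+x. F (\<chi> i. x $ Transposition.transpose m n i) \<partial>lborel)"
proof -
  let ?h = "\<lambda>x :: real ^ 'n. \<chi> i. x $ Transposition.transpose m n i"
  have [measurable]: "?h \<in> borel_measurable borel"
    by (rule borel_measurable_vec_lambda) simp
  have "lborel = distr lborel borel ?h"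
  proof (rule lborel_eqI)
    fix l u :: "real ^ 'n"
    assume le: "\<And>b. b \<in> Basis \<Longrightarrow> l \<bullet> b \<le> u \<bullet> b"
    have le': "l $ i \<le> u $ i" for i
      using le[of "axis i 1"] by (simp add: inner_axis axis_in_Basis_iff)
    have tt: "(\<forall>i. P (Transposition.transpose m n i)) \<longleftrightarrow> (\<forall>i. P i)" for P
      by (metis transpose_involutory)
    have "?h -` box l u = box (?h l) (?h u)"
      using tt[of "\<lambda>i. l $ Transposition.transpose m n i < _ $ i \<and> _ $ i < u $ Transposition.transpose m n i"]
      by (auto simp: mem_box_cart)
    then have "emeasure (distr lborel borel ?h) (box l u) = (\<Prod>b\<in>Basis. (?h u - ?h l) \<bullet> b)"
      by (simp add: emeasure_distr emeasure_lborel_box_eq Basis_vec_def inner_axis le')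
    also have "\<dots> = (\<Prod>i\<in>UNIV. (u - l) $ i)"
      using prod.permute[OF permutes_swap_id, where S = UNIV and g = "\<lambda>i. (u - l) $ i"
          and a1 = m and b1 = n]
      by (simp add: prod_Basis_vec inner_axis o_def)
    finally show "emeasure (distr lborel borel ?h) (box l u) = (\<Prod>b\<in>Basis. (u - l) \<bullet> b)"
      by (simp add: prod_Basis_vec inner_axis)
  qed simp
  then have "(\<integral>\<^sup>+x. F x \<partial>lborel) = (\<integral>\<^sup>+x. F x \<partial>distr lborel borel ?h)"
    by (rule arg_cong[where f = "\<lambda>N. integral\<^sup>N N F"])
  then show ?thesis
    by (simp add: nn_integral_distr)
qed

text \<open>
  By Fubini, for fixed values of the other coordinates, the shear only translates the coordinate
  \<open>m\<close> by a constant.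
\<close>

lemma nn_integral_lborel_shear:
  fixes F :: "real ^ 'n \<Rightarrow> ennreal"
  assumes mn: "m \<noteq> n" and [measurable]: "F \<in> borel_measurable borel"
  shows "(\<integral>\<^sup>+x. F x \<partial>lborel)
      = (\<integral>\<^sup>+x. F (\<chi> i. if i = m then x $ m + x $ n else x $ i) \<partial>lborel)"
proof -
  interpret product_sigma_finite "\<lambda>_::'n. lborel :: real measure" ..
  let ?P = "\<Pi>\<^sub>M i\<in>UNIV. (lborel :: real measure)"
  let ?h = "\<lambda>x :: real ^ 'n. \<chi> i. if i = m then x $ m + x $ n else x $ i"
  let ?I = "UNIV - {m}"
  have ins: "insert m ?I = UNIV" by auto
  have [measurable]: "(\<lambda>f. \<chi> i. f i) \<in> ?P \<rightarrow>\<^sub>M (borel :: (real ^ 'n) measure)"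
    by (rule borel_measurable_vec_lambda) simp
  have [measurable]: "?h \<in> borel_measurable borel"
    by (rule borel_measurable_vec_lambda) simp
  have split: "(\<integral>\<^sup>+x. G x \<partial>lborel)
      = (\<integral>\<^sup>+f. (\<integral>\<^sup>+y. G (\<chi> i. (f(m := y)) i) \<partial>lborel) \<partial>(\<Pi>\<^sub>M i\<in>?I. lborel))"
    if [measurable]: "G \<in> borel_measurable borel" for G :: "real ^ 'n \<Rightarrow> ennreal"
  proof -
    have "(\<integral>\<^sup>+x. G x \<partial>lborel) = (\<integral>\<^sup>+f. G (\<chi> i. f i) \<partial>?P)"
      by (subst lborel_eq_distr_PiM) (simp add: nn_integral_distr)
    also have "\<dots> = (\<integral>\<^sup>+f. G (\<chi> i. f i) \<partial>(\<Pi>\<^sub>M i\<in>insert m ?I. lborel))"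
      by (simp only: ins)
    also have "\<dots> = (\<integral>\<^sup>+f. (\<integral>\<^sup>+y. G (\<chi> i. (f(m := y)) i) \<partial>lborel) \<partial>(\<Pi>\<^sub>M i\<in>?I. lborel))"
      by (rule product_nn_integral_insert) (simp_all add: ins)
    finally show ?thesis .
  qed
  have "(\<integral>\<^sup>+x. F x \<partial>lborel)
      = (\<integral>\<^sup>+f. (\<integral>\<^sup>+y. F (\<chi> i. (f(m := y)) i) \<partial>lborel) \<partial>(\<Pi>\<^sub>M i\<in>?I. lborel))"
    by (rule split) simp
  also have "\<dots> = (\<integral>\<^sup>+f. (\<integral>\<^sup>+y. F (?h (\<chi> i. (f(m := y)) i)) \<partial>lborel) \<partial>(\<Pi>\<^sub>M i\<in>?I. lborel))"
  proof (rule nn_integral_cong)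
    fix f :: "'n \<Rightarrow> real"
    have "(\<lambda>y. \<chi> i. (f(m := y)) i) \<in> borel_measurable borel"
      by (rule borel_measurable_vec_lambda) (simp add: fun_upd_def)
    then have meas: "(\<lambda>y. F (\<chi> i. (f(m := y)) i)) \<in> borel_measurable borel"
      by (rule measurable_compose) simp
    have eq: "(\<chi> i. (f(m := f n + 1 * y)) i) = ?h (\<chi> i. (f(m := y)) i)" for y
      using mn by (auto simp: vec_eq_iff)
    show "(\<integral>\<^sup>+y. F (\<chi> i. (f(m := y)) i) \<partial>lborel)
        = (\<integral>\<^sup>+y. F (?h (\<chi> i. (f(m := y)) i)) \<partial>lborel)"
    proof -
      have "(\<integral>\<^sup>+y. F (\<chi> i. (f(m := y)) i) \<partial>lborel)
          = (\<integral>\<^sup>+y. F (\<chi> i. (f(m := f n + 1 * y)) i) \<partial>lborel)"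
        using nn_integral_real_affine[OF meas, of 1 "f n"] by simp
      then show ?thesis
        by (simp only: eq)
    qed
  qed
  also have "\<dots> = (\<integral>\<^sup>+x. F (?h x) \<partial>lborel)"
    by (rule split[symmetric]) simp
  finally show ?thesis .
qed

text \<open>
  Every square matrix is a product of elementary ones, and both sides are multiplicative in the
  matrix, so the three preceding lemmas suffice; a matrix with a zero row has determinant zero.
  The change of variables is needed for an arbitrary finite index type, without a well-order on it.
\<close>

theorem nn_integral_lborel_linear:
  fixes A :: "real ^ 'n ^ 'n"
  assumes "det A \<noteq> 0" and "F \<in> borel_measurable borel"
  shows "(\<integral>\<^sup>+x. F x \<partial>lborel) = ennreal \<bar>det A\<bar> * (\<integral>\<^sup>+x. F (A *v x) \<partial>lborel)"
proof -
  let ?P = "\<lambda>A :: real ^ 'n ^ 'n. det A \<noteq> 0 \<longrightarrow> (\<forall>F. F \<in> borel_measurable borel \<longrightarrow>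
      (\<integral>\<^sup>+x. F x \<partial>lborel) = ennreal \<bar>det A\<bar> * (\<integral>\<^sup>+x. F (A *v x) \<partial>lborel))"
  have "?P A"
  proof (rule induct_matrix_elementary_alt[of ?P A])
    fix A B :: "real ^ 'n ^ 'n"
    assume A: "?P A" and B: "?P B"
    show "?P (A ** B)"
    proof (intro impI allI)
      fix F :: "real ^ 'n \<Rightarrow> ennreal"
      assume det: "det (A ** B) \<noteq> 0" and [measurable]: "F \<in> borel_measurable borel"
      have "(\<integral>\<^sup>+x. F x \<partial>lborel) = ennreal \<bar>det A\<bar> * (\<integral>\<^sup>+x. F (A *v x) \<partial>lborel)"
        using A[rule_format, of F] det by (simp only: det_mul mult_eq_0_iff de_Morgan_disj) simp
      also have "(\<integral>\<^sup>+x. F (A *v x) \<partial>lborel) = ennreal \<bar>det B\<bar> * (\<integral>\<^sup>+x. F (A *v (B *v x)) \<partial>lborel)"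
        using B[rule_format, of "\<lambda>x. F (A *v x)"] det
        by (simp only: det_mul mult_eq_0_iff de_Morgan_disj) simp
      finally show "(\<integral>\<^sup>+x. F x \<partial>lborel)
          = ennreal \<bar>det (A ** B)\<bar> * (\<integral>\<^sup>+x. F (A ** B *v x) \<partial>lborel)"
        by (simp add: det_mul abs_mult ennreal_mult mult.assoc matrix_vector_mul_assoc)
    qed
  next
    fix A :: "real ^ 'n ^ 'n" and i
    assume "row i A = 0"
    then show "?P A"
      by (simp add: det_zero_row(2))
  next
    fix A :: "real ^ 'n ^ 'n"
    assume "\<And>i j. i \<noteq> j \<Longrightarrow> A $ i $ j = 0"
    then show "?P A"
      using nn_integral_lborel_diagonal by blast
  next
    fix m n :: 'n
    let ?A = "(\<chi> i j. mat 1 $ i $ Transposition.transpose m n j) :: real ^ 'n ^ 'n"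
    have "\<bar>det ?A\<bar> = 1"
      by (simp add: det_permute_columns permutes_swap_id sign_swap_id abs_mult)
    moreover have "?A *v x = (\<chi> i. x $ Transposition.transpose m n i)" for x
    proof -
      have "(if i = Transposition.transpose m n j then 1 else 0) * x $ j
          = (if j = Transposition.transpose m n i then x $ j else 0)" for i j
        by (auto simp: transpose_involutory)
      then show ?thesis
        by (simp add: vec_eq_iff matrix_vector_mult_def mat_def)
    qed
    ultimately show "?P ?A"
      using nn_integral_lborel_swap[of _ m n] by (simp only:) simp
  next
    fix m n :: 'n
    assume mn: "m \<noteq> n"
    let ?A = "(\<chi> i j. of_bool (i = m \<and> j = n \<or> i = j)) :: real ^ 'n ^ 'n"
    have "?A = (\<chi> k. if k = m then row m (mat 1) + 1 *s row n (mat 1) else row k (mat 1))"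
      using mn by (auto simp: vec_eq_iff row_def mat_def)
    then have "det ?A = 1"
      using det_row_operation[OF mn, of "mat 1" 1] by simp
    moreover have "?A *v x = (\<chi> i. if i = m then x $ m + x $ n else x $ i)" for x
    proof -
      have "(\<Sum>j\<in>UNIV. of_bool (i = m \<and> j = n \<or> i = j) * x $ j)
          = (\<Sum>j\<in>UNIV. (if j = i then x $ i else 0) + (if i = m \<and> j = n then x $ n else 0))" for i
        using mn by (intro sum.cong) auto
      then show ?thesis
        using mn by (auto simp: vec_eq_iff matrix_vector_mult_def sum.distrib)
    qed
    ultimately show "?P ?A"
      using nn_integral_lborel_shear[OF mn] by (simp only:) simp
  qed
  then show ?thesis using assms by blast
qed

section \<open>The multivariate normal distribution\<close>

lemma symmetric_inner_commute:
  fixes A :: "real ^ 'n ^ 'n"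
  assumes "transpose A = A"
  shows "x \<bullet> (A *v y) = (A *v x) \<bullet> y"
  by (metis assms dot_lmul_matrix transpose_matrix_vector)

lemma pos_def_matrix_inv:
  fixes S :: "real ^ 'n ^ 'n"
  assumes "pos_def_matrix S"
  shows "invertible S" "S ** matrix_inv S = mat 1" "matrix_inv S ** S = mat 1"
    "pos_def_matrix (matrix_inv S)"
proof -
  have sym: "transpose S = S" and pos: "\<And>z. z \<noteq> 0 \<Longrightarrow> 0 < z \<bullet> (S *v z)"
    using assms by (auto simp: pos_def_matrix_def)
  have "z = 0" if "S *v z = 0" for z
    using pos[of z] that by auto
  then show inv: "invertible S"
    by (simp add: invertible_left_inverse matrix_left_invertible_ker)
  have ex: "\<exists>A'. S ** A' = mat 1 \<and> A' ** S = mat 1"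
    using inv by (simp add: invertible_def)
  show r: "S ** matrix_inv S = mat 1" and l: "matrix_inv S ** S = mat 1"
    using someI_ex[OF ex] by (simp_all add: matrix_inv_def)
  have "transpose (matrix_inv S) ** S = mat 1"
    using arg_cong[OF r, of transpose] by (simp add: matrix_transpose_mul sym transpose_mat)
  then have symi: "transpose (matrix_inv S) = matrix_inv S"
    by (metis matrix_mul_assoc matrix_mul_lid matrix_mul_rid r)
  have "0 < z \<bullet> (matrix_inv S *v z)" if "z \<noteq> 0" for z
  proof -
    have z: "S *v (matrix_inv S *v z) = z"
      by (simp add: matrix_vector_mul_assoc r)
    then have "matrix_inv S *v z \<noteq> 0"
      using that by (metis matrix_vector_mult_0_right)
    from pos[OF this] show ?thesis
      by (simp add: z inner_commute)
  qed
  then show "pos_def_matrix (matrix_inv S)"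
    by (simp add: pos_def_matrix_def symi)
qed

text \<open>Gram-Schmidt orthonormalisation for the inner product \<open>x \<bullet> (Q *v y)\<close>.\<close>

lemma pos_def_orthonormal:
  fixes Q :: "real ^ 'n ^ 'n"
  assumes Q: "pos_def_matrix Q" and "finite F"
  shows "\<exists>b :: 'n \<Rightarrow> real ^ 'n. \<forall>i\<in>F. \<forall>j\<in>F. b i \<bullet> (Q *v b j) = of_bool (i = j)"
  using \<open>finite F\<close>
proof (induction F rule: finite_induct)
  case (insert k F)
  have sym: "x \<bullet> (Q *v y) = y \<bullet> (Q *v x)" for x y
    using symmetric_inner_commute[of Q x y] Q by (simp add: pos_def_matrix_def inner_commute)
  obtain b :: "'n \<Rightarrow> real ^ 'n" where b: "\<And>i j. i \<in> F \<Longrightarrow> j \<in> F \<Longrightarrow> b i \<bullet> (Q *v b j) = of_bool (i = j)"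
    using insert.IH by blast
  have "card (b ` F) \<le> card F"
    by (rule card_image_le) (rule insert.hyps)
  also have "\<dots> < CARD('n)"
    using insert.hyps by (metis UNIV_I finite_class.finite_UNIV psubset_card_mono psubsetI subset_UNIV)
  finally have "dim (b ` F) < DIM(real ^ 'n)"
    using dim_le_card[of "b ` F" "b ` F"] insert.hyps by (simp add: span_superset)
  then have "span (b ` F) \<noteq> UNIV"
    by (metis dim_UNIV dim_span less_irrefl)
  then obtain v where v: "v \<notin> span (b ` F)"
    by blast
  define u where "u = v - (\<Sum>i\<in>F. (v \<bullet> (Q *v b i)) *\<^sub>R b i)"
  have "(\<Sum>i\<in>F. (v \<bullet> (Q *v b i)) *\<^sub>R b i) \<in> span (b ` F)"
    by (intro span_sum span_scale span_base) auto
  then have "u \<noteq> 0"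
    using v by (auto simp: u_def)
  then have pos: "0 < u \<bullet> (Q *v u)"
    using Q by (simp add: pos_def_matrix_def)
  have orth: "u \<bullet> (Q *v b j) = 0" if "j \<in> F" for j
  proof -
    have "(\<Sum>i\<in>F. (v \<bullet> (Q *v b i)) * (b i \<bullet> (Q *v b j)))
        = (\<Sum>i\<in>F. if i = j then v \<bullet> (Q *v b j) else 0)"
      using b that by (intro sum.cong) auto
    then show ?thesis
      using that insert.hyps by (simp add: u_def inner_diff_left inner_sum_left)
  qed
  define w where "w = (1 / sqrt (u \<bullet> (Q *v u))) *\<^sub>R u"
  have "w \<bullet> (Q *v w) = 1"
    using pos by (simp add: w_def matrix_vector_mult_scaleR field_simps)
  moreover have "w \<bullet> (Q *v b j) = 0" "b j \<bullet> (Q *v w) = 0" if "j \<in> F" for j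
    using orth[OF that] sym[of "b j" w] by (simp_all add: w_def)
  ultimately have "\<forall>i\<in>insert k F. \<forall>j\<in>insert k F. (b(k := w)) i \<bullet> (Q *v (b(k := w)) j) = of_bool (i = j)"
    using insert.hyps b by auto
  then show ?case by blast
qed simp

text \<open>
  The columns of \<open>B\<close> are orthonormal for the inverse of \<open>S\<close>. The map \<open>w \<mapsto> B *v w\<close> thus turns the
  exponent of the normal density with covariance \<open>S\<close> into that of the standard normal density.
\<close>

lemma pos_def_factor:
  fixes S :: "real ^ 'n ^ 'n"
  assumes S: "pos_def_matrix S"
  obtains B where "det B \<noteq> 0" "det S = (det B)\<^sup>2" "B ** transpose B = S"
    "\<And>w. (B *v w) \<bullet> (matrix_inv S *v (B *v w)) = w \<bullet> w"
proof -
  let ?Q = "matrix_inv S"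
  obtain b :: "'n \<Rightarrow> real ^ 'n" where b: "\<And>i j. b i \<bullet> (?Q *v b j) = of_bool (i = j)"
    using pos_def_orthonormal[OF pos_def_matrix_inv(4)[OF S] finite_class.finite_UNIV] by blast
  define B where "B = (\<chi> i j. b j $ i)"
  have "(transpose B ** (?Q ** B)) $ i $ j = b i \<bullet> (?Q *v b j)" for i j
    by (simp add: matrix_matrix_mult_def transpose_def B_def matrix_vector_mult_def inner_vec_def)
  then have BQB: "transpose B ** (?Q ** B) = mat 1"
    by (simp add: vec_eq_iff b mat_def)
  have d: "det B * det ?Q * det B = 1"
    using arg_cong[OF BQB, of det] by (simp add: det_mul det_transpose)
  have dS: "det S * det ?Q = 1"
    using arg_cong[OF pos_def_matrix_inv(2)[OF S], of det] by (simp add: det_mul)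
  have "?Q ** (B ** transpose B) = mat 1"
    using matrix_left_right_inverse1[OF BQB] by (simp add: matrix_mul_assoc)
  then have "B ** transpose B = S"
    using pos_def_matrix_inv(2)[OF S] by (metis matrix_mul_assoc matrix_mul_lid matrix_mul_rid)
  moreover have "det S = (det B)\<^sup>2"
    by (metis calculation det_mul det_transpose power2_eq_square)
  moreover have "det B \<noteq> 0"
    using d by auto
  moreover have "(B *v w) \<bullet> (?Q *v (B *v w)) = w \<bullet> w" for w
  proof -
    have "(B *v w) \<bullet> (?Q *v (B *v w)) = w \<bullet> (transpose B *v (?Q *v (B *v w)))"
      by (metis dot_lmul_matrix inner_commute transpose_matrix_vector)
    also have "\<dots> = w \<bullet> w"
      using BQB by (simp add: matrix_vector_mul_assoc matrix_mul_assoc)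
    finally show ?thesis .
  qed
  ultimately show thesis
    using that by blast
qed

lemma PiM_density_lborel:
  fixes g :: "real \<Rightarrow> ennreal"
  assumes [measurable]: "g \<in> borel_measurable borel" and "prob_space (density lborel g)"
  shows "density (\<Pi>\<^sub>M i\<in>(UNIV :: 'n::finite set). lborel) (\<lambda>f. \<Prod>i\<in>UNIV. g (f i))
      = (\<Pi>\<^sub>M i\<in>UNIV. density lborel g)"
proof -
  interpret L: product_sigma_finite "\<lambda>_::'n. lborel :: real measure" ..
  interpret D: prob_space "density lborel g" by fact
  interpret P: product_sigma_finite "\<lambda>_::'n. density lborel g" ..
  show ?thesis
  proof (rule P.PiM_eqI)
    show "sets (density (\<Pi>\<^sub>M i\<in>(UNIV :: 'n set). lborel) (\<lambda>f. \<Prod>i\<in>UNIV. g (f i)))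
        = sets (\<Pi>\<^sub>M i\<in>UNIV. density lborel g)"
      by (simp cong: sets_PiM_cong)
    fix A :: "'n \<Rightarrow> real set"
    assume A: "\<And>i. i \<in> UNIV \<Longrightarrow> A i \<in> sets (density lborel g)"
    then have [measurable]: "A i \<in> sets borel" for i by simp
    have ind: "indicator (Pi\<^sub>E UNIV A) f = (\<Prod>i\<in>UNIV. indicator (A i) (f i) :: ennreal)" for f
      by (auto simp: indicator_def PiE_def Pi_iff prod_zero_iff)
    have "emeasure (density (\<Pi>\<^sub>M i\<in>UNIV. lborel) (\<lambda>f. \<Prod>i\<in>UNIV. g (f i))) (Pi\<^sub>E UNIV A)
        = (\<integral>\<^sup>+f. (\<Prod>i\<in>UNIV. g (f i) * indicator (A i) (f i)) \<partial>(\<Pi>\<^sub>M i\<in>UNIV. lborel))"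
      by (subst emeasure_density) (auto simp: ind prod.distrib intro!: sets_PiM_I_finite)
    also have "\<dots> = (\<Prod>i\<in>UNIV. \<integral>\<^sup>+x. g x * indicator (A i) x \<partial>lborel)"
      by (rule L.product_nn_integral_prod) auto
    also have "\<dots> = (\<Prod>i\<in>UNIV. emeasure (density lborel g) (A i))"
      by (intro prod.cong) (auto simp: emeasure_density)
    finally show "emeasure (density (\<Pi>\<^sub>M i\<in>UNIV. lborel) (\<lambda>f. \<Prod>i\<in>UNIV. g (f i))) (Pi\<^sub>E UNIV A)
        = (\<Prod>i\<in>UNIV. emeasure (density lborel g) (A i))" .
  qed simp
qed

abbreviation std_normal_product :: "('n::finite \<Rightarrow> real) measure" where
  "std_normal_product \<equiv> (\<Pi>\<^sub>M i\<in>UNIV. std_normal_distribution)"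

text \<open>
  The substitution \<open>z = B *v w\<close> makes the density a product of standard normal densities; its
  Jacobian \<open>\<bar>det B\<bar>\<close> cancels the square root of \<open>det S\<close> in the normalising constant. So the density
  in the definition of the multivariate normal distribution has total mass one, and its
  characteristic function is a product of one-dimensional ones.
\<close>

theorem mv_normal_eq_distr:
  fixes S :: "real ^ 'n ^ 'n"
  assumes B: "det B \<noteq> 0" "det S = (det B)\<^sup>2"
    and quad: "\<And>w. (B *v w) \<bullet> (matrix_inv S *v (B *v w)) = w \<bullet> w"
  shows "mv_normal 0 S
      = distr std_normal_product borel (\<lambda>f. B *v (\<chi> i. f i))"
proof (rule measure_eqI)
  let ?P = "\<Pi>\<^sub>M i\<in>(UNIV :: 'n set). (lborel :: real measure)"
  define dens where "dens z = ennreal (exp (- (z \<bullet> (matrix_inv S *v z)) / 2) /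
      sqrt ((2 * pi) ^ CARD('n) * det S))" for z
  have [measurable]: "dens \<in> borel_measurable borel"
  proof -
    have "(\<lambda>z. z \<bullet> (matrix_inv S *v z)) \<in> borel_measurable borel"
      by (intro borel_measurable_inner) simp_all
    then show ?thesis unfolding dens_def by measurable
  qed
  have vl [measurable]: "(\<lambda>f. \<chi> i. f i) \<in> ?P \<rightarrow>\<^sub>M (borel :: (real ^ 'n) measure)"
    by (rule borel_measurable_vec_lambda) simp
  have PiM: "std_normal_product
      = density ?P (\<lambda>f. \<Prod>i\<in>UNIV. ennreal (std_normal_density (f i)))"
    by (rule PiM_density_lborel[symmetric]) (auto intro: prob_space_normal_density)
  show "sets (mv_normal 0 S) = sets (distr std_normal_product borel (\<lambda>f. B *v (\<chi> i. f i)))"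
    by (simp add: mv_normal_def)
  have key: "ennreal \<bar>det B\<bar> * dens (B *v (\<chi> i. f i)) = (\<Prod>i\<in>UNIV. ennreal (std_normal_density (f i)))"
    for f :: "'n \<Rightarrow> real"
  proof -
    have "(\<Prod>i\<in>UNIV. std_normal_density (f i))
        = (1 / sqrt (2 * pi)) ^ CARD('n) * exp (- (\<Sum>i\<in>UNIV. (f i)\<^sup>2) / 2)"
      by (simp add: std_normal_density_def prod_dividef power_divide sum_negf sum_divide_distrib
          flip: exp_sum)
    moreover have q: "(B *v (\<chi> i. f i)) \<bullet> (matrix_inv S *v (B *v (\<chi> i. f i))) = (\<Sum>i\<in>UNIV. (f i)\<^sup>2)"
      unfolding quad by (simp add: inner_vec_def power2_eq_square)
    moreover have "\<bar>det B\<bar> * (exp (- ((B *v (\<chi> i. f i)) \<bullet> (matrix_inv S *v (B *v (\<chi> i. f i)))) / 2) /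
      sqrt ((2 * pi) ^ CARD('n) * det S)) = (1 / sqrt (2 * pi)) ^ CARD('n) * exp (- (\<Sum>i\<in>UNIV. (f i)\<^sup>2) / 2)"
      unfolding q B(2) real_sqrt_mult[of "(2 * pi) ^ CARD('n)"] real_sqrt_power[of "2 * pi"] real_sqrt_abs
      using B(1) by (simp add: power_divide)
    ultimately show ?thesis
      unfolding dens_def by (simp add: prod_ennreal flip: ennreal_mult')
  qed
  fix X assume "X \<in> sets (mv_normal 0 S)"
  then have [measurable]: "X \<in> sets borel" by (simp add: mv_normal_def)
  have mB: "(\<lambda>f. B *v (\<chi> i. f i)) \<in> ?P \<rightarrow>\<^sub>M borel"
    by (rule measurable_compose[OF vl]) simp
  have "mv_normal 0 S = density lborel dens"
    by (simp add: mv_normal_def dens_def[abs_def])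
  then have "emeasure (mv_normal 0 S) X = (\<integral>\<^sup>+z. dens z * indicator X z \<partial>lborel)"
    by (simp add: emeasure_density)
  also have "\<dots> = ennreal \<bar>det B\<bar> * (\<integral>\<^sup>+z. dens (B *v z) * indicator X (B *v z) \<partial>lborel)"
    by (rule nn_integral_lborel_linear[OF B(1)]) simp
  also have "\<dots> = (\<integral>\<^sup>+z. ennreal \<bar>det B\<bar> * (dens (B *v z) * indicator X (B *v z)) \<partial>lborel)"
    by (rule nn_integral_cmult[symmetric]) simp
  also have "\<dots> = (\<integral>\<^sup>+f. ennreal \<bar>det B\<bar> * (dens (B *v (\<chi> i. f i)) * indicator X (B *v (\<chi> i. f i))) \<partial>?P)"
    by (subst lborel_eq_distr_PiM) (simp add: nn_integral_distr)
  also have "\<dots> = (\<integral>\<^sup>+f. (\<Prod>i\<in>UNIV. ennreal (std_normal_density (f i))) * indicator X (B *v (\<chi> i. f i)) \<partial>?P)"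
    by (simp only: mult.assoc[symmetric] key)
  also have "\<dots> = (\<integral>\<^sup>+f. indicator X (B *v (\<chi> i. f i)) \<partial>std_normal_product)"
    unfolding PiM by (rule nn_integral_density[symmetric]) (use mB in simp_all)
  also have "\<dots> = emeasure (distr std_normal_product borel (\<lambda>f. B *v (\<chi> i. f i))) X"
  proof -
    have [measurable]: "(\<lambda>f. B *v (\<chi> i. f i)) \<in> std_normal_product \<rightarrow>\<^sub>M borel"
      using mB unfolding PiM by simp
    show ?thesis
      by (subst emeasure_distr)
        (auto simp: nn_integral_indicator[symmetric] indicator_def simp del: nn_integral_indicator intro!: nn_integral_cong)
  qed
  finally show "emeasure (mv_normal 0 S) X
      = emeasure (distr std_normal_product borel (\<lambda>f. B *v (\<chi> i. f i))) X" .
qed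

lemma sets_mv_normal [simp, measurable_cong]: "sets (mv_normal \<mu> S) = sets borel"
  by (simp add: mv_normal_def)

theorem
  fixes S :: "real ^ 'n ^ 'n"
  assumes S: "pos_def_matrix S"
  shows mv_normal_prob_space: "prob_space (mv_normal 0 S)"
    and mv_normal_char: "(\<integral>z. iexp (t \<bullet> z) \<partial>mv_normal 0 S) = exp (- (t \<bullet> (S *v t)) / 2)"
proof -
  obtain B where B: "det B \<noteq> 0" "det S = (det B)\<^sup>2" "B ** transpose B = S"
    "\<And>w. (B *v w) \<bullet> (matrix_inv S *v (B *v w)) = w \<bullet> w"
    by (rule pos_def_factor[OF S]) blast
  interpret N: prob_space std_normal_distribution
    by (rule prob_space_normal_density) simp
  interpret P: product_prob_space "\<lambda>_::'n. std_normal_distribution" UNIV ..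
  define s where "s = transpose B *v t"
  have "(\<lambda>f. \<chi> i. f i) \<in> std_normal_product \<rightarrow>\<^sub>M (borel :: (real ^ 'n) measure)"
    by (rule borel_measurable_vec_lambda) simp
  then have B_meas [measurable]: "(\<lambda>f. B *v (\<chi> i. f i)) \<in> std_normal_product \<rightarrow>\<^sub>M borel"
    by (rule measurable_compose) simp
  then show "prob_space (mv_normal 0 S)"
    unfolding mv_normal_eq_distr[OF B(1,2,4)] by (rule P.prob_space_distr)
  have meas: "(\<lambda>z :: real ^ 'n. iexp (t \<bullet> z)) \<in> borel_measurable borel"
    by (intro borel_measurable_continuous_onI continuous_intros)
  have split: "iexp (t \<bullet> (B *v (\<chi> i. f i))) = (\<Prod>i\<in>UNIV. iexp (s $ i * f i))" for f
  proof -
    have "t \<bullet> (B *v (\<chi> i. f i)) = s \<bullet> (\<chi> i. f i)"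
      by (simp add: s_def dot_lmul_matrix transpose_matrix_vector)
    then show ?thesis
      by (simp add: inner_vec_def sum_distrib_left exp_sum)
  qed
  have "(\<integral>z. iexp (t \<bullet> z) \<partial>mv_normal 0 S)
      = (\<integral>f. (\<Prod>i\<in>UNIV. iexp (s $ i * f i)) \<partial>std_normal_product)"
    unfolding mv_normal_eq_distr[OF B(1,2,4)]
    by (subst integral_distr) (simp_all add: split meas)
  also have "\<dots> = (\<Prod>i\<in>UNIV. \<integral>x. iexp (s $ i * x) \<partial>std_normal_distribution)"
  proof (rule P.product_integral_prod)
    fix i :: 'n
    show "integrable std_normal_distribution (\<lambda>x. iexp (s $ i * x))"
      by (rule N.integrable_const_bound[where B = 1]) auto
  qed simp
  also have "\<dots> = (\<Prod>i\<in>UNIV. complex_of_real (exp (- ((s $ i)\<^sup>2) / 2)))"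
    using char_std_normal_distribution by (simp add: char_def fun_eq_iff)
  also have "\<dots> = exp (- (s \<bullet> s) / 2)"
    by (simp add: inner_vec_def power2_eq_square sum_negf sum_divide_distrib flip: exp_sum of_real_prod)
  also have "s \<bullet> s = t \<bullet> (S *v t)"
    by (simp add: s_def B(3)[symmetric] flip: matrix_vector_mul_assoc)
      (simp add: dot_lmul_matrix transpose_matrix_vector inner_commute)
  finally show "(\<integral>z. iexp (t \<bullet> z) \<partial>mv_normal 0 S) = exp (- (t \<bullet> (S *v t)) / 2)" .
qed

lemma mv_normal_null:
  fixes S :: "real ^ 'n ^ 'n"
  assumes "A \<in> null_sets lborel"
  shows "measure (mv_normal \<mu> S) A = 0"
proof -
  have "(\<lambda>z. (z - \<mu>) \<bullet> (matrix_inv S *v (z - \<mu>))) \<in> borel_measurable borel"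
    by (intro borel_measurable_inner measurable_compose[OF _ borel_measurable_matrix_vector_mult]) simp_all
  then have "A \<in> null_sets (mv_normal \<mu> S)"
    unfolding mv_normal_def using assms
    by (subst null_sets_density_iff) (auto intro: AE_I' null_setsD2 AE_not_in elim: eventually_mono)
  then show ?thesis
    by (simp add: measure_eq_0_null_sets)
qed

section \<open>Convergence in distribution from characteristic functions\<close>

inductive_set exp_sums :: "('b::euclidean_space \<Rightarrow> complex) set" where
  iexp: "(\<lambda>x. c * iexp (t \<bullet> x)) \<in> exp_sums"
| add: "f \<in> exp_sums \<Longrightarrow> g \<in> exp_sums \<Longrightarrow> (\<lambda>x. f x + g x) \<in> exp_sums"

lemma exp_sums_const: "(\<lambda>x. c) \<in> exp_sums"
  using exp_sums.iexp[of c 0] by simp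

lemma exp_sums_sum:
  assumes "\<And>i. i \<in> I \<Longrightarrow> f i \<in> exp_sums"
  shows "(\<lambda>x. \<Sum>i\<in>I. f i x) \<in> exp_sums"
  using assms by (induction I rule: infinite_finite_induct) (auto intro: exp_sums_const exp_sums.add)

lemma exp_sums_mult:
  assumes "f \<in> exp_sums" "g \<in> exp_sums"
  shows "(\<lambda>x. f x * g x) \<in> exp_sums"
  using assms(1)
proof induction
  case (iexp c t)
  from assms(2) show ?case
  proof induction
    case (iexp d s)
    have "(\<lambda>x. c * iexp (t \<bullet> x) * (d * iexp (s \<bullet> x))) = (\<lambda>x. (c * d) * iexp ((t + s) \<bullet> x))"
      by (auto simp: fun_eq_iff inner_add_left algebra_simps exp_add)
    then show ?case by (simp add: exp_sums.iexp)
  next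
    case (add g h)
    then show ?case by (simp add: distrib_left exp_sums.add)
  qed
next
  case (add f h)
  then show ?case by (simp add: distrib_right exp_sums.add)
qed

lemma exp_sums_sin: "(\<lambda>x. complex_of_real (sin (t \<bullet> x))) \<in> exp_sums"
proof -
  have eq: "(\<lambda>x. complex_of_real (sin (t \<bullet> x)))
      = (\<lambda>x. (1 / (2 * \<i>)) * iexp (t \<bullet> x) + (- (1 / (2 * \<i>))) * iexp ((- t) \<bullet> x))"
    by (rule ext) (simp add: sin_exp_eq field_simps flip: sin_of_real)
  show ?thesis
    unfolding eq by (rule exp_sums.add[OF exp_sums.iexp exp_sums.iexp])
qed

lemma exp_sums_continuous: "f \<in> exp_sums \<Longrightarrow> continuous_on UNIV f"
  by (induction rule: exp_sums.induct) (auto intro!: continuous_intros)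

lemma exp_sums_bounded: "f \<in> exp_sums \<Longrightarrow> \<exists>K. \<forall>x. norm (f x) \<le> K"
proof (induction rule: exp_sums.induct)
  case (iexp c t)
  show ?case by (rule exI[of _ "norm c"]) (simp add: norm_mult)
next
  case (add f g)
  then obtain K L where "\<forall>x. norm (f x) \<le> K" "\<forall>x. norm (g x) \<le> L" by blast
  then have "\<forall>x. norm (f x + g x) \<le> K + L"
    by (meson add_mono norm_triangle_ineq order_trans)
  then show ?case by blast
qed

text \<open>
  The map \<open>sin_map m\<close> sends the whole space into a cube and is undone by \<open>arcsin_map m\<close> on the ball of
  radius \<open>m\<close>. A polynomial in its value is a trigonometric sum, bounded on the whole space. This is
  what turns polynomial approximation on a compact cube into approximation by trigonometric sums
  that is close on the ball and keeps the bound elsewhere.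
\<close>

definition sin_map :: "real \<Rightarrow> 'b::euclidean_space \<Rightarrow> 'b" where
  "sin_map m x = (\<Sum>b\<in>Basis. sin ((x \<bullet> b) / m) *\<^sub>R b)"

definition arcsin_map :: "real \<Rightarrow> 'b::euclidean_space \<Rightarrow> 'b" where
  "arcsin_map m y = (\<Sum>b\<in>Basis. (m * arcsin (y \<bullet> b)) *\<^sub>R b)"

lemma exp_sums_polynomial_sin_map:
  assumes "real_polynomial_function p"
  shows "(\<lambda>x :: 'b::euclidean_space. complex_of_real (p (sin_map m x))) \<in> exp_sums"
  using assms
proof induction
  case (linear f)
  interpret bounded_linear f by fact
  have "complex_of_real (f (sin_map m x))
      = (\<Sum>b\<in>Basis. of_real (f b) * of_real (sin ((b /\<^sub>R m) \<bullet> x)))" for x :: 'b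
    by (simp add: sin_map_def sum scaleR inner_commute divide_inverse mult.commute)
  then have eq: "(\<lambda>x :: 'b. complex_of_real (f (sin_map m x)))
      = (\<lambda>x. \<Sum>b\<in>Basis. of_real (f b) * of_real (sin ((b /\<^sub>R m) \<bullet> x)))"
    by (rule ext)
  show ?case
    unfolding eq by (intro exp_sums_sum exp_sums_mult exp_sums_const exp_sums_sin)
next
  case (const c)
  show ?case by (rule exp_sums_const)
next
  case (add f g)
  show ?case
    using exp_sums.add[OF add.IH] by simp
next
  case (mult f g)
  show ?case
    using exp_sums_mult[OF mult.IH] by simp
qed

lemma sin_map_in_cube: "sin_map m x \<in> cbox (- One) One"
  by (auto simp: mem_box sin_map_def)

lemma arcsin_sin_map:
  assumes "m > 0" "norm x \<le> m"
  shows "arcsin_map m (sin_map m x) = x"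
proof -
  have "m * arcsin (sin_map m x \<bullet> b) = x \<bullet> b" if b: "b \<in> Basis" for b
  proof -
    have "\<bar>x \<bullet> b\<bar> \<le> m"
      using Basis_le_norm[OF b, of x] assms by linarith
    moreover have "pi / 2 > 1"
      using pi_gt3 by simp
    ultimately have "\<bar>(x \<bullet> b) / m\<bar> \<le> 1" "1 < pi / 2"
      using assms(1) by (simp_all add: abs_divide)
    then have "arcsin (sin ((x \<bullet> b) / m)) = (x \<bullet> b) / m"
      by (intro arcsin_sin) (simp_all only: abs_le_iff, linarith+)
    then show ?thesis
      using b assms by (simp add: sin_map_def)
  qed
  then show ?thesis
    by (simp add: arcsin_map_def euclidean_representation)
qed

lemma exp_sums_approx:
  fixes g :: "'b::euclidean_space \<Rightarrow> real"
  assumes cont: "continuous_on UNIV g" and bdd: "\<And>x. \<bar>g x\<bar> \<le> K" and "\<eta> > 0" "m > 0"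
  obtains F where "F \<in> exp_sums" "\<And>x. norm (F x) \<le> K + \<eta>"
    "\<And>x. norm x \<le> m \<Longrightarrow> norm (F x - of_real (g x)) \<le> \<eta>"
proof -
  let ?Q = "cbox (- One) One :: 'b set"
  have "continuous_on ?Q (arcsin_map m)"
    unfolding arcsin_map_def
    by (intro continuous_intros) (auto simp: mem_box)
  then have "continuous_on ?Q (\<lambda>y. g (arcsin_map m y))"
    by (rule continuous_on_compose2[OF cont]) auto
  then obtain p where p: "real_polynomial_function p"
    "\<And>y. y \<in> ?Q \<Longrightarrow> \<bar>g (arcsin_map m y) - p y\<bar> < \<eta>"
    using Stone_Weierstrass_real_polynomial_function[OF compact_cbox _ \<open>\<eta> > 0\<close>] by blast
  show thesis
  proof (rule that[of "\<lambda>x. of_real (p (sin_map m x))"])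
    show "(\<lambda>x. complex_of_real (p (sin_map m x))) \<in> exp_sums"
      by (rule exp_sums_polynomial_sin_map) fact
    show "norm (complex_of_real (p (sin_map m x))) \<le> K + \<eta>" for x
      using p(2)[OF sin_map_in_cube, of m x] bdd[of "arcsin_map m (sin_map m x)"] by simp
    show "norm (complex_of_real (p (sin_map m x)) - of_real (g x)) \<le> \<eta>" if "norm x \<le> m" for x
      using p(2)[OF sin_map_in_cube, of m x] arcsin_sin_map[OF \<open>m > 0\<close> that]
      by (simp flip: of_real_diff)
  qed
qed

lemma (in prob_space) tight_single:
  fixes X :: "'a \<Rightarrow> 'b::euclidean_space"
  assumes [measurable]: "X \<in> borel_measurable M" and "\<epsilon> > 0"
  shows "\<exists>R. prob {w \<in> space M. R < norm (X w)} \<le> \<epsilon>"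
proof -
  let ?A = "\<lambda>n :: nat. {w \<in> space M. real n < norm (X w)}"
  have "(\<lambda>n. prob (?A n)) \<longlonglongrightarrow> prob (\<Inter>n. ?A n)"
    by (rule finite_Lim_measure_decseq) (auto simp: decseq_def)
  moreover have "(\<Inter>n. ?A n) = {}"
  proof safe
    fix w assume *: "w \<in> (\<Inter>n. ?A n)"
    obtain n :: nat where "norm (X w) < real n"
      using reals_Archimedean2 by blast
    then show "w \<in> {}"
      using *[THEN INT_D, of n] by auto
  qed
  ultimately have "(\<lambda>n. prob (?A n)) \<longlonglongrightarrow> 0" by simp
  then have "eventually (\<lambda>n. prob (?A n) < \<epsilon>) sequentially"
    using assms(2) by (rule order_tendstoD)
  then obtain n where "prob (?A n) < \<epsilon>"
    by (auto simp: eventually_sequentially)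
  then show ?thesis
    using less_imp_le by blast
qed

lemma (in prob_space) expectation_diff_le_of_close:
  fixes X Y :: "'a \<Rightarrow> 'c::{banach, second_countable_topology}"
  assumes [measurable]: "X \<in> borel_measurable M" "Y \<in> borel_measurable M" "A \<in> sets M"
    and bX: "\<And>w. w \<in> space M \<Longrightarrow> norm (X w) \<le> K" and bY: "\<And>w. w \<in> space M \<Longrightarrow> norm (Y w) \<le> L"
    and close: "\<And>w. w \<in> space M \<Longrightarrow> w \<notin> A \<Longrightarrow> norm (X w - Y w) \<le> \<eta>" and "\<eta> \<ge> 0"
  shows "norm (expectation X - expectation Y) \<le> \<eta> + (K + L) * prob A"
proof -
  have iX: "integrable M X"
    by (rule integrable_const_bound[where B = K]) (use bX in auto)
  have iY: "integrable M Y"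
    by (rule integrable_const_bound[where B = L]) (use bY in auto)
  have iA: "integrable M (indicat_real A)"
    by (rule integrable_real_indicator) (auto simp: emeasure_eq_measure)
  have "norm (expectation X - expectation Y) = norm (expectation (\<lambda>w. X w - Y w))"
    using iX iY by simp
  also have "\<dots> \<le> expectation (\<lambda>w. norm (X w - Y w))"
    by (rule integral_norm_bound)
  also have "\<dots> \<le> expectation (\<lambda>w. \<eta> + (K + L) * indicat_real A w)"
  proof (rule integral_mono)
    fix w assume w: "w \<in> space M"
    show "norm (X w - Y w) \<le> \<eta> + (K + L) * indicat_real A w"
    proof (cases "w \<in> A")
      case True
      have "norm (X w - Y w) \<le> K + L"
        using bX[OF w] bY[OF w] norm_triangle_ineq4[of "X w" "Y w"] by linarith
      then show ?thesis using True \<open>\<eta> \<ge> 0\<close> by simp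
    next
      case False
      then show ?thesis using close[OF w] by simp
    qed
  qed (use iX iY iA in auto)
  also have "\<dots> = \<eta> + (K + L) * prob A"
    using iA by (simp add: prob_space)
  finally show ?thesis .
qed

lemma (in prob_space) prob_le_expectation:
  fixes g :: "'a \<Rightarrow> real"
  assumes [measurable]: "A \<in> sets M" "g \<in> borel_measurable M"
    and g: "\<And>w. w \<in> space M \<Longrightarrow> indicator A w \<le> g w" "\<And>w. w \<in> space M \<Longrightarrow> g w \<le> 1"
  shows "prob A \<le> expectation g"
proof -
  have "0 \<le> g w" if "w \<in> space M" for w
    using g(1)[OF that] by (meson indicator_pos_le order_trans)
  then have "integrable M g"
    using g(2) by (intro integrable_const_bound[where B = 1]) auto
  then have "expectation (indicat_real A) \<le> expectation g"
    using g(1) by (intro integral_mono) (auto simp: emeasure_eq_measure)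
  then show ?thesis by simp
qed

text \<open>
  The approximation by trigonometric sums is uniform on a ball that carries all but little of the mass of every
  \<open>Z n\<close> and of \<open>D\<close>; both \<open>g\<close> and its approximation are bounded, so the rest contributes little.
\<close>

theorem conv_in_distribution_if_char:
  fixes Z :: "nat \<Rightarrow> 'w \<Rightarrow> 'b::euclidean_space"
  assumes M: "prob_space M" and D: "prob_space D" and [measurable_cong]: "sets D = sets borel"
    and [measurable]: "\<And>n. Z n \<in> borel_measurable M"
    and tight: "\<And>\<epsilon>. \<epsilon> > 0 \<Longrightarrow> \<exists>R. \<forall>n. measure M {w \<in> space M. R < norm (Z n w)} \<le> \<epsilon>"
    and char: "\<And>t. (\<lambda>n. \<integral>w. iexp (t \<bullet> Z n w) \<partial>M) \<longlonglongrightarrow> (\<integral>z. iexp (t \<bullet> z) \<partial>D)"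
  shows "conv_in_distribution M Z D"
proof -
  interpret M: prob_space M by fact
  interpret D: prob_space D by fact
  have exp_sums_meas: "(\<lambda>w. F (X w)) \<in> borel_measurable N"
    if "F \<in> exp_sums" "X \<in> borel_measurable N" for F and X :: "'x \<Rightarrow> 'b" and N
    by (rule measurable_compose[OF that(2) borel_measurable_continuous_onI[OF exp_sums_continuous[OF that(1)]]])
  have int_Z: "integrable M (\<lambda>w. F (Z n w))" and int_D: "integrable D F" if F: "F \<in> exp_sums" for F n
  proof -
    obtain K where "\<forall>x. norm (F x) \<le> K"
      using exp_sums_bounded[OF F] by blast
    then show "integrable M (\<lambda>w. F (Z n w))" "integrable D F"
      using exp_sums_meas[OF F, of "\<lambda>z. z" D] exp_sums_meas[OF F, of "Z n" M]
      by (auto intro!: M.integrable_const_bound[where B = K] D.integrable_const_bound[where B = K])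
  qed
  have conv: "(\<lambda>n. \<integral>w. F (Z n w) \<partial>M) \<longlonglongrightarrow> (\<integral>z. F z \<partial>D)" if "F \<in> exp_sums" for F
    using that
  proof induction
    case (iexp c t)
    then show ?case
      using tendsto_mult_left[OF char, of c t] by simp
  next
    case (add f g)
    then show ?case
      using int_Z int_D by (simp add: tendsto_add)
  qed
  show ?thesis
    unfolding conv_in_distribution_def
  proof (intro conjI allI impI)
    fix g :: "'b \<Rightarrow> real" assume "continuous_on UNIV g \<and> bounded (range g)"
    then have g: "continuous_on UNIV g" and "bounded (range g)" by auto
    have [measurable]: "g \<in> borel_measurable borel"
      by (rule borel_measurable_continuous_onI) fact
    obtain K where K: "\<And>x. \<bar>g x\<bar> \<le> K" and "K > 0"
      using \<open>bounded (range g)\<close> by (auto simp: bounded_pos)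
    show "(\<lambda>n. \<integral>w. g (Z n w) \<partial>M) \<longlonglongrightarrow> (\<integral>z. g z \<partial>D)"
    proof (rule tendstoI)
      fix \<epsilon> :: real assume "\<epsilon> > 0"
      define \<eta> where "\<eta> = min 1 (\<epsilon> / (4 * (2 * K + 3)))"
      have "\<eta> \<le> \<epsilon> / (4 * (2 * K + 3))" by (simp add: \<eta>_def)
      then have "\<eta> * (4 * (2 * K + 3)) \<le> \<epsilon>"
        using \<open>K > 0\<close> by (subst (asm) pos_le_divide_eq) auto
      moreover have "\<eta> > 0" "\<eta> \<le> 1"
        using \<open>\<epsilon> > 0\<close> \<open>K > 0\<close> by (simp_all add: \<eta>_def)
      ultimately have \<eta>: "\<eta> > 0" "\<eta> \<le> 1" "\<eta> * (4 * (2 * K + 3)) \<le> \<epsilon>"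
        by blast+
      obtain R1 where R1: "\<And>n. measure M {w \<in> space M. R1 < norm (Z n w)} \<le> \<eta>"
        using tight[OF \<eta>(1)] by blast
      obtain R2 where R2: "measure D {z \<in> space D. R2 < norm z} \<le> \<eta>"
        using D.tight_single[of "\<lambda>z. z", OF _ \<eta>(1)] by auto
      define m where "m = max 1 (max R1 R2)"
      have "m > 0" by (simp add: m_def)
      have mM: "measure M {w \<in> space M. m < norm (Z n w)} \<le> \<eta>" for n
        by (rule order_trans[OF M.finite_measure_mono R1[of n]]) (auto simp: m_def)
      have mD: "measure D {z \<in> space D. m < norm z} \<le> \<eta>"
        by (rule order_trans[OF D.finite_measure_mono R2]) (auto simp: m_def)
      obtain F where F: "F \<in> exp_sums" and FK: "\<And>x. norm (F x) \<le> K + \<eta>"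
        and Fg: "\<And>x. norm x \<le> m \<Longrightarrow> norm (F x - of_real (g x)) \<le> \<eta>"
        using exp_sums_approx[OF g K \<eta>(1) \<open>m > 0\<close>] by blast
      have bound: "\<eta> + (K + \<eta> + K) * q \<le> \<eta> * (2 * K + 2)" if "q \<le> \<eta>" for q
      proof -
        have "(K + \<eta> + K) * q \<le> (2 * K + 1) * \<eta>"
          using that \<eta> \<open>K > 0\<close> by (intro order_trans[OF mult_left_mono[OF that] mult_right_mono]) auto
        then show ?thesis by (simp add: algebra_simps)
      qed
      have 1: "norm ((\<integral>w. F (Z n w) \<partial>M) - (\<integral>w. complex_of_real (g (Z n w)) \<partial>M)) \<le> \<eta> * (2 * K + 2)" for n
      proof (rule order_trans[OF M.expectation_diff_le_of_close bound[OF mM[of n]]])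
        show "(\<lambda>w. F (Z n w)) \<in> borel_measurable M"
          by (rule exp_sums_meas[OF F]) simp
        show "norm (F (Z n w) - complex_of_real (g (Z n w))) \<le> \<eta>"
          if "w \<in> space M" "w \<notin> {w \<in> space M. m < norm (Z n w)}" for w
          using that Fg by auto
      qed (use FK K \<eta> in auto)
      have 2: "norm ((\<integral>z. F z \<partial>D) - (\<integral>z. complex_of_real (g z) \<partial>D)) \<le> \<eta> * (2 * K + 2)"
      proof (rule order_trans[OF D.expectation_diff_le_of_close bound[OF mD]])
        show "F \<in> borel_measurable D"
          by (rule exp_sums_meas[OF F, of "\<lambda>z. z"]) simp
        show "norm (F z - complex_of_real (g z)) \<le> \<eta>"
          if "z \<in> space D" "z \<notin> {z \<in> space D. m < norm z}" for z
          using that Fg by auto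
      qed (use FK K \<eta> in auto)
      have "eventually (\<lambda>n. norm ((\<integral>w. F (Z n w) \<partial>M) - (\<integral>z. F z \<partial>D)) < \<eta>) sequentially"
        using tendstoD[OF conv[OF F] \<eta>(1)] by (simp add: dist_norm)
      then show "eventually (\<lambda>n. dist (\<integral>w. g (Z n w) \<partial>M) (\<integral>z. g z \<partial>D) < \<epsilon>) sequentially"
      proof eventually_elim
        case (elim n)
        let ?a = "\<integral>w. complex_of_real (g (Z n w)) \<partial>M" and ?b = "\<integral>z. complex_of_real (g z) \<partial>D"
        let ?Fa = "\<integral>w. F (Z n w) \<partial>M" and ?Fb = "\<integral>z. F z \<partial>D"
        have "?a - ?b = - (?Fa - ?a) + (?Fa - ?Fb) + (?Fb - ?b)"
          by simp
        then have "norm (?a - ?b) \<le> norm (?Fa - ?a) + norm (?Fa - ?Fb) + norm (?Fb - ?b)"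
          by (metis norm_minus_cancel norm_triangle_mono order_refl norm_triangle_ineq)
        also have "\<dots> < \<eta> * (2 * K + 2) + \<eta> + \<eta> * (2 * K + 2)"
          using 1[of n] 2 elim by linarith
        also have "\<dots> \<le> \<eta> * (4 * (2 * K + 3))"
          using \<eta> \<open>K > 0\<close> by (simp add: algebra_simps)
        also have "\<dots> \<le> \<epsilon>" by (rule \<eta>(3))
        finally show ?case
          by (simp add: dist_norm flip: of_real_diff)
      qed
    qed
  qed simp
qed

theorem conv_in_distribution_closed_null:
  fixes Z :: "nat \<Rightarrow> 'w \<Rightarrow> 'b::euclidean_space"
  assumes M: "prob_space M" and D: "prob_space D" and setsD [measurable_cong]: "sets D = sets borel"
    and conv: "conv_in_distribution M Z D" and "closed C" and null: "measure D C = 0"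
  shows "(\<lambda>n. measure M {w \<in> space M. Z n w \<in> C}) \<longlonglongrightarrow> 0"
proof (cases "C = {}")
  case False
  interpret M: prob_space M by fact
  interpret D: prob_space D by fact
  have [measurable]: "Z n \<in> borel_measurable M" for n
    using conv by (simp add: conv_in_distribution_def)
  have [measurable]: "C \<in> sets borel"
    using \<open>closed C\<close> by simp
  \<comment> \<open>These continuous functions decrease to the indicator of the closed set \<open>C\<close>.\<close>
  define g where "g m z = max 0 (1 - real m * infdist z C)" for m z
  have cg: "continuous_on UNIV (g m)" for m
    unfolding g_def by (intro continuous_intros)
  then have [measurable]: "g m \<in> borel_measurable borel" for m
    by (rule borel_measurable_continuous_onI)
  have bg: "0 \<le> g m z" "g m z \<le> 1" for m z
    by (auto simp: g_def infdist_nonneg)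
  have "(\<lambda>m. \<integral>z. g m z \<partial>D) \<longlonglongrightarrow> (\<integral>z. indicat_real C z \<partial>D)"
  proof (rule integral_dominated_convergence[where w = "\<lambda>_. 1"])
    show "AE z in D. (\<lambda>m. g m z) \<longlonglongrightarrow> indicat_real C z"
    proof (rule AE_I2)
      fix z
      show "(\<lambda>m. g m z) \<longlonglongrightarrow> indicat_real C z"
      proof (cases "z \<in> C")
        case True
        then show ?thesis by (simp add: g_def)
      next
        case notin: False
        then have pos: "infdist z C > 0"
          using \<open>closed C\<close> False by (simp add: infdist_pos_not_in_closed)
        obtain N :: nat where N: "1 / infdist z C < real N"
          using reals_Archimedean2 by blast
        have "g m z = 0" if "m \<ge> N" for m
        proof -
          have "1 / infdist z C < real m"
            using N that by linarith
          then show ?thesis using pos by (simp add: g_def field_simps)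
        qed
        then have "eventually (\<lambda>m. g m z = 0) sequentially"
          by (auto simp: eventually_sequentially)
        then show ?thesis using notin by (simp add: tendsto_eventually)
      qed
    qed
  qed (use bg in auto)
  then have lim0: "(\<lambda>m. \<integral>z. g m z \<partial>D) \<longlonglongrightarrow> 0"
    using null by simp
  show ?thesis
  proof (rule tendstoI)
    fix \<epsilon> :: real assume "\<epsilon> > 0"
    have "eventually (\<lambda>m. (\<integral>z. g m z \<partial>D) < \<epsilon>) sequentially"
      using lim0 \<open>\<epsilon> > 0\<close> by (rule order_tendstoD)
    then obtain m where m: "(\<integral>z. g m z \<partial>D) < \<epsilon>"
      by (auto simp: eventually_sequentially)
    have "bounded (range (g m))"
      using bg by (auto intro!: boundedI[where B = 1])
    then have "(\<lambda>n. \<integral>w. g m (Z n w) \<partial>M) \<longlonglongrightarrow> (\<integral>z. g m z \<partial>D)"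
      using conv cg by (simp add: conv_in_distribution_def)
    then have "eventually (\<lambda>n. (\<integral>w. g m (Z n w) \<partial>M) < \<epsilon>) sequentially"
      using m by (rule order_tendstoD)
    then show "eventually (\<lambda>n. dist (measure M {w \<in> space M. Z n w \<in> C}) 0 < \<epsilon>) sequentially"
    proof eventually_elim
      case (elim n)
      have "measure M {w \<in> space M. Z n w \<in> C} \<le> (\<integral>w. g m (Z n w) \<partial>M)"
      proof (rule M.prob_le_expectation)
        show "(\<lambda>w. g m (Z n w)) \<in> borel_measurable M"
          by measurable
      qed (use bg in \<open>auto simp: indicator_def g_def\<close>)
      then show ?case using elim by simp
    qed
  qed
qed simp

lemma conv_in_distribution_tight:
  fixes Z :: "nat \<Rightarrow> 'w \<Rightarrow> 'b::euclidean_space"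
  assumes M: "prob_space M" and D: "prob_space D" and setsD [measurable_cong]: "sets D = sets borel"
    and conv: "conv_in_distribution M Z D" and "\<epsilon> > 0"
  shows "\<exists>R. \<forall>\<^sub>F n in sequentially. measure M {w \<in> space M. R < norm (Z n w)} < \<epsilon>"
proof -
  interpret M: prob_space M by fact
  interpret D: prob_space D by fact
  have [measurable]: "Z n \<in> borel_measurable M" for n
    using conv by (simp add: conv_in_distribution_def)
  have "\<epsilon> / 2 > 0" using \<open>\<epsilon> > 0\<close> by simp
  then obtain R where R: "measure D {z \<in> space D. R < norm z} \<le> \<epsilon> / 2"
    using D.tight_single[of "\<lambda>z. z" "\<epsilon> / 2"] by auto
  define g where "g z = min 1 (max 0 (norm z - R))" for z :: 'b
  have cg: "continuous_on UNIV g"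
    unfolding g_def by (intro continuous_intros)
  then have [measurable]: "g \<in> borel_measurable borel"
    by (rule borel_measurable_continuous_onI)
  have bg: "0 \<le> g z" "g z \<le> 1" for z by (auto simp: g_def)
  have "(\<integral>z. g z \<partial>D) \<le> (\<integral>z. indicat_real {z \<in> space D. R < norm z} z \<partial>D)"
  proof (rule integral_mono)
    show "integrable D g"
      by (rule D.integrable_const_bound[where B = 1]) (use bg in auto)
    show "g z \<le> indicat_real {z \<in> space D. R < norm z} z" if "z \<in> space D" for z
      using that by (auto simp: indicator_def g_def)
  qed (auto simp: D.emeasure_eq_measure)
  also have "\<dots> < \<epsilon>" using R \<open>\<epsilon> > 0\<close> by simp
  finally have "(\<integral>z. g z \<partial>D) < \<epsilon>" .
  moreover have "bounded (range g)"
    using bg by (auto intro!: boundedI[where B = 1])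
  then have "(\<lambda>n. \<integral>w. g (Z n w) \<partial>M) \<longlonglongrightarrow> (\<integral>z. g z \<partial>D)"
    using conv cg by (simp add: conv_in_distribution_def)
  ultimately have "\<forall>\<^sub>F n in sequentially. (\<integral>w. g (Z n w) \<partial>M) < \<epsilon>"
    by (metis order_tendstoD(2))
  then have "\<forall>\<^sub>F n in sequentially. measure M {w \<in> space M. R + 1 < norm (Z n w)} < \<epsilon>"
  proof eventually_elim
    case (elim n)
    have "measure M {w \<in> space M. R + 1 < norm (Z n w)} \<le> (\<integral>w. g (Z n w) \<partial>M)"
      using bg by (intro M.prob_le_expectation) (auto simp: indicator_def g_def)
    then show ?case using elim by simp
  qed
  then show ?thesis by blast
qed

theorem conv_in_distribution_slutsky:
  fixes Z Z' :: "nat \<Rightarrow> 'w \<Rightarrow> 'b::euclidean_space"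
  assumes M: "prob_space M" and D: "prob_space D" and setsD: "sets D = sets borel"
    and conv: "conv_in_distribution M Z D" and meas [measurable]: "\<And>n. Z' n \<in> borel_measurable M"
    and close: "\<And>\<epsilon> \<delta>. \<epsilon> > 0 \<Longrightarrow> \<delta> > 0 \<Longrightarrow>
      \<forall>\<^sub>F n in sequentially. measure M {w \<in> space M. \<epsilon> < norm (Z' n w - Z n w)} \<le> \<delta>"
  shows "conv_in_distribution M Z' D"
  unfolding conv_in_distribution_def
proof (intro conjI allI impI)
  interpret M: prob_space M by fact
  have [measurable]: "Z n \<in> borel_measurable M" for n
    using conv by (simp add: conv_in_distribution_def)
  fix g :: "'b \<Rightarrow> real" assume g: "continuous_on UNIV g \<and> bounded (range g)"
  then have [measurable]: "g \<in> borel_measurable borel"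
    by (auto intro: borel_measurable_continuous_onI)
  obtain K where K: "\<And>x. \<bar>g x\<bar> \<le> K" and "K > 0"
    using g by (auto simp: bounded_pos)
  have diff: "(\<lambda>n. (\<integral>w. g (Z' n w) \<partial>M) - (\<integral>w. g (Z n w) \<partial>M)) \<longlonglongrightarrow> 0"
  proof (rule tendstoI)
    fix \<epsilon> :: real assume "\<epsilon> > 0"
    define \<delta> where "\<delta> = \<epsilon> / (8 * K + 2)"
    have \<delta>: "\<delta> > 0" "\<delta> * (8 * K + 2) = \<epsilon>"
      using \<open>\<epsilon> > 0\<close> \<open>K > 0\<close> by (auto simp: \<delta>_def field_simps add_pos_pos)
    obtain R where R: "\<forall>\<^sub>F n in sequentially. measure M {w \<in> space M. R < norm (Z n w)} < \<delta>"
      using conv_in_distribution_tight[OF M D setsD conv \<delta>(1)] by blast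
    have "uniformly_continuous_on (cball 0 (R + 1)) g"
      using g by (intro compact_uniformly_continuous) (auto intro: continuous_on_subset)
    then obtain d where "d > 0"
      and d: "\<And>x y. x \<in> cball 0 (R + 1) \<Longrightarrow> y \<in> cball 0 (R + 1) \<Longrightarrow> dist y x < d \<Longrightarrow> dist (g y) (g x) < \<delta>"
      using uniformly_continuous_onE[OF _ \<delta>(1)] by blast
    define e where "e = min 1 (d / 2)"
    have e: "e > 0" "e \<le> 1" "e < d" using \<open>d > 0\<close> by (auto simp: e_def)
    have "\<forall>\<^sub>F n in sequentially. measure M {w \<in> space M. e < norm (Z' n w - Z n w)} \<le> \<delta>"
      by (rule close) fact+
    with R show "\<forall>\<^sub>F n in sequentially. dist ((\<integral>w. g (Z' n w) \<partial>M) - (\<integral>w. g (Z n w) \<partial>M)) 0 < \<epsilon>"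
    proof eventually_elim
      case (elim n)
      let ?A1 = "{w \<in> space M. R < norm (Z n w)}" and ?A2 = "{w \<in> space M. e < norm (Z' n w - Z n w)}"
      have "measure M (?A1 \<union> ?A2) \<le> measure M ?A1 + measure M ?A2"
        by (rule measure_Un_le) auto
      then have A: "measure M (?A1 \<union> ?A2) \<le> 2 * \<delta>"
        using elim by linarith
      have "norm ((\<integral>w. g (Z' n w) \<partial>M) - (\<integral>w. g (Z n w) \<partial>M)) \<le> \<delta> + (K + K) * measure M (?A1 \<union> ?A2)"
      proof (rule M.expectation_diff_le_of_close)
        fix w assume "w \<in> space M" "w \<notin> ?A1 \<union> ?A2"
        then have 1: "norm (Z n w) \<le> R" and 2: "norm (Z' n w - Z n w) \<le> e"
          by auto
        have "norm (Z' n w) \<le> R + 1"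
          using 1 2 e norm_triangle_sub[of "Z' n w" "Z n w"] by linarith
        then have "dist (g (Z' n w)) (g (Z n w)) < \<delta>"
          using 1 2 e by (intro d) (auto simp: dist_norm)
        then show "norm (g (Z' n w) - g (Z n w)) \<le> \<delta>"
          by (simp add: dist_norm)
      qed (use K \<delta> in auto)
      also have "\<dots> \<le> \<delta> + (K + K) * (2 * \<delta>)"
        using A \<open>K > 0\<close> by (intro add_left_mono mult_left_mono) auto
      also have "\<dots> < \<delta> * (8 * K + 2)"
      proof -
        have "\<delta> * (8 * K + 2) = (\<delta> + (K + K) * (2 * \<delta>)) + (\<delta> + 4 * (K * \<delta>))"
          by algebra
        moreover have "0 < K * \<delta>"
          using \<delta>(1) \<open>K > 0\<close> by simp
        ultimately show ?thesis using \<delta>(1) by linarith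
      qed
      finally show ?case using \<delta>(2) by simp
    qed
  qed
  have "(\<lambda>n. \<integral>w. g (Z n w) \<partial>M) \<longlonglongrightarrow> (\<integral>z. g z \<partial>D)"
    using conv g by (simp add: conv_in_distribution_def)
  then show "(\<lambda>n. \<integral>w. g (Z' n w) \<partial>M) \<longlonglongrightarrow> (\<integral>z. g z \<partial>D)"
    using diff by (rule Lim_transform)
qed (rule meas)

section \<open>Limit theorems for bounded random vectors\<close>

lemma distr_comp_eq:
  assumes "X \<in> borel_measurable M" "Y \<in> borel_measurable M" "distr M borel X = distr M borel Y"
    and "f \<in> borel_measurable borel"
  shows "distr M borel (\<lambda>w. f (X w)) = distr M borel (\<lambda>w. f (Y w))"
proof -
  have "distr M borel (\<lambda>w. f (X w)) = distr (distr M borel X) borel f"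
    using assms(1,4) by (simp add: distr_distr o_def)
  also have "\<dots> = distr M borel (\<lambda>w. f (Y w))"
    unfolding assms(3) using assms(2,4) by (simp add: distr_distr o_def)
  finally show ?thesis .
qed

lemma expectation_eq_of_distr_eq:
  fixes f :: "'b::topological_space \<Rightarrow> real"
  assumes [measurable]: "X \<in> borel_measurable M" "Y \<in> borel_measurable M" "f \<in> borel_measurable borel"
    and "distr M borel X = distr M borel Y"
  shows "(\<integral>w. f (X w) \<partial>M) = (\<integral>w. f (Y w) \<partial>M)"
proof -
  have "(\<integral>z. f z \<partial>distr M borel X) = (\<integral>z. f z \<partial>distr M borel Y)"
    by (simp only: assms(4))
  then show ?thesis
    by (simp add: integral_distr)
qed

lemma (in prob_space) Hoeffding_bounded_iid:
  fixes X :: "nat \<Rightarrow> 'a \<Rightarrow> real"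
  assumes indep: "indep_vars (\<lambda>_. borel) X UNIV"
    and ident: "\<And>i. distr M borel (X i) = distr M borel (X 0)"
    and bound: "\<And>i w. w \<in> space M \<Longrightarrow> \<bar>X i w\<bar> \<le> c" and "c > 0" "\<epsilon> \<ge> 0" "n > 0"
  shows "prob {w \<in> space M. \<epsilon> \<le> \<bar>(\<Sum>i<n. X i w) - n * expectation (X 0)\<bar>}
      \<le> 2 * exp (- 2 * \<epsilon>\<^sup>2 / (n * (2 * c)\<^sup>2))"
proof -
  have meas: "X i \<in> borel_measurable M" for i
    using indep by (auto simp: indep_vars_def)
  interpret H: Hoeffding_ineq_iid M "{..<n}" X "X 0" "- c" c "expectation (X 0)"
  proof unfold_locales
    show "indep_vars (\<lambda>_. borel) X {..<n}"
      using indep by (rule indep_vars_subset) auto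
    show "AE x in M. X 0 x \<in> {- c..c}"
    proof (rule AE_I2)
      fix x assume "x \<in> space M"
      then have "\<bar>X 0 x\<bar> \<le> c" by (rule bound)
      then show "X 0 x \<in> {- c..c}" unfolding atLeastAtMost_iff by linarith
    qed
    show "distr M borel (X i) = distr M borel (X 0)" for i
      by (rule ident)
  qed (use meas in auto)
  have ne: "- c < c" "{..<n} \<noteq> {}"
    using assms(4,6) by auto
  have "c - - c = 2 * c" by simp
  then show ?thesis
    using H.Hoeffding_ineq_abs_ge[OF \<open>\<epsilon> \<ge> 0\<close> ne] by (simp only: card_lessThan)
qed

lemma (in prob_space) weak_law_bounded_iid:
  fixes X :: "nat \<Rightarrow> 'a \<Rightarrow> real"
  assumes indep: "indep_vars (\<lambda>_. borel) X UNIV"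
    and ident: "\<And>i. distr M borel (X i) = distr M borel (X 0)"
    and bound: "\<And>i w. w \<in> space M \<Longrightarrow> \<bar>X i w\<bar> \<le> c" and "\<epsilon> > 0" "\<delta> > 0"
  shows "\<forall>\<^sub>F n in sequentially.
      prob {w \<in> space M. \<epsilon> < \<bar>(\<Sum>i<n. X i w) / n - expectation (X 0)\<bar>} \<le> \<delta>"
proof -
  have [measurable]: "X i \<in> borel_measurable M" for i
    using indep by (auto simp: indep_vars_def)
  define c' where "c' = max 1 c"
  have c': "c' > 0" "\<And>i w. w \<in> space M \<Longrightarrow> \<bar>X i w\<bar> \<le> c'"
    using bound by (auto simp: c'_def le_max_iff_disj)
  define a where "a = 2 * \<epsilon>\<^sup>2 / (2 * c')\<^sup>2"
  have "a > 0" using c' \<open>\<epsilon> > 0\<close> by (simp add: a_def)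
  have "(\<lambda>n. 2 * exp (- a) ^ n) \<longlonglongrightarrow> 2 * 0"
    using \<open>a > 0\<close> by (intro tendsto_intros LIMSEQ_power_zero) simp
  then have "\<forall>\<^sub>F n in sequentially. 2 * exp (- a) ^ n < \<delta>"
    using \<open>\<delta> > 0\<close> by (intro order_tendstoD) auto
  with eventually_gt_at_top[of 0] show ?thesis
  proof eventually_elim
    case (elim n)
    have "prob {w \<in> space M. \<epsilon> < \<bar>(\<Sum>i<n. X i w) / n - expectation (X 0)\<bar>}
        \<le> prob {w \<in> space M. n * \<epsilon> \<le> \<bar>(\<Sum>i<n. X i w) - n * expectation (X 0)\<bar>}"
    proof (rule finite_measure_mono)
      show "{w \<in> space M. \<epsilon> < \<bar>(\<Sum>i<n. X i w) / n - expectation (X 0)\<bar>}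
          \<subseteq> {w \<in> space M. n * \<epsilon> \<le> \<bar>(\<Sum>i<n. X i w) - n * expectation (X 0)\<bar>}"
      proof safe
        fix w assume *: "\<epsilon> < \<bar>(\<Sum>i<n. X i w) / n - expectation (X 0)\<bar>"
        have "(\<Sum>i<n. X i w) - n * expectation (X 0) = n * ((\<Sum>i<n. X i w) / n - expectation (X 0))"
          using elim by (simp add: field_simps)
        then have "\<bar>(\<Sum>i<n. X i w) - n * expectation (X 0)\<bar> = n * \<bar>(\<Sum>i<n. X i w) / n - expectation (X 0)\<bar>"
          by (simp add: abs_mult)
        then show "n * \<epsilon> \<le> \<bar>(\<Sum>i<n. X i w) - n * expectation (X 0)\<bar>"
          using * by (simp add: mult_left_mono)
      qed
    qed measurable
    also have "\<dots> \<le> 2 * exp (- 2 * (n * \<epsilon>)\<^sup>2 / (n * (2 * c')\<^sup>2))"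
      using elim \<open>\<epsilon> > 0\<close> by (intro Hoeffding_bounded_iid indep ident c') auto
    also have "- 2 * (n * \<epsilon>)\<^sup>2 / (n * (2 * c')\<^sup>2) = n * (- a)"
      using elim by (simp add: a_def power2_eq_square field_simps)
    also have "2 * exp (n * (- a)) = 2 * exp (- a) ^ n"
      by (simp only: exp_of_nat_mult)
    finally show ?case using elim by linarith
  qed
qed

text \<open>
  The radius does not depend on \<open>n\<close>, because the exponent in Hoeffding's inequality is unchanged
  when the deviation grows like \<open>sqrt n\<close>.
\<close>

lemma (in prob_space) scaled_sum_tight:
  fixes \<xi> :: "nat \<Rightarrow> 'a \<Rightarrow> real ^ 'n"
  assumes indep: "indep_vars (\<lambda>_. borel) \<xi> UNIV"
    and ident: "\<And>i. distr M borel (\<xi> i) = distr M borel (\<xi> 0)"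
    and bound: "\<And>i w. w \<in> space M \<Longrightarrow> norm (\<xi> i w) \<le> B"
    and mean: "\<And>k. expectation (\<lambda>w. \<xi> 0 w $ k) = 0" and "\<epsilon> > 0"
  shows "\<exists>R\<ge>0. \<forall>n. prob {w \<in> space M. R < norm ((1 / sqrt n) *\<^sub>R (\<Sum>i<n. \<xi> i w))} \<le> \<epsilon>"
proof -
  have [measurable]: "\<xi> i \<in> borel_measurable M" for i
    using indep by (auto simp: indep_vars_def)
  have [measurable]: "(\<lambda>w. \<xi> i w $ k) \<in> borel_measurable M" for i k
    by (rule measurable_compose[OF _ borel_measurable_vec_nth]) simp
  define c where "c = max 1 B"
  have "c > 0" by (simp add: c_def)
  have c: "\<bar>\<xi> i w $ k\<bar> \<le> c" if "w \<in> space M" for i w k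
    using bound[OF that, of i] component_le_norm_cart[of "\<xi> i w" k] by (simp add: c_def)
  let ?d = "real CARD('n)"
  \<comment> \<open>Hoeffding's bound is \<open>2 * exp (- s)\<close> for each coordinate, and \<open>s\<close> makes these add up to at most \<open>\<epsilon>\<close>.\<close>
  define s where "s = max 0 (ln (2 * ?d / \<epsilon>))"
  define r where "r = sqrt (2 * c\<^sup>2 * s)"
  have "r \<ge> 0" by (simp add: r_def s_def)
  have "exp (- s) \<le> exp (- ln (2 * ?d / \<epsilon>))"
    by (simp add: s_def)
  also have "\<dots> = \<epsilon> / (2 * ?d)"
    using \<open>\<epsilon> > 0\<close> by (simp add: exp_minus)
  finally have exps: "exp (- s) \<le> \<epsilon> / (2 * ?d)" .
  have coord: "prob {w \<in> space M. r < \<bar>((1 / sqrt n) *\<^sub>R (\<Sum>i<n. \<xi> i w)) $ k\<bar>} \<le> \<epsilon> / ?d" for n k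
  proof (cases "n = 0")
    case True
    then show ?thesis using \<open>r \<ge> 0\<close> \<open>\<epsilon> > 0\<close> by simp
  next
    case False
    have ind: "indep_vars (\<lambda>_. borel) (\<lambda>i w. \<xi> i w $ k) UNIV"
      by (rule indep_vars_compose2[OF indep]) (rule borel_measurable_vec_nth)
    have idt: "distr M borel (\<lambda>w. \<xi> i w $ k) = distr M borel (\<lambda>w. \<xi> 0 w $ k)" for i
      by (rule distr_comp_eq[OF _ _ ident]) simp_all
    have "prob {w \<in> space M. r < \<bar>((1 / sqrt n) *\<^sub>R (\<Sum>i<n. \<xi> i w)) $ k\<bar>}
        \<le> prob {w \<in> space M. r * sqrt n \<le> \<bar>(\<Sum>i<n. \<xi> i w $ k) - n * expectation (\<lambda>w. \<xi> 0 w $ k)\<bar>}"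
      using False by (intro finite_measure_mono) (auto simp: mean abs_mult field_simps)
    also have "\<dots> \<le> 2 * exp (- 2 * (r * sqrt n)\<^sup>2 / (n * (2 * c)\<^sup>2))"
      using False \<open>r \<ge> 0\<close> \<open>c > 0\<close> by (intro Hoeffding_bounded_iid ind idt c) auto
    also have "- 2 * (r * sqrt n)\<^sup>2 / (n * (2 * c)\<^sup>2) = - s"
      using False \<open>c > 0\<close> by (simp add: r_def s_def power_mult_distrib)
    also have "2 * exp (- s) \<le> \<epsilon> / ?d"
      using exps by (simp add: field_simps)
    finally show ?thesis .
  qed
  have "prob {w \<in> space M. ?d * r < norm ((1 / sqrt n) *\<^sub>R (\<Sum>i<n. \<xi> i w))} \<le> \<epsilon>" for n
  proof -
    let ?Z = "\<lambda>w. (1 / sqrt n) *\<^sub>R (\<Sum>i<n. \<xi> i w)"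
    let ?A = "\<lambda>k. {w \<in> space M. r < \<bar>?Z w $ k\<bar>}"
    have [measurable]: "(\<lambda>w. ?Z w $ k) \<in> borel_measurable M" for k
      by (rule measurable_compose[OF _ borel_measurable_vec_nth]) simp
    have "prob {w \<in> space M. ?d * r < norm (?Z w)} \<le> prob (\<Union>k\<in>UNIV. ?A k)"
    proof (rule finite_measure_mono)
      show "{w \<in> space M. ?d * r < norm (?Z w)} \<subseteq> (\<Union>k\<in>UNIV. ?A k)"
      proof (rule subsetI, rule ccontr)
        fix w assume w: "w \<in> {w \<in> space M. ?d * r < norm (?Z w)}" "w \<notin> (\<Union>k\<in>UNIV. ?A k)"
        have "norm (?Z w) \<le> (\<Sum>k\<in>UNIV. \<bar>?Z w $ k\<bar>)"
          by (rule norm_le_l1_cart)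
        also have "\<dots> \<le> (\<Sum>k\<in>(UNIV :: 'n set). r)"
          using w by (intro sum_mono) (auto simp: not_less)
        finally show False using w by simp
      qed
    qed measurable
    also have "\<dots> \<le> (\<Sum>k\<in>UNIV. prob (?A k))"
      by (rule finite_measure_subadditive_finite) auto
    also have "\<dots> \<le> (\<Sum>k\<in>(UNIV :: 'n set). \<epsilon> / ?d)"
      by (intro sum_mono coord)
    also have "\<dots> = \<epsilon>" by simp
    finally show ?thesis .
  qed
  then show ?thesis
    using \<open>r \<ge> 0\<close> by (intro exI[of _ "?d * r"]) simp
qed

text \<open>
  The Cramer-Wold device: the characteristic function at \<open>t\<close> of the scaled sum is a value of the
  characteristic function of the scaled sum of the real variables \<open>t \<bullet> \<xi> i\<close>, to which the
  one-dimensional central limit theorem applies.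
\<close>

theorem (in prob_space) multivariate_clt:
  fixes \<xi> :: "nat \<Rightarrow> 'a \<Rightarrow> real ^ 'n"
  assumes indep: "indep_vars (\<lambda>_. borel) \<xi> UNIV"
    and ident: "\<And>i. distr M borel (\<xi> i) = distr M borel (\<xi> 0)"
    and bound: "\<And>i w. w \<in> space M \<Longrightarrow> norm (\<xi> i w) \<le> B"
    and mean: "\<And>t. expectation (\<lambda>w. t \<bullet> \<xi> 0 w) = 0"
    and cov: "\<And>t. expectation (\<lambda>w. (t \<bullet> \<xi> 0 w)\<^sup>2) = t \<bullet> (S *v t)"
    and S: "pos_def_matrix S"
  shows "conv_in_distribution M (\<lambda>n w. (1 / sqrt n) *\<^sub>R (\<Sum>i<n. \<xi> i w)) (mv_normal 0 S)"
proof (rule conv_in_distribution_if_char)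
  have [measurable]: "\<xi> i \<in> borel_measurable M" for i
    using indep by (auto simp: indep_vars_def)
  show "prob_space M"
    by (rule prob_space_axioms)
  show "prob_space (mv_normal 0 S)"
    by (rule mv_normal_prob_space) fact
  show "sets (mv_normal 0 S) = sets borel" by simp
  show "(\<lambda>w. (1 / sqrt n) *\<^sub>R (\<Sum>i<n. \<xi> i w)) \<in> borel_measurable M" for n
    by measurable
  show "\<exists>R. \<forall>n. prob {w \<in> space M. R < norm ((1 / sqrt n) *\<^sub>R (\<Sum>i<n. \<xi> i w))} \<le> \<epsilon>"
    if "\<epsilon> > 0" for \<epsilon>
    using scaled_sum_tight[OF indep ident bound _ that] mean[of "axis _ 1"] by (auto simp: inner_axis')
  fix t :: "real ^ 'n"
  show "(\<lambda>n. \<integral>w. iexp (t \<bullet> ((1 / sqrt n) *\<^sub>R (\<Sum>i<n. \<xi> i w))) \<partial>M)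
      \<longlonglongrightarrow> (\<integral>z. iexp (t \<bullet> z) \<partial>mv_normal 0 S)"
  proof (cases "t = 0")
    case True
    interpret N: prob_space "mv_normal 0 S"
      by (rule mv_normal_prob_space) fact
    show ?thesis using True by (simp add: prob_space N.prob_space)
  next
    case False
    define \<sigma> where "\<sigma> = sqrt (t \<bullet> (S *v t))"
    have pos: "0 < t \<bullet> (S *v t)"
      using S False by (simp add: pos_def_matrix_def)
    then have \<sigma>: "\<sigma> > 0" "\<sigma>\<^sup>2 = t \<bullet> (S *v t)"
      by (simp_all add: \<sigma>_def)
    have [measurable]: "(\<lambda>z :: real ^ 'n. t \<bullet> z) \<in> borel_measurable borel"
      by simp
    have meas [measurable]: "(\<lambda>w. t \<bullet> \<xi> i w) \<in> borel_measurable M" for i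
      by simp
    have dist: "distr M borel (\<lambda>w. t \<bullet> \<xi> i w) = distr M borel (\<lambda>w. t \<bullet> \<xi> 0 w)" for i
      by (rule distr_comp_eq[OF _ _ ident]) simp_all
    have mean_i: "expectation (\<lambda>w. t \<bullet> \<xi> i w) = 0" for i
      using expectation_eq_of_distr_eq[of "\<xi> i" M "\<xi> 0" "\<lambda>z. t \<bullet> z", OF _ _ _ ident] mean by simp
    have sq_i: "expectation (\<lambda>w. (t \<bullet> \<xi> i w)\<^sup>2) = \<sigma>\<^sup>2" for i
      using expectation_eq_of_distr_eq[of "\<xi> i" M "\<xi> 0" "\<lambda>z. (t \<bullet> z)\<^sup>2", OF _ _ _ ident] cov \<sigma> by simp
    have bd: "\<bar>t \<bullet> \<xi> i w\<bar> \<le> norm t * B" if "w \<in> space M" for i w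
      using Cauchy_Schwarz_ineq2[of t "\<xi> i w"] bound[OF that, of i]
      by (meson mult_left_mono norm_ge_zero order_trans)
    have "weak_conv_m (\<lambda>n. distr M borel (\<lambda>w. (\<Sum>i<n. t \<bullet> \<xi> i w) / sqrt (n * \<sigma>\<^sup>2))) std_normal_distribution"
    proof (rule central_limit_theorem_zero_mean)
      show "indep_vars (\<lambda>i. borel) (\<lambda>i w. t \<bullet> \<xi> i w) UNIV"
        by (rule indep_vars_compose2[OF indep]) simp
      show "integrable M (\<lambda>w. (t \<bullet> \<xi> i w)\<^sup>2)" for i
      proof (rule integrable_const_bound[where B = "(norm t * B)\<^sup>2"])
        show "AE w in M. norm ((t \<bullet> \<xi> i w)\<^sup>2) \<le> (norm t * B)\<^sup>2"
          using bd[of _ i] by (intro AE_I2) (auto simp: abs_le_square_iff[symmetric] intro: order_trans[OF _ abs_ge_self])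
      qed simp
      show "variance (\<lambda>w. t \<bullet> \<xi> i w) = \<sigma>\<^sup>2" for i
        using mean_i[of i] sq_i[of i] by simp
      show "distr M borel (\<lambda>w. t \<bullet> \<xi> i w) = distr M borel (\<lambda>w. t \<bullet> \<xi> 0 w)" for i
        by (rule dist)
    qed (use mean_i \<sigma> in auto)
    then have "(\<lambda>n. char (distr M borel (\<lambda>w. (\<Sum>i<n. t \<bullet> \<xi> i w) / sqrt (n * \<sigma>\<^sup>2))) \<sigma>)
        \<longlonglongrightarrow> char std_normal_distribution \<sigma>"
      by (intro levy_continuity1 real_distribution_distr real_dist_normal_dist) measurable
    also have "char std_normal_distribution \<sigma> = (\<integral>z. iexp (t \<bullet> z) \<partial>mv_normal 0 S)"
      by (simp add: char_std_normal_distribution mv_normal_char[OF S] \<sigma>)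
    also have "(\<lambda>n. char (distr M borel (\<lambda>w. (\<Sum>i<n. t \<bullet> \<xi> i w) / sqrt (n * \<sigma>\<^sup>2))) \<sigma>)
        = (\<lambda>n. \<integral>w. iexp (t \<bullet> ((1 / sqrt n) *\<^sub>R (\<Sum>i<n. \<xi> i w))) \<partial>M)"
    proof
      fix n
      have "\<sigma> * ((\<Sum>i<n. t \<bullet> \<xi> i w) / sqrt (n * \<sigma>\<^sup>2)) = t \<bullet> ((1 / sqrt n) *\<^sub>R (\<Sum>i<n. \<xi> i w))" for w
      proof -
        have "sqrt (n * \<sigma>\<^sup>2) = sqrt n * \<sigma>"
          using \<sigma>(1) by (simp add: real_sqrt_mult)
        then show ?thesis
          using \<sigma>(1) by (simp add: inner_sum_right)
      qed
      then show "char (distr M borel (\<lambda>w. (\<Sum>i<n. t \<bullet> \<xi> i w) / sqrt (n * \<sigma>\<^sup>2))) \<sigma>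
          = (\<integral>w. iexp (t \<bullet> ((1 / sqrt n) *\<^sub>R (\<Sum>i<n. \<xi> i w))) \<partial>M)"
        unfolding char_def by (subst integral_distr) simp_all
    qed
    finally show ?thesis .
  qed
qed

section \<open>Local expansion of the logistic likelihood\<close>

definition logistic :: "real \<Rightarrow> real" where
  "logistic \<eta> = exp \<eta> / (1 + exp \<eta>)"

lemma logistic_bounds: "0 < logistic \<eta>" "logistic \<eta> < 1"
  by (simp_all add: logistic_def add_pos_pos field_simps)

lemma continuous_on_logistic: "continuous_on S logistic"
  unfolding logistic_def
  by (intro continuous_intros) (metis add_pos_pos exp_gt_zero less_irrefl zero_less_one)

lemma DERIV_\<phi>: "(\<phi> has_real_derivative logistic \<eta>) (at \<eta>)"
  unfolding \<phi>_def[abs_def] logistic_def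
  by (rule derivative_eq_intros refl | simp add: add_pos_pos)+

lemma DERIV_logistic: "(logistic has_real_derivative logistic \<eta> * (1 - logistic \<eta>)) (at \<eta>)"
proof -
  have [simp]: "1 + exp \<eta> \<noteq> 0"
    by (metis add_pos_pos exp_gt_zero less_irrefl zero_less_one)
  have "((\<lambda>\<eta>. exp \<eta> / (1 + exp \<eta>)) has_real_derivative
      exp \<eta> / (1 + exp \<eta>) * (1 - exp \<eta> / (1 + exp \<eta>))) (at \<eta>)"
    by (rule derivative_eq_intros refl | simp)+ (simp add: field_simps)
  then show ?thesis
    by (simp add: logistic_def[abs_def])
qed

lemma DERIV_logistic_variance:
  "((\<lambda>\<eta>. logistic \<eta> * (1 - logistic \<eta>)) has_real_derivative
    logistic \<eta> * (1 - logistic \<eta>) * (1 - 2 * logistic \<eta>)) (at \<eta>)"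
  by (rule derivative_eq_intros DERIV_logistic refl | simp add: algebra_simps)+

lemma deriv2_\<phi>: "(deriv ^^ 2) \<phi> \<eta> = logistic \<eta> * (1 - logistic \<eta>)"
proof -
  have "deriv \<phi> = logistic"
    using DERIV_\<phi> by (auto intro!: DERIV_imp_deriv)
  then show ?thesis
    using DERIV_logistic by (simp add: numeral_2_eq_2 DERIV_imp_deriv)
qed

lemma \<phi>_taylor:
  "\<bar>\<phi> (\<eta> + h) - \<phi> \<eta> - (logistic \<eta> * h + logistic \<eta> * (1 - logistic \<eta>) * h\<^sup>2 / 2)\<bar> \<le> \<bar>h\<bar> ^ 3"
proof -
  define diff :: "nat \<Rightarrow> real \<Rightarrow> real" where
    "diff m t = (case m of 0 \<Rightarrow> \<phi> (\<eta> + t) | Suc 0 \<Rightarrow> logistic (\<eta> + t)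
      | Suc (Suc 0) \<Rightarrow> logistic (\<eta> + t) * (1 - logistic (\<eta> + t))
      | _ \<Rightarrow> logistic (\<eta> + t) * (1 - logistic (\<eta> + t)) * (1 - 2 * logistic (\<eta> + t)))" for m t
  have shift: "((\<lambda>t. f (\<eta> + t)) has_real_derivative d) (at t)"
    if "(f has_real_derivative d) (at (\<eta> + t))" for f d t
    using DERIV_shift[of f d t \<eta>] that by (simp add: add.commute)
  have deriv: "DERIV (diff m) t :> diff (Suc m) t" if "m < 3" for m t
  proof -
    have "m = 0 \<or> m = 1 \<or> m = 2" using that by arith
    then consider "m = 0" | "m = 1" | "m = 2" by blast
    then show ?thesis
    proof cases
      case 1 then show ?thesis
        using shift[OF DERIV_\<phi>, of t] by (simp add: diff_def[abs_def])
    next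
      case 2 then show ?thesis
        using shift[OF DERIV_logistic, of t] by (simp add: diff_def[abs_def])
    next
      case 3 then show ?thesis
        using shift[OF DERIV_logistic_variance, of t] by (simp add: diff_def[abs_def] numeral_2_eq_2)
    qed
  qed
  have "diff 0 = (\<lambda>t. \<phi> (\<eta> + t))"
    by (simp add: diff_def fun_eq_iff)
  then obtain t where t: "\<phi> (\<eta> + h) = (\<Sum>m<3. diff m 0 / fact m * h ^ m) + diff 3 t / fact 3 * h ^ 3"
    using Maclaurin_bi_le[of diff "\<lambda>t. \<phi> (\<eta> + t)" 3 h] deriv by blast
  have "\<bar>diff 3 t\<bar> = logistic (\<eta> + t) * (1 - logistic (\<eta> + t)) * \<bar>1 - 2 * logistic (\<eta> + t)\<bar>"
    using logistic_bounds[of "\<eta> + t"] by (simp add: diff_def numeral_3_eq_3 abs_mult)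
  also have "\<dots> \<le> 1 * 1 * 1"
    using logistic_bounds[of "\<eta> + t"] by (intro mult_mono) (auto simp: abs_le_iff mult_nonneg_nonneg)
  finally have "\<bar>diff 3 t\<bar> / 6 \<le> 1" by simp
  then have "\<bar>diff 3 t / fact 3 * h ^ 3\<bar> \<le> 1 * \<bar>h\<bar> ^ 3"
    unfolding abs_mult power_abs by (intro mult_right_mono) (auto simp: numeral_3_eq_3)
  then show ?thesis
    unfolding t by (simp add: diff_def eval_nat_numeral algebra_simps)
qed

lemma ln_obs_density: "ln (obs_density v \<beta>) = fst v * (snd v \<bullet> \<beta>) - \<phi> (snd v \<bullet> \<beta>)"
  by (simp add: obs_density_def)

lemma convex_on_\<phi>: "convex_on UNIV \<phi>"
proof (rule f''_ge0_imp_convex)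
  show "(\<phi> has_real_derivative logistic x) (at x)" for x
    by (rule DERIV_\<phi>)
  show "(logistic has_real_derivative logistic x * (1 - logistic x)) (at x)" for x
    by (rule DERIV_logistic)
  show "0 \<le> logistic x * (1 - logistic x)" for x
    using logistic_bounds[of x] by simp
qed simp

lemma continuous_on_\<phi>: "continuous_on S \<phi>"
  using DERIV_\<phi> by (meson DERIV_isCont continuous_at_imp_continuous_on)

lemma continuous_on_loglik: "continuous_on UNIV (loglik vs)"
proof -
  have "continuous_on UNIV (\<lambda>\<beta>. \<Sum>i<length vs. ln (obs_density (vs ! i) \<beta>))"
    unfolding ln_obs_density
    by (intro continuous_intros continuous_on_compose2[OF continuous_on_\<phi>[of UNIV]]) auto
  then show ?thesis
    by (simp add: loglik_def[abs_def] sum_list_sum_nth atLeast0LessThan)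
qed

lemma convex_on_affine:
  assumes "convex_on UNIV f"
  shows "convex_on UNIV (\<lambda>u. f (a + c *\<^sub>R u))"
proof (rule convex_onI)
  fix t :: real and x y :: 'a
  assume t: "0 < t" "t < 1"
  have "a + c *\<^sub>R ((1 - t) *\<^sub>R x + t *\<^sub>R y) = (1 - t) *\<^sub>R (a + c *\<^sub>R x) + t *\<^sub>R (a + c *\<^sub>R y)"
    by (simp add: algebra_simps)
  then show "f (a + c *\<^sub>R ((1 - t) *\<^sub>R x + t *\<^sub>R y)) \<le> (1 - t) * f (a + c *\<^sub>R x) + t * f (a + c *\<^sub>R y)"
    using convex_onD[OF assms, of t "a + c *\<^sub>R x" "a + c *\<^sub>R y"] t by simp
qed simp

lemma convex_on_neg_loglik: "convex_on UNIV (\<lambda>\<beta>. - loglik vs \<beta>)"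
proof -
  have "convex_on UNIV (\<lambda>\<beta>. - ln (obs_density v \<beta>))" for v :: "real \<times> (real ^ 'n)"
  proof (rule convex_onI)
    fix t :: real and \<beta> \<beta>' :: "real ^ 'n"
    assume t: "0 < t" "t < 1"
    have "\<phi> ((1 - t) *\<^sub>R (snd v \<bullet> \<beta>) + t *\<^sub>R (snd v \<bullet> \<beta>')) \<le> (1 - t) * \<phi> (snd v \<bullet> \<beta>) + t * \<phi> (snd v \<bullet> \<beta>')"
      using convex_onD[OF convex_on_\<phi>, of t] t by simp
    then show "- ln (obs_density v ((1 - t) *\<^sub>R \<beta> + t *\<^sub>R \<beta>'))
        \<le> (1 - t) * - ln (obs_density v \<beta>) + t * - ln (obs_density v \<beta>')"
      by (simp add: ln_obs_density inner_add_right algebra_simps)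
  qed simp
  then have *: "convex_on UNIV (\<lambda>\<beta>. - ln (obs_density (v :: real \<times> (real ^ 'n)) \<beta>))" for v .
  show ?thesis
  proof (induction vs)
    case Nil
    show ?case by (simp add: loglik_def convex_on_const)
  next
    case (Cons v vs)
    then show ?case
      using convex_on_add[OF *[of v] Cons] by (simp add: loglik_def algebra_simps)
  qed
qed

definition score :: "real ^ 'b \<Rightarrow> real \<times> (real ^ 'b::finite) \<Rightarrow> real ^ 'b" where
  "score \<beta> v = (fst v - logistic (snd v \<bullet> \<beta>)) *\<^sub>R snd v"

definition info_entry :: "real ^ 'b \<Rightarrow> 'b \<Rightarrow> 'b \<Rightarrow> real \<times> (real ^ 'b::finite) \<Rightarrow> real" where
  "info_entry \<beta> i k v = logistic (snd v \<bullet> \<beta>) * (1 - logistic (snd v \<bullet> \<beta>)) * (snd v $ i * snd v $ k)"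

lemma info_entry_quadratic:
  "(\<Sum>i\<in>UNIV. \<Sum>k\<in>UNIV. u $ i * u $ k * info_entry \<beta> i k v)
    = logistic (snd v \<bullet> \<beta>) * (1 - logistic (snd v \<bullet> \<beta>)) * (snd v \<bullet> u)\<^sup>2"
proof -
  define a where "a = logistic (snd v \<bullet> \<beta>) * (1 - logistic (snd v \<bullet> \<beta>))"
  have "(\<Sum>i\<in>UNIV. \<Sum>k\<in>UNIV. u $ i * u $ k * (a * (snd v $ i * snd v $ k))) = a * (snd v \<bullet> u)\<^sup>2"
    by (simp add: inner_vec_def power2_eq_square sum_product sum_distrib_left mult_ac)
  then show ?thesis
    by (simp add: info_entry_def a_def)
qed

lemma loglik_term_expansion:
  assumes "norm (snd v) \<le> K"
  shows "\<bar>ln (obs_density v \<beta>) - ln (obs_density v (\<beta> + c *\<^sub>R u))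
      - (- (c * (score \<beta> v \<bullet> u)) + c\<^sup>2 * (\<Sum>i\<in>UNIV. \<Sum>k\<in>UNIV. u $ i * u $ k * info_entry \<beta> i k v) / 2)\<bar>
      \<le> (\<bar>c\<bar> * K * norm u) ^ 3"
proof -
  let ?\<eta> = "snd v \<bullet> \<beta>" and ?h = "c * (snd v \<bullet> u)"
  have "\<bar>?h\<bar> \<le> \<bar>c\<bar> * (K * norm u)"
    unfolding abs_mult using Cauchy_Schwarz_ineq2[of "snd v" u] assms
    by (meson abs_ge_zero mult_left_mono mult_right_mono norm_ge_zero order_trans)
  then have "\<bar>?h\<bar> ^ 3 \<le> (\<bar>c\<bar> * K * norm u) ^ 3"
    by (intro power_mono) (auto simp: mult.assoc)
  moreover have "ln (obs_density v \<beta>) - ln (obs_density v (\<beta> + c *\<^sub>R u))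
      - (- (c * (score \<beta> v \<bullet> u)) + c\<^sup>2 * (\<Sum>i\<in>UNIV. \<Sum>k\<in>UNIV. u $ i * u $ k * info_entry \<beta> i k v) / 2)
      = \<phi> (?\<eta> + ?h) - \<phi> ?\<eta> - (logistic ?\<eta> * ?h + logistic ?\<eta> * (1 - logistic ?\<eta>) * ?h\<^sup>2 / 2)"
    unfolding info_entry_quadratic
    by (simp add: ln_obs_density score_def inner_add_right power_mult_distrib algebra_simps)
  ultimately show ?thesis
    using \<phi>_taylor[of ?\<eta> ?h] by linarith
qed

text \<open>
  The cubic Taylor remainders are each of order \<open>(1 / sqrt n) ^ 3\<close>, so their sum over the sample is of
  order \<open>1 / sqrt n\<close>; the last term of the bound is the price of replacing the empirical
  information by a matrix \<open>A\<close> that it approximates entrywise.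
\<close>

lemma loglik_expansion:
  fixes vs :: "(real \<times> (real ^ 'b)) list"
  assumes K: "\<forall>v\<in>set vs. norm (snd v) \<le> K" and n: "n = length vs" "n > 0"
    and H: "\<And>i k. \<bar>(\<Sum>v\<leftarrow>vs. info_entry \<beta> i k v) / n - A $ i $ k\<bar> \<le> \<delta>"
  defines "W \<equiv> (1 / sqrt n) *\<^sub>R (\<Sum>v\<leftarrow>vs. score \<beta> v)"
  shows "\<bar>loglik vs \<beta> - loglik vs (\<beta> + (1 / sqrt n) *\<^sub>R u) - (- (W \<bullet> u) + u \<bullet> (A *v u) / 2)\<bar>
      \<le> (K * norm u) ^ 3 / sqrt n + \<delta> * (real CARD('b) * norm u)\<^sup>2"
proof -
  let ?c = "1 / sqrt n"
  let ?h = "\<lambda>v. \<Sum>i\<in>UNIV. \<Sum>k\<in>UNIV. u $ i * u $ k * info_entry \<beta> i k v"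
  let ?r = "\<lambda>v. ln (obs_density v \<beta>) - ln (obs_density v (\<beta> + ?c *\<^sub>R u)) - (- (?c * (score \<beta> v \<bullet> u)) + ?c\<^sup>2 * ?h v / 2)"
  have len: "(\<Sum>v\<leftarrow>vs. f v) = (\<Sum>i<n. f (vs ! i))" for f :: "_ \<Rightarrow> 'z::comm_monoid_add"
    by (simp add: n(1) sum_list_sum_nth atLeast0LessThan)
  have Wu: "W \<bullet> u = (\<Sum>i<n. ?c * (score \<beta> (vs ! i) \<bullet> u))"
    by (simp add: W_def len inner_sum_left sum_distrib_left sum_divide_distrib)
  have hsum: "(\<Sum>i<n. ?c\<^sup>2 * ?h (vs ! i)) = (\<Sum>i\<in>UNIV. \<Sum>k\<in>UNIV. u $ i * u $ k * ((\<Sum>v\<leftarrow>vs. info_entry \<beta> i k v) / n))"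
  proof -
    have "(\<Sum>i<n. ?c\<^sup>2 * ?h (vs ! i)) = (\<Sum>j<n. \<Sum>i\<in>UNIV. \<Sum>k\<in>UNIV. u $ i * u $ k * info_entry \<beta> i k (vs ! j) / n)"
      by (simp add: power_divide sum_divide_distrib)
    also have "\<dots> = (\<Sum>i\<in>UNIV. \<Sum>j<n. \<Sum>k\<in>UNIV. u $ i * u $ k * info_entry \<beta> i k (vs ! j) / n)"
      by (rule sum.swap)
    also have "\<dots> = (\<Sum>i\<in>UNIV. \<Sum>k\<in>UNIV. \<Sum>j<n. u $ i * u $ k * info_entry \<beta> i k (vs ! j) / n)"
      by (intro sum.cong refl sum.swap)
    also have "\<dots> = (\<Sum>i\<in>UNIV. \<Sum>k\<in>UNIV. u $ i * u $ k * ((\<Sum>v\<leftarrow>vs. info_entry \<beta> i k v) / n))"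
      by (simp add: len sum_distrib_left sum_divide_distrib)
    finally show ?thesis .
  qed
  have uAu: "u \<bullet> (A *v u) = (\<Sum>i\<in>UNIV. \<Sum>k\<in>UNIV. u $ i * u $ k * A $ i $ k)"
    by (simp add: inner_vec_def matrix_vector_mult_def sum_distrib_left algebra_simps)
  have "\<bar>\<Sum>i<n. ?r (vs ! i)\<bar> \<le> (\<Sum>i<n. \<bar>?r (vs ! i)\<bar>)"
    by (rule sum_abs)
  also have "\<dots> \<le> (\<Sum>i<n. (\<bar>?c\<bar> * K * norm u) ^ 3)"
    using K n by (intro sum_mono loglik_term_expansion) auto
  also have "\<dots> = (K * norm u) ^ 3 / sqrt n"
  proof -
    have "sqrt n ^ 3 = n * sqrt n"
      by (simp add: power3_eq_cube)
    then show ?thesis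
      using n(2) by (simp add: power_divide)
  qed
  finally have 1: "\<bar>\<Sum>i<n. ?r (vs ! i)\<bar> \<le> (K * norm u) ^ 3 / sqrt n" .
  have "\<bar>(\<Sum>i<n. ?c\<^sup>2 * ?h (vs ! i)) - u \<bullet> (A *v u)\<bar>
      = \<bar>\<Sum>i\<in>UNIV. \<Sum>k\<in>UNIV. u $ i * u $ k * ((\<Sum>v\<leftarrow>vs. info_entry \<beta> i k v) / n - A $ i $ k)\<bar>"
    unfolding hsum uAu by (simp add: sum_subtractf right_diff_distrib)
  also have "\<dots> \<le> (\<Sum>i\<in>UNIV. \<Sum>k\<in>UNIV. \<bar>u $ i * u $ k * ((\<Sum>v\<leftarrow>vs. info_entry \<beta> i k v) / n - A $ i $ k)\<bar>)"
    by (rule order_trans[OF sum_abs sum_mono]) (rule sum_abs)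
  also have "\<dots> \<le> (\<Sum>i\<in>(UNIV :: 'b set). \<Sum>k\<in>(UNIV :: 'b set). norm u * norm u * \<delta>)"
    unfolding abs_mult by (intro sum_mono mult_mono H component_le_norm_cart) auto
  also have "\<dots> = \<delta> * (real CARD('b) * norm u)\<^sup>2"
    by (simp add: power2_eq_square)
  finally have 2: "\<bar>(\<Sum>i<n. ?c\<^sup>2 * ?h (vs ! i)) - u \<bullet> (A *v u)\<bar> \<le> \<delta> * (real CARD('b) * norm u)\<^sup>2" .
  have split: "(\<Sum>i<n. ?c\<^sup>2 * ?h (vs ! i) / 2) = (\<Sum>i<n. ?c\<^sup>2 * ?h (vs ! i)) / 2"
    by (simp only: sum_divide_distrib)
  have "loglik vs \<beta> - loglik vs (\<beta> + ?c *\<^sub>R u) - (- (W \<bullet> u) + u \<bullet> (A *v u) / 2)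
      = (\<Sum>i<n. ?r (vs ! i)) + ((\<Sum>i<n. ?c\<^sup>2 * ?h (vs ! i)) - u \<bullet> (A *v u)) / 2"
    unfolding loglik_def len Wu by (simp only: sum_subtractf sum.distrib sum_negf split)
      (simp add: diff_divide_distrib)
  moreover have "\<bar>x\<bar> \<le> p + q" if "x = y + z / 2" "\<bar>y\<bar> \<le> p" "\<bar>z\<bar> \<le> q" for x y z p q :: real
    using that by linarith
  ultimately show ?thesis
    using 1 2 by blast
qed

section \<open>Minimizers of perturbed quadratic forms\<close>

text \<open>
  If there were no minimum, the open sets of points with a larger value than at \<open>w\<close> would cover
  the compact set, and the smallest of the finitely many \<open>w\<close> that suffice would not be covered.
\<close>

lemma lsc_attains_min:
  fixes F :: "'b::topological_space \<Rightarrow> real"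
  assumes lsc: "\<And>x c. c < F x \<Longrightarrow> \<forall>\<^sub>F y in nhds x. c < F y" and "compact S" "S \<noteq> {}"
  shows "\<exists>x\<in>S. \<forall>y\<in>S. F x \<le> F y"
proof (rule ccontr)
  assume "\<not> ?thesis"
  then have smaller: "\<exists>y\<in>S. F y < F x" if "x \<in> S" for x
    using that by (auto simp: not_le)
  define U where "U w = interior {y. F w < F y}" for w
  have "S \<subseteq> (\<Union>w\<in>S. U w)"
  proof
    fix x assume "x \<in> S"
    then obtain w where w: "w \<in> S" "F w < F x"
      using smaller by blast
    have "x \<in> U w"
      using lsc[OF w(2)] by (auto simp: U_def eventually_nhds interior_def)
    then show "x \<in> (\<Union>w\<in>S. U w)" using w by blast
  qed
  then obtain C where C: "C \<subseteq> S" "finite C" "S \<subseteq> (\<Union>w\<in>C. U w)"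
    using compactE_image[OF \<open>compact S\<close>, of S U] by (auto simp: U_def)
  then have "C \<noteq> {}" using \<open>S \<noteq> {}\<close> by auto
  then obtain w where w: "w \<in> C" "\<And>w'. w' \<in> C \<Longrightarrow> F w \<le> F w'"
    using C(2) by (metis arg_min_if_finite(1) arg_min_least)
  then obtain w' where "w' \<in> C" "w \<in> U w'"
    using C by blast
  then have "F w' < F w"
    using interior_subset by (auto simp: U_def)
  then show False
    using w(2)[OF \<open>w' \<in> C\<close>] by simp
qed

lemma lsc_coercive_attains_min:
  fixes F :: "'b::euclidean_space \<Rightarrow> real"
  assumes lsc: "\<And>x c. c < F x \<Longrightarrow> \<forall>\<^sub>F y in nhds x. c < F y"
    and out: "\<And>u. R \<le> norm u \<Longrightarrow> F a \<le> F (a + c *\<^sub>R u)" and "R > 0" "c > 0"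
  shows "\<exists>x. \<forall>y. F x \<le> F y"
proof -
  have "\<exists>x\<in>cball a (c * R). \<forall>y\<in>cball a (c * R). F x \<le> F y"
    using mult_pos_pos[OF \<open>c > 0\<close> \<open>R > 0\<close>] by (intro lsc_attains_min lsc) auto
  then obtain x where x: "\<And>y. y \<in> cball a (c * R) \<Longrightarrow> F x \<le> F y"
    by blast
  have "F x \<le> F y" for y
  proof (cases "y \<in> cball a (c * R)")
    case False
    then have "R \<le> norm ((1 / c) *\<^sub>R (y - a))"
      using \<open>c > 0\<close> by (simp add: dist_norm norm_minus_commute pos_le_divide_eq mult.commute)
    from out[OF this] have "F a \<le> F y"
      using \<open>c > 0\<close> by simp
    then show ?thesis
      using x[of a] mult_pos_pos[OF \<open>c > 0\<close> \<open>R > 0\<close>] by simp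
  qed (rule x)
  then show ?thesis by blast
qed

lemma continuous_imp_lsc:
  fixes f :: "'b::euclidean_space \<Rightarrow> real"
  assumes "continuous_on UNIV f" "c < f x"
  shows "\<forall>\<^sub>F y in nhds x. c < f y"
proof -
  have "isCont f x"
    using assms(1) by (simp add: continuous_on_eq_continuous_at)
  then have "(f \<longlongrightarrow> f x) (nhds x)"
    unfolding isCont_def by (subst tendsto_nhds_iff) simp
  then show ?thesis using assms(2) by (rule order_tendstoD)
qed

definition restrict_coords :: "'b set \<Rightarrow> real ^ 'b \<Rightarrow> real ^ 'b" where
  "restrict_coords S u = (\<chi> i. if i \<in> S then u $ i else 0)"

lemma norm_restrict_coords_le: "norm (restrict_coords S u) \<le> norm u"
  unfolding norm_vec_def by (intro L2_set_mono) (auto simp: restrict_coords_def)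

lemma restrict_coords_inner:
  assumes "restrict_coords S a = a" "\<And>i. i \<in> S \<Longrightarrow> b $ i = c $ i"
  shows "a \<bullet> b = a \<bullet> c"
proof -
  have "a $ i = 0" if "i \<notin> S" for i
    using arg_cong[OF assms(1), of "\<lambda>v. v $ i"] that by (simp add: restrict_coords_def)
  then show ?thesis
    using assms(2) unfolding inner_vec_def by (intro sum.cong) (metis inner_zero_left)+
qed

lemma restrict_coords_idem: "restrict_coords S (restrict_coords S u) = restrict_coords S u"
  by (simp add: restrict_coords_def vec_eq_iff)

lemma convex_on_ge_outside_ball:
  fixes K :: "'b::real_normed_vector \<Rightarrow> real"
  assumes conv: "convex_on UNIV K" and "K 0 = 0" and sph: "\<And>u. norm u = R \<Longrightarrow> 1 \<le> K u"
    and "R > 0" "R \<le> norm u"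
  shows "1 \<le> K u"
proof -
  define t where "t = R / norm u"
  have u: "0 < norm u"
    using assms(4,5) by linarith
  then have t: "0 < t" "t \<le> 1"
    using assms(4,5) by (auto simp: t_def)
  have "norm (t *\<^sub>R u) = R"
    using u assms(4) by (simp add: t_def)
  then have "1 \<le> K (t *\<^sub>R u)" by (rule sph)
  also have "K (t *\<^sub>R u) \<le> (1 - t) * K 0 + t * K u"
    using convex_onD[OF conv, of t 0 u] t by simp
  finally have "1 \<le> t * K u" using \<open>K 0 = 0\<close> by simp
  moreover have "t * K u \<le> 1 * K u" if "0 \<le> K u"
    using t that by (intro mult_right_mono) auto
  moreover have "t * K u \<le> 0" if "K u < 0"
    using t that by (simp add: mult_le_0_iff)
  ultimately show ?thesis by linarith
qed

text \<open>
  This is the deterministic core of the argument. The function \<open>F\<close> stands for the increase of the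
  penalised negative log likelihood at a parameter \<open>\<beta> + u / sqrt n\<close>. Its part \<open>D\<close> comes from the
  likelihood and is close to a quadratic form on the ball of radius \<open>R\<close>; \<open>N1\<close> is the penalty of the
  active groups, \<open>N2\<close> that of the inactive groups, and \<open>P0\<close> is the fusion part, which is not convex
  but small. The radius is large enough for the quadratic form to dominate on the sphere.
\<close>

locale perturbed_quadratic =
  fixes A :: "real ^ 'b ^ 'b" and \<kappa> \<Lambda> B \<epsilon> R :: real and W :: "real ^ 'b"
    and D N1 N2 P0 :: "real ^ 'b \<Rightarrow> real"
  assumes sym: "transpose A = A"
    and lower: "\<kappa> * (norm u)\<^sup>2 \<le> u \<bullet> (A *v u)" and upper: "norm (A *v u) \<le> \<Lambda> * norm u"
    and \<kappa>: "\<kappa> > 0" and \<Lambda>: "\<Lambda> \<ge> 0" and W: "norm W \<le> B" and \<epsilon>: "0 \<le> \<epsilon>" "\<epsilon> \<le> 1 / 4"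
    and R: "R = 2 * (B + 3) / \<kappa> + 1"
    and D: "convex_on UNIV D" "D 0 = 0"
      "norm u \<le> R \<Longrightarrow> \<bar>D u - (- (W \<bullet> u) + u \<bullet> (A *v u) / 2)\<bar> \<le> \<epsilon>"
    and N1: "convex_on UNIV N1" "N1 0 = 0" "\<bar>N1 u\<bar> \<le> \<epsilon> * norm u"
    and N2: "convex_on UNIV N2" "N2 0 = 0" "0 \<le> N2 u"
    and P0: "P0 0 = 0" "\<bar>P0 u\<bar> \<le> \<epsilon>"
begin

definition F :: "real ^ 'b \<Rightarrow> real" where
  "F u = D u + N1 u + N2 u + P0 u"

lemma B_nonneg: "B \<ge> 0"
  using W norm_ge_zero order_trans by blast

lemma R_ge: "1 \<le> R" "B / \<kappa> \<le> R"
proof -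
  have "0 \<le> (B + 6) / \<kappa>" "0 \<le> (B + 3) / \<kappa>"
    using \<kappa> B_nonneg by auto
  moreover have "R = B / \<kappa> + (B + 6) / \<kappa> + 1" "R = 2 * ((B + 3) / \<kappa>) + 1"
    by (simp_all add: R add_divide_distrib)
  ultimately show "1 \<le> R" "B / \<kappa> \<le> R" by linarith+
qed

lemma F_0: "F 0 = 0"
  by (simp add: F_def D N1 N2 P0)

text \<open>
  The convex part of \<open>F\<close> is at least one on the sphere and zero at the centre, so it is at least one
  everywhere outside the ball; adding \<open>P0\<close> cannot make it negative.
\<close>

lemma F_pos_outside:
  assumes "R \<le> norm u"
  shows "0 < F u"
proof -
  let ?K = "\<lambda>u. D u + N1 u + N2 u"
  have "1 \<le> ?K u"
  proof (rule convex_on_ge_outside_ball[where K = ?K and R = R])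
    show "convex_on UNIV ?K"
      by (intro convex_on_add D N1 N2)
    show "?K 0 = 0"
      by (simp add: D N1 N2)
    show "0 < R" using R_ge by simp
    fix u :: "real ^ 'b" assume u: "norm u = R"
    have "D u \<ge> - (W \<bullet> u) + u \<bullet> (A *v u) / 2 - \<epsilon>"
      using D(3)[of u] u by simp
    moreover have "W \<bullet> u \<le> B * R"
      using norm_cauchy_schwarz[of W u] mult_right_mono[OF W norm_ge_zero[of u]] u by simp
    moreover have "\<kappa> * R\<^sup>2 \<le> u \<bullet> (A *v u)"
      using lower[of u] u by simp
    moreover have "- N1 u \<le> 1 * R"
    proof -
      have "\<epsilon> * R \<le> 1 * R"
        using \<epsilon> R_ge by (intro mult_right_mono) auto
      then show ?thesis
        using N1(3)[of u] u by simp
    qed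
    moreover have "\<kappa> * R\<^sup>2 / 2 \<ge> (B + 3) * R"
    proof -
      have "\<kappa> * R / 2 = B + 3 + \<kappa> / 2"
        using \<kappa> by (simp add: R field_simps)
      then have "B + 3 \<le> \<kappa> * R / 2" using \<kappa> by simp
      then have "(B + 3) * R \<le> \<kappa> * R / 2 * R"
        using R_ge by (intro mult_right_mono) auto
      then show ?thesis by (simp add: power2_eq_square)
    qed
    moreover have "(B + 3) * R = B * R + 3 * R" by (simp add: algebra_simps)
    ultimately show "1 \<le> ?K u"
      using N2(3)[of u] \<epsilon> R_ge(1) by linarith
  qed (rule assms)
  then show ?thesis
    using P0(2)[of u] \<epsilon> by (simp add: F_def)
qed

lemma minimizer_in_ball:
  assumes "\<And>u. F v \<le> F u"
  shows "norm v < R"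
  using F_pos_outside[of v] assms[of 0] F_0 by (cases "R \<le> norm v") auto

text \<open>
  The vector \<open>e\<close> minimises the quadratic form among the vectors supported on \<open>S\<close>. On the ball, the
  other coordinates of a minimizer \<open>v\<close> of \<open>F\<close> can gain at most a fixed multiple of their norm in the
  quadratic form, and the steep penalty \<open>N2\<close> takes this gain away. Hence the restriction of \<open>v\<close> to
  \<open>S\<close> almost minimises the quadratic form, and by uniform convexity it is close to \<open>e\<close>.
\<close>

theorem minimizer_near_quadratic_minimizer:
  assumes min: "\<And>u. F v \<le> F u"
    and steep: "\<And>u. norm u \<le> R \<Longrightarrow> (B + \<Lambda> * R) * norm (u - restrict_coords S u) \<le> N2 u"
    and flat: "\<And>u. restrict_coords S u = u \<Longrightarrow> N2 u = 0"
    and e: "restrict_coords S e = e" "\<And>i. i \<in> S \<Longrightarrow> (A *v e) $ i = W $ i"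
  shows "(norm (restrict_coords S v - e))\<^sup>2 \<le> 4 * \<epsilon> * (2 + R) / \<kappa>"
proof -
  define q where "q u = - (W \<bullet> u) + u \<bullet> (A *v u) / 2" for u
  have comm: "x \<bullet> (A *v y) = y \<bullet> (A *v x)" for x y
    using symmetric_inner_commute[OF sym, of x y] by (simp add: inner_commute)
  define a where "a = restrict_coords S v"
  define w where "w = v - a"
  have v: "norm v < R" by (rule minimizer_in_ball) (rule min)
  have aS: "restrict_coords S a = a"
    by (simp add: a_def restrict_coords_idem)
  have an: "norm a \<le> R"
    using norm_restrict_coords_le[of S v] v by (simp add: a_def)
  have en: "norm e \<le> R"
  proof -
    have "\<kappa> * (norm e)\<^sup>2 \<le> e \<bullet> W"
      using lower[of e] restrict_coords_inner[of S e "A *v e" W] e by simp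
    also have "\<dots> \<le> norm e * B"
      using norm_cauchy_schwarz[of e W] mult_left_mono[OF W norm_ge_zero[of e]] by simp
    finally have "norm e * (\<kappa> * norm e) \<le> norm e * B"
      by (simp add: power2_eq_square algebra_simps)
    then have "norm e = 0 \<or> \<kappa> * norm e \<le> B"
      by (metis mult_le_cancel_left_pos norm_ge_zero order_le_less)
    then have "norm e \<le> B / \<kappa>"
      using \<kappa> B_nonneg by (auto simp: pos_le_divide_eq mult.commute)
    then show ?thesis using R_ge by linarith
  qed
  have "F e \<le> q e + \<epsilon> + \<epsilon> * R + \<epsilon>"
  proof -
    have "N1 e \<le> \<epsilon> * R"
      using N1(3)[of e] mult_left_mono[OF en \<epsilon>(1)] by linarith
    then show ?thesis
      using D(3)[OF en] P0(2)[of e] flat[OF e(1)] by (simp add: F_def q_def)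
  qed
  moreover have "F v \<ge> q v - \<epsilon> - \<epsilon> * R + N2 v - \<epsilon>"
  proof -
    have "- N1 v \<le> \<epsilon> * R"
      using N1(3)[of v] mult_left_mono[OF less_imp_le[OF v] \<epsilon>(1)] by linarith
    then show ?thesis
      using D(3)[of v] v P0(2)[of v] by (simp add: F_def q_def)
  qed
  moreover have "q a - N2 v \<le> q v"
  proof -
    have vaw: "v = a + w" by (simp add: w_def)
    have "q v = q a - W \<bullet> w + w \<bullet> (A *v a) + w \<bullet> (A *v w) / 2"
      unfolding vaw q_def matrix_vector_right_distrib inner_add_left inner_add_right
      using comm[of a w] by simp
    moreover have "0 \<le> w \<bullet> (A *v w)"
      using lower[of w] \<kappa> by (meson less_imp_le mult_nonneg_nonneg order_trans zero_le_power2)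
    moreover have "W \<bullet> w \<le> B * norm w"
      using norm_cauchy_schwarz[of W w] mult_right_mono[OF W norm_ge_zero[of w]] by simp
    moreover have "- (w \<bullet> (A *v a)) \<le> \<Lambda> * R * norm w"
    proof -
      have "- (w \<bullet> (A *v a)) \<le> norm w * norm (A *v a)"
        using norm_cauchy_schwarz[of "- w" "A *v a"] by simp
      also have "\<dots> \<le> norm w * (\<Lambda> * R)"
        using upper[of a] mult_left_mono[OF an \<Lambda>] by (intro mult_left_mono) auto
      finally show ?thesis by (simp add: mult_ac)
    qed
    moreover have "(B + \<Lambda> * R) * norm w \<le> N2 v"
      using steep[of v] v by (simp add: w_def a_def)
    ultimately show ?thesis by (simp add: algebra_simps)
  qed
  ultimately have "q a - q e \<le> 2 * \<epsilon> * (2 + R)"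
    using min[of e] by (simp add: algebra_simps)
  moreover have "q a - q e = (a - e) \<bullet> (A *v (a - e)) / 2"
  proof -
    have "a \<bullet> (A *v e) = a \<bullet> W" "e \<bullet> (A *v e) = e \<bullet> W"
      by (rule restrict_coords_inner[OF aS e(2)] restrict_coords_inner[OF e]; simp)+
    then show ?thesis
      unfolding q_def matrix_vector_mult_diff_distrib inner_diff_left inner_diff_right
      using comm[of e a] by (simp add: inner_commute field_simps)
  qed
  moreover have "\<kappa> * (norm (a - e))\<^sup>2 \<le> (a - e) \<bullet> (A *v (a - e))"
    by (rule lower)
  ultimately have "\<kappa> * (norm (a - e))\<^sup>2 \<le> 4 * \<epsilon> * (2 + R)"
    by linarith
  then show ?thesis
    using \<kappa> by (simp add: pos_le_divide_eq mult.commute a_def)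
qed

end

lemma pos_def_bounds:
  fixes A :: "real ^ 'b ^ 'b"
  assumes A: "pos_def_matrix A"
  obtains \<kappa> \<Lambda> where "\<kappa> > 0" "\<Lambda> \<ge> 0" "\<And>u. \<kappa> * (norm u)\<^sup>2 \<le> u \<bullet> (A *v u)"
    "\<And>u. norm (A *v u) \<le> \<Lambda> * norm u"
proof -
  have "bounded_linear ((*v) A)"
    by (rule matrix_vector_mul_bounded_linear)
  then obtain \<Lambda> where \<Lambda>: "\<Lambda> \<ge> 0" "\<And>u. norm (A *v u) \<le> \<Lambda> * norm u"
    by (metis bounded_linear.nonneg_bounded mult.commute)
  have "continuous_on (sphere 0 1) (\<lambda>u. u \<bullet> (A *v u))"
    by (intro continuous_intros linear_continuous_on matrix_vector_mul_bounded_linear)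
  moreover have "axis undefined 1 \<in> sphere (0 :: real ^ 'b) 1"
    by simp
  ultimately obtain x where x: "x \<in> sphere 0 1" "\<And>u. u \<in> sphere 0 1 \<Longrightarrow> x \<bullet> (A *v x) \<le> u \<bullet> (A *v u)"
    using continuous_attains_inf[of "sphere 0 1" "\<lambda>u. u \<bullet> (A *v u)"] by (metis compact_sphere empty_iff)
  define \<kappa> where "\<kappa> = x \<bullet> (A *v x)"
  have "x \<noteq> 0" using x(1) by auto
  then have "\<kappa> > 0"
    using A by (simp add: \<kappa>_def pos_def_matrix_def)
  have "\<kappa> * (norm u)\<^sup>2 \<le> u \<bullet> (A *v u)" for u
  proof (cases "u = 0")
    case False
    have "\<kappa> \<le> (u /\<^sub>R norm u) \<bullet> (A *v (u /\<^sub>R norm u))"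
      unfolding \<kappa>_def using False by (intro x) simp
    also have "\<dots> = (u \<bullet> (A *v u)) / (norm u)\<^sup>2"
      by (simp add: matrix_vector_mult_scaleR power2_eq_square divide_inverse)
    finally show ?thesis
      using False by (simp add: field_simps)
  qed simp
  then show thesis
    using that \<open>\<kappa> > 0\<close> \<Lambda> by blast
qed

section \<open>The logistic regression sample\<close>

definition scaled_score :: "real ^ 'b \<Rightarrow> (real \<times> (real ^ 'b::finite)) list \<Rightarrow> real ^ 'b" where
  "scaled_score \<beta> vs = (1 / sqrt (length vs)) *\<^sub>R (\<Sum>v\<leftarrow>vs. score \<beta> v)"

definition scaled_nll :: "real ^ 'b \<Rightarrow> (real \<times> (real ^ 'b::finite)) list \<Rightarrow> real ^ 'b \<Rightarrow> real" where
  "scaled_nll \<beta> vs u = loglik vs \<beta> - loglik vs (\<beta> + (1 / sqrt (length vs)) *\<^sub>R u)"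

lemma length_sample [simp]: "length (sample V n w) = n"
  by (simp add: sample_def)

lemma sum_list_sample: "(\<Sum>v\<leftarrow>sample V n w. f v) = (\<Sum>i<n. f (V i w))"
  by (simp add: sample_def o_def interv_sum_list_conv_sum_set_nat atLeast0LessThan)

lemma borel_measurable_score [measurable]: "score \<beta> \<in> borel_measurable borel"
  unfolding score_def
  by (intro borel_measurable_continuous_onI continuous_intros
      continuous_on_compose2[OF continuous_on_logistic[of UNIV]]) auto

lemma borel_measurable_info_entry [measurable]: "info_entry \<beta> i k \<in> borel_measurable borel"
  unfolding info_entry_def
  by (intro borel_measurable_continuous_onI continuous_intros
      continuous_on_compose2[OF continuous_on_logistic[of UNIV]]) auto

text \<open>
  Observations take finitely many values, so every function of a sample is measurable and every
  function of an observation is bounded.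
\<close>

locale logistic_sample = prob_space M
  for M :: "'w measure" +
  fixes v :: "'w \<Rightarrow> real \<times> (real ^ 'b)" and V :: "nat \<Rightarrow> 'w \<Rightarrow> real \<times> (real ^ 'b)"
    and \<beta> :: "real ^ 'b" and Obs :: "(real \<times> (real ^ 'b)) set"
  assumes finite_Obs: "finite Obs" and fst_Obs: "ob \<in> Obs \<Longrightarrow> fst ob \<in> {0, 1}"
    and v_meas [measurable]: "v \<in> borel_measurable M" and v_Obs: "w \<in> space M \<Longrightarrow> v w \<in> Obs"
    and V_meas [measurable]: "V i \<in> borel_measurable M" and V_Obs: "w \<in> space M \<Longrightarrow> V i w \<in> Obs"
    and V_indep: "indep_vars (\<lambda>_. borel) V UNIV"
    and V_copies: "distr M borel (V i) = distr M borel v"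
    and model: "logistic_model M (\<lambda>w. fst (v w)) (\<lambda>w. snd (v w)) \<beta>"
    and reg2: "reg2 M (\<lambda>w. snd (v w)) \<beta>"
begin

abbreviation Info :: "real ^ 'b ^ 'b" where
  "Info \<equiv> fisher_info M (\<lambda>w. snd (v w)) \<beta>"

lemma pos_def_Info: "pos_def_matrix Info"
  using reg2 by (simp add: reg2_def)

lemma Obs_bound: "\<exists>K\<ge>0. \<forall>ob\<in>Obs. norm (f ob :: 'z::real_normed_vector) \<le> K"
proof -
  have "bounded (f ` Obs)"
    using finite_Obs by (intro finite_imp_bounded) simp
  then show ?thesis
    by (auto simp: bounded_pos intro: less_imp_le)
qed

lemma integrable_v: "integrable M (\<lambda>w. f (v w) :: real)"
proof -
  have v_count: "v \<in> M \<rightarrow>\<^sub>M count_space Obs"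
    unfolding measurable_count_space_eq2[OF finite_Obs]
    using v_Obs measurable_sets[OF v_meas] by auto
  obtain K where "\<forall>ob\<in>Obs. norm (f ob) \<le> K"
    using Obs_bound[of f] by blast
  then show ?thesis
    using v_Obs measurable_compose[OF v_count, of f borel]
    by (intro integrable_const_bound[where B = K]) auto
qed

text \<open>The model equation says that the residual is orthogonal to every continuous function of the covariates.\<close>

lemma residual_orthogonal:
  assumes h: "continuous_on UNIV (h :: real ^ 'b \<Rightarrow> real)"
  shows "expectation (\<lambda>w. h (snd (v w)) * (fst (v w) - logistic (snd (v w) \<bullet> \<beta>))) = 0"
proof -
  let ?F = "vimage_algebra (space M) (\<lambda>w. snd (v w)) borel"
  have [measurable]: "h \<in> borel_measurable borel"
    using h by (rule borel_measurable_continuous_onI)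
  have [measurable]: "(fst :: real \<times> (real ^ 'b) \<Rightarrow> real) \<in> borel_measurable borel"
    "(snd :: real \<times> (real ^ 'b) \<Rightarrow> real ^ 'b) \<in> borel_measurable borel"
    by (intro borel_measurable_continuous_onI continuous_intros)+
  have mX: "(\<lambda>w. snd (v w)) \<in> borel_measurable M" and mY: "(\<lambda>w. fst (v w)) \<in> borel_measurable M"
    by measurable
  have sub: "subalgebra M ?F"
    unfolding subalgebra_def using mX by (auto simp: measurable_iff_sets)
  interpret C: finite_measure_subalgebra M ?F
    by unfold_locales (rule sub)
  have mF: "(\<lambda>w. h (snd (v w))) \<in> borel_measurable ?F"
    by (rule measurable_compose[OF measurable_vimage_algebra1]) auto
  have int: "integrable M (\<lambda>w. h (snd (v w)) * fst (v w))"
    "integrable M (\<lambda>w. h (snd (v w)) * logistic (snd (v w) \<bullet> \<beta>))"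
    using integrable_v[of "\<lambda>ob. h (snd ob) * fst ob"]
      integrable_v[of "\<lambda>ob. h (snd ob) * logistic (snd ob \<bullet> \<beta>)"] by simp_all
  have "expectation (\<lambda>w. h (snd (v w)) * fst (v w))
      = expectation (\<lambda>w. h (snd (v w)) * real_cond_exp M ?F (\<lambda>w. fst (v w)) w)"
    by (rule C.real_cond_exp_intg(2)[OF int(1) mF mY, symmetric])
  also have "\<dots> = expectation (\<lambda>w. h (snd (v w)) * logistic (snd (v w) \<bullet> \<beta>))"
  proof (rule integral_cong_AE)
    show "AE w in M. h (snd (v w)) * real_cond_exp M ?F (\<lambda>w. fst (v w)) w
        = h (snd (v w)) * logistic (snd (v w) \<bullet> \<beta>)"
      using model by (auto simp: logistic_model_def logistic_def elim!: eventually_mono)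
    show "(\<lambda>w. h (snd (v w)) * logistic (snd (v w) \<bullet> \<beta>)) \<in> borel_measurable M"
      using int(2) by (rule borel_measurable_integrable)
  qed (use sub in measurable)
  finally show ?thesis
    using int by (simp add: right_diff_distrib)
qed

lemma info_entry_mean: "expectation (\<lambda>w. info_entry \<beta> i k (v w)) = Info $ i $ k"
  by (simp add: fisher_info_def deriv2_\<phi> info_entry_def)

lemma score_mean: "expectation (\<lambda>w. t \<bullet> score \<beta> (v w)) = 0"
  using residual_orthogonal[of "\<lambda>x. t \<bullet> x"] by (simp add: continuous_intros score_def mult.commute)

text \<open>
  A response \<open>y\<close> in \<open>{0, 1}\<close> satisfies \<open>y\<^sup>2 = y\<close>, which makes its squared residual a multiple of the
  residual plus the conditional variance.
\<close>

lemma score_covariance: "expectation (\<lambda>w. (t \<bullet> score \<beta> (v w))\<^sup>2) = t \<bullet> (Info *v t)"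
proof -
  define h where "h x = (1 - 2 * logistic (x \<bullet> \<beta>)) * (t \<bullet> x)\<^sup>2" for x
  let ?h = "\<lambda>ob. h (snd ob) * (fst ob - logistic (snd ob \<bullet> \<beta>))"
  let ?q = "\<lambda>ob. \<Sum>i\<in>UNIV. \<Sum>k\<in>UNIV. t $ i * t $ k * info_entry \<beta> i k ob"
  have hc: "continuous_on UNIV h"
    unfolding h_def
    by (intro continuous_intros continuous_on_compose2[OF continuous_on_logistic[of UNIV]]) auto
  have "expectation (\<lambda>w. (t \<bullet> score \<beta> (v w))\<^sup>2) = expectation (\<lambda>w. ?h (v w) + ?q (v w))"
  proof (rule Bochner_Integration.integral_cong[OF refl])
    fix w assume "w \<in> space M"
    then have "fst (v w) = 0 \<or> fst (v w) = 1"
      using fst_Obs[OF v_Obs] by blast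
    then show "(t \<bullet> score \<beta> (v w))\<^sup>2 = ?h (v w) + ?q (v w)"
      unfolding info_entry_quadratic
      by (elim disjE) (simp_all add: score_def h_def power2_eq_square inner_commute algebra_simps)
  qed
  also have "\<dots> = expectation (\<lambda>w. ?h (v w)) + expectation (\<lambda>w. ?q (v w))"
    by (rule Bochner_Integration.integral_add[OF integrable_v[of ?h] integrable_v[of ?q]])
  also have "expectation (\<lambda>w. ?h (v w)) = 0"
    by (rule residual_orthogonal[OF hc])
  also have "expectation (\<lambda>w. ?q (v w)) = (\<Sum>i\<in>UNIV. \<Sum>k\<in>UNIV. t $ i * t $ k * Info $ i $ k)"
    by (simp add: integrable_v info_entry_mean)
  also have "\<dots> = t \<bullet> (Info *v t)"
    by (simp add: inner_vec_def matrix_vector_mult_def sum_distrib_left mult_ac)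
  finally show ?thesis by simp
qed

lemma V_ident: "distr M borel (V i) = distr M borel (V 0)"
  by (simp only: V_copies)

lemma set_sample: "w \<in> space M \<Longrightarrow> set (sample V n w) \<subseteq> Obs"
  using V_Obs by (auto simp: sample_def)

lemma measurable_sample: "sample V n \<in> M \<rightarrow>\<^sub>M count_space {vs. set vs \<subseteq> Obs \<and> length vs = n}"
proof (subst measurable_count_space_eq2)
  show "finite {vs. set vs \<subseteq> Obs \<and> length vs = n}"
    using finite_Obs by (rule finite_lists_length_eq)
  show "sample V n \<in> space M \<rightarrow> {vs. set vs \<subseteq> Obs \<and> length vs = n} \<and>
      (\<forall>vs\<in>{vs. set vs \<subseteq> Obs \<and> length vs = n}. sample V n -` {vs} \<inter> space M \<in> sets M)"
  proof (intro conjI ballI)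
    fix vs assume "vs \<in> {vs. set vs \<subseteq> Obs \<and> length vs = n}"
    then have len: "length vs = n" by simp
    have "sample V n w = vs \<longleftrightarrow> (\<forall>i\<in>{..<n}. V i w = vs ! i)" for w
      using len unfolding list_eq_iff_nth_eq by (simp add: sample_def Ball_def)
    then have "sample V n -` {vs} \<inter> space M = {w \<in> space M. \<forall>i\<in>{..<n}. V i w = vs ! i}"
      by blast
    also have "\<dots> \<in> sets M"
    proof (rule sets.sets_Collect_finite_All)
      fix i
      have "V i -` {vs ! i} \<inter> space M \<in> sets M"
        by (rule measurable_sets[OF V_meas]) simp
      also have "V i -` {vs ! i} \<inter> space M = {w \<in> space M. V i w = vs ! i}"
        by blast
      finally show "{w \<in> space M. V i w = vs ! i} \<in> sets M" .
    qed simp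
    finally show "sample V n -` {vs} \<inter> space M \<in> sets M" .
  qed (use set_sample in force)
qed

lemma measurable_of_sample [measurable]: "(\<lambda>w. f (sample V n w)) \<in> borel_measurable M"
  by (rule measurable_compose[OF measurable_sample]) simp

lemma sets_sample [measurable]: "{w \<in> space M. Q (sample V n w)} \<in> sets M"
proof -
  have "Measurable.pred M (\<lambda>w. Q (sample V n w))"
    by (rule measurable_compose[OF measurable_sample]) simp
  then show ?thesis by simp
qed

abbreviation fail_prob :: "((real \<times> (real ^ 'b)) list \<Rightarrow> bool) \<Rightarrow> nat \<Rightarrow> real" where
  "fail_prob Q n \<equiv> prob {w \<in> space M. \<not> Q (sample V n w)}"

text \<open>
  "With high probability", as the sample grows. The sample size is not an argument, because it is
  the length of the list.
\<close>

definition whp :: "((real \<times> (real ^ 'b)) list \<Rightarrow> bool) \<Rightarrow> bool" where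
  "whp Q \<longleftrightarrow> (\<lambda>n. fail_prob Q n) \<longlonglongrightarrow> 0"

lemma whp_iff: "whp Q \<longleftrightarrow> (\<forall>\<delta>>0. \<forall>\<^sub>F n in sequentially. fail_prob Q n \<le> \<delta>)"
proof
  assume *: "whp Q"
  show "\<forall>\<delta>>0. \<forall>\<^sub>F n in sequentially. fail_prob Q n \<le> \<delta>"
  proof (intro allI impI)
    fix \<delta> :: real assume "\<delta> > 0"
    show "\<forall>\<^sub>F n in sequentially. fail_prob Q n \<le> \<delta>"
      using order_tendstoD(2)[OF *[unfolded whp_def] \<open>\<delta> > 0\<close>] by eventually_elim simp
  qed
next
  assume *: "\<forall>\<delta>>0. \<forall>\<^sub>F n in sequentially. fail_prob Q n \<le> \<delta>"
  show "whp Q"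
    unfolding whp_def
  proof (rule tendstoI)
    fix e :: real assume "e > 0"
    then have "\<forall>\<^sub>F n in sequentially. fail_prob Q n \<le> e / 2"
      by (intro *[rule_format]) simp
    then show "\<forall>\<^sub>F n in sequentially. dist (fail_prob Q n) 0 < e"
      by eventually_elim (use \<open>e > 0\<close> in simp)
  qed
qed

lemma whp_tendsto_1: "whp Q \<Longrightarrow> (\<lambda>n. prob {w \<in> space M. Q (sample V n w)}) \<longlonglongrightarrow> 1"
proof -
  assume "whp Q"
  then have "(\<lambda>n. 1 - fail_prob Q n) \<longlonglongrightarrow> 1 - 0"
    unfolding whp_def by (intro tendsto_intros)
  moreover have "1 - fail_prob Q n = prob {w \<in> space M. Q (sample V n w)}" for n
    by (subst prob_neg) simp_all
  ultimately show ?thesis by simp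
qed

lemma whp_mono:
  assumes Q: "whp Q" and imp: "\<forall>\<^sub>F n in sequentially. \<forall>vs. length vs = n \<and> set vs \<subseteq> Obs \<and> Q vs \<longrightarrow> Q' vs"
  shows "whp Q'"
  unfolding whp_iff
proof (intro allI impI)
  fix \<delta> :: real assume "\<delta> > 0"
  then have "\<forall>\<^sub>F n in sequentially. fail_prob Q n \<le> \<delta>"
    using Q by (simp add: whp_iff)
  with imp show "\<forall>\<^sub>F n in sequentially. fail_prob Q' n \<le> \<delta>"
  proof eventually_elim
    case (elim n)
    have "fail_prob Q' n \<le> fail_prob Q n"
      using elim(1) set_sample by (intro finite_measure_mono sets_sample) auto
    then show ?case using elim by simp
  qed
qed

lemma whp_eventually:
  assumes "\<forall>\<^sub>F n in sequentially. \<forall>vs. length vs = n \<and> set vs \<subseteq> Obs \<longrightarrow> Q vs"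
  shows "whp Q"
proof (rule whp_mono)
  show "whp (\<lambda>_. True)" by (simp add: whp_def)
qed (use assms in simp)

lemma whp_conj:
  assumes "whp P" "whp Q"
  shows "whp (\<lambda>vs. P vs \<and> Q vs)"
  unfolding whp_iff
proof (intro allI impI)
  fix \<delta> :: real assume "\<delta> > 0"
  then have "\<forall>\<^sub>F n in sequentially. fail_prob P n \<le> \<delta> / 2"
    "\<forall>\<^sub>F n in sequentially. fail_prob Q n \<le> \<delta> / 2"
    using assms[unfolded whp_iff, rule_format, OF half_gt_zero] by blast+
  then show "\<forall>\<^sub>F n in sequentially. prob {w \<in> space M. \<not> (P (sample V n w) \<and> Q (sample V n w))} \<le> \<delta>"
  proof eventually_elim
    case (elim n)
    have "{w \<in> space M. \<not> (P (sample V n w) \<and> Q (sample V n w))}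
        = {w \<in> space M. \<not> P (sample V n w)} \<union> {w \<in> space M. \<not> Q (sample V n w)}"
      by auto
    also have "prob \<dots> \<le> fail_prob P n + fail_prob Q n"
      by (rule measure_Un_le) (rule sets_sample)+
    finally show ?case using elim by simp
  qed
qed

lemma whp_ball_finite:
  assumes "finite I" "\<And>i. i \<in> I \<Longrightarrow> whp (Q i)"
  shows "whp (\<lambda>vs. \<forall>i\<in>I. Q i vs)"
  using assms
proof (induction I rule: finite_induct)
  case empty
  show ?case by (simp add: whp_def)
next
  case (insert i I)
  then have "whp (\<lambda>vs. Q i vs \<and> (\<forall>i\<in>I. Q i vs))"
    by (intro whp_conj) auto
  then show ?case by simp
qed

lemma scaled_score_sample: "scaled_score \<beta> (sample V n w) = (1 / sqrt n) *\<^sub>R (\<Sum>i<n. score \<beta> (V i w))"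
  by (simp add: scaled_score_def sum_list_sample)

text \<open>
  The scaled score is bounded in probability. Arguments that hold with probability tending to one
  for every fixed bound on it therefore hold with probability tending to one without a bound.
\<close>

lemma whp_if_bounded_score:
  assumes "\<And>B. B \<ge> 0 \<Longrightarrow> whp (\<lambda>vs. norm (scaled_score \<beta> vs) \<le> B \<longrightarrow> Q vs)"
  shows "whp Q"
  unfolding whp_iff
proof (intro allI impI)
  fix \<delta> :: real assume "\<delta> > 0"
  obtain K where K: "K \<ge> 0" "\<And>ob. ob \<in> Obs \<Longrightarrow> norm (score \<beta> ob) \<le> K"
    using Obs_bound[of "score \<beta>"] by blast
  have "\<exists>B\<ge>0. \<forall>n. prob {w \<in> space M. B < norm ((1 / sqrt n) *\<^sub>R (\<Sum>i<n. score \<beta> (V i w)))} \<le> \<delta> / 2"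
  proof (rule scaled_sum_tight)
    show "indep_vars (\<lambda>_. borel) (\<lambda>i w. score \<beta> (V i w)) UNIV"
      by (rule indep_vars_compose2[OF V_indep]) simp
    show "distr M borel (\<lambda>w. score \<beta> (V i w)) = distr M borel (\<lambda>w. score \<beta> (V 0 w))" for i
      by (rule distr_comp_eq[OF _ _ V_ident]) simp_all
    show "norm (score \<beta> (V i w)) \<le> K" if "w \<in> space M" for i w
      using K V_Obs[OF that] by blast
    show "expectation (\<lambda>w. score \<beta> (V 0 w) $ k) = 0" for k
    proof -
      have "(\<lambda>ob. axis k 1 \<bullet> score \<beta> ob) \<in> borel_measurable borel" by simp
      from expectation_eq_of_distr_eq[OF _ _ this V_copies[of 0]] show ?thesis
        using score_mean[of "axis k 1"] by (simp add: inner_axis')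
    qed
  qed (use \<open>\<delta> > 0\<close> in simp)
  then obtain B where B: "B \<ge> 0" "\<And>n. prob {w \<in> space M. B < norm (scaled_score \<beta> (sample V n w))} \<le> \<delta> / 2"
    by (auto simp: scaled_score_sample)
  have "\<forall>\<^sub>F n in sequentially. prob {w \<in> space M. \<not> (norm (scaled_score \<beta> (sample V n w)) \<le> B \<longrightarrow> Q (sample V n w))} \<le> \<delta> / 2"
    using assms[OF B(1), unfolded whp_iff, rule_format, OF half_gt_zero[OF \<open>\<delta> > 0\<close>]] .
  then show "\<forall>\<^sub>F n in sequentially. fail_prob Q n \<le> \<delta>"
  proof eventually_elim
    case (elim n)
    let ?A1 = "{w \<in> space M. B < norm (scaled_score \<beta> (sample V n w))}"
    let ?A2 = "{w \<in> space M. \<not> (norm (scaled_score \<beta> (sample V n w)) \<le> B \<longrightarrow> Q (sample V n w))}"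
    have "fail_prob Q n \<le> prob (?A1 \<union> ?A2)"
      by (intro finite_measure_mono sets.Un sets_sample) auto
    also have "\<dots> \<le> prob ?A1 + prob ?A2"
      by (rule measure_Un_le) (rule sets_sample)+
    finally show ?case using elim B(2)[of n] by simp
  qed
qed

lemma whp_info:
  assumes "\<epsilon> > 0"
  shows "whp (\<lambda>vs. \<forall>i k. \<bar>(\<Sum>ob\<leftarrow>vs. info_entry \<beta> i k ob) / length vs - Info $ i $ k\<bar> \<le> \<epsilon>)"
proof -
  have "whp (\<lambda>vs. \<bar>(\<Sum>ob\<leftarrow>vs. info_entry \<beta> i k ob) / length vs - Info $ i $ k\<bar> \<le> \<epsilon>)" for i k
    unfolding whp_iff
  proof (intro allI impI)
    fix \<delta> :: real assume "\<delta> > 0"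
    obtain K where K: "\<And>ob. ob \<in> Obs \<Longrightarrow> norm (info_entry \<beta> i k ob) \<le> K"
      using Obs_bound[of "info_entry \<beta> i k"] by blast
    have mean: "expectation (\<lambda>w. info_entry \<beta> i k (V 0 w)) = Info $ i $ k"
      using expectation_eq_of_distr_eq[OF _ _ borel_measurable_info_entry V_copies[of 0]] info_entry_mean by simp
    have "\<forall>\<^sub>F n in sequentially. prob {w \<in> space M.
        \<epsilon> < \<bar>(\<Sum>j<n. info_entry \<beta> i k (V j w)) / n - expectation (\<lambda>w. info_entry \<beta> i k (V 0 w))\<bar>} \<le> \<delta>"
    proof (rule weak_law_bounded_iid)
      show "indep_vars (\<lambda>_. borel) (\<lambda>j w. info_entry \<beta> i k (V j w)) UNIV"
        by (rule indep_vars_compose2[OF V_indep]) simp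
      show "distr M borel (\<lambda>w. info_entry \<beta> i k (V j w)) = distr M borel (\<lambda>w. info_entry \<beta> i k (V 0 w))" for j
        by (rule distr_comp_eq[OF _ _ V_ident]) simp_all
      show "\<bar>info_entry \<beta> i k (V j w)\<bar> \<le> K" if "w \<in> space M" for j w
        using K[OF V_Obs[OF that]] by simp
    qed fact+
    then show "\<forall>\<^sub>F n in sequentially. prob {w \<in> space M. \<not> \<bar>(\<Sum>ob\<leftarrow>sample V n w. info_entry \<beta> i k ob)
        / length (sample V n w) - Info $ i $ k\<bar> \<le> \<epsilon>} \<le> \<delta>"
      by (simp add: sum_list_sample mean not_le)
  qed
  then have "whp (\<lambda>vs. \<forall>i\<in>UNIV. \<forall>k\<in>UNIV. \<bar>(\<Sum>ob\<leftarrow>vs. info_entry \<beta> i k ob) / length vs - Info $ i $ k\<bar> \<le> \<epsilon>)"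
    by (intro whp_ball_finite) simp_all
  then show ?thesis by simp
qed

lemma whp_local_quadratic:
  assumes "\<epsilon> > 0" "R \<ge> 0"
  shows "whp (\<lambda>vs. \<forall>u. norm u \<le> R \<longrightarrow>
    \<bar>scaled_nll \<beta> vs u - (- (scaled_score \<beta> vs \<bullet> u) + u \<bullet> (Info *v u) / 2)\<bar> \<le> \<epsilon>)"
proof -
  obtain K where K: "K \<ge> 0" "\<And>ob. ob \<in> Obs \<Longrightarrow> norm (snd ob) \<le> K"
    using Obs_bound[of snd] by blast
  \<comment> \<open>Half of \<open>\<epsilon>\<close> is left for the error in the information matrix on the ball, half for the cubic remainder.\<close>
  define \<delta> where "\<delta> = \<epsilon> / (2 * ((real CARD('b) * R)\<^sup>2 + 1))"
  have pos: "0 < (real CARD('b) * R)\<^sup>2 + 1"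
    by (simp add: add_nonneg_pos)
  have \<delta>: "\<delta> > 0"
    unfolding \<delta>_def using assms pos by simp
  have \<delta>': "\<delta> * (real CARD('b) * R)\<^sup>2 \<le> \<epsilon> / 2"
  proof -
    have "\<delta> * (real CARD('b) * R)\<^sup>2 \<le> \<delta> * ((real CARD('b) * R)\<^sup>2 + 1)"
      using \<delta> by (intro mult_left_mono) auto
    also have "\<dots> = \<epsilon> / 2"
      using pos unfolding \<delta>_def by (simp only: times_divide_eq_left) (simp add: field_simps)
    finally show ?thesis .
  qed
  have "(\<lambda>n. (K * R) ^ 3 / sqrt (real n)) \<longlonglongrightarrow> 0"
    by (rule tendsto_divide_0[OF tendsto_const])
      (rule filterlim_at_top_imp_at_infinity[OF filterlim_compose[OF sqrt_at_top filterlim_real_sequentially]])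
  then have "\<forall>\<^sub>F n in sequentially. (K * R) ^ 3 / sqrt (real n) < \<epsilon> / 2"
    using assms by (intro order_tendstoD) auto
  then have ev: "\<forall>\<^sub>F n in sequentially. \<forall>vs. length vs = n \<and> set vs \<subseteq> Obs \<and>
      (\<forall>i k. \<bar>(\<Sum>ob\<leftarrow>vs. info_entry \<beta> i k ob) / length vs - Info $ i $ k\<bar> \<le> \<delta>) \<longrightarrow>
      (\<forall>u. norm u \<le> R \<longrightarrow> \<bar>scaled_nll \<beta> vs u - (- (scaled_score \<beta> vs \<bullet> u) + u \<bullet> (Info *v u) / 2)\<bar> \<le> \<epsilon>)"
    using eventually_gt_at_top[of 0]
  proof eventually_elim
    case (elim n)
    show ?case
    proof (intro allI impI)
      fix vs :: "(real \<times> (real ^ 'b)) list" and u :: "real ^ 'b"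
      assume vs: "length vs = n \<and> set vs \<subseteq> Obs \<and>
        (\<forall>i k. \<bar>(\<Sum>ob\<leftarrow>vs. info_entry \<beta> i k ob) / length vs - Info $ i $ k\<bar> \<le> \<delta>)" and u: "norm u \<le> R"
      have "\<bar>loglik vs \<beta> - loglik vs (\<beta> + (1 / sqrt n) *\<^sub>R u)
          - (- ((1 / sqrt n) *\<^sub>R (\<Sum>ob\<leftarrow>vs. score \<beta> ob) \<bullet> u) + u \<bullet> (Info *v u) / 2)\<bar>
          \<le> (K * norm u) ^ 3 / sqrt n + \<delta> * (real CARD('b) * norm u)\<^sup>2"
        using vs elim K by (intro loglik_expansion) auto
      also have "\<dots> \<le> (K * R) ^ 3 / sqrt n + \<delta> * (real CARD('b) * R)\<^sup>2"
        using u K \<delta> assms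
        by (intro add_mono divide_right_mono power_mono mult_left_mono) auto
      also have "\<dots> \<le> \<epsilon>"
        using elim(1) \<delta>' by linarith
      finally show "\<bar>scaled_nll \<beta> vs u - (- (scaled_score \<beta> vs \<bullet> u) + u \<bullet> (Info *v u) / 2)\<bar> \<le> \<epsilon>"
        using vs by (simp add: scaled_nll_def scaled_score_def)
    qed
  qed
  show ?thesis
    by (rule whp_mono[OF whp_info[OF \<delta>] ev])
qed

end

section \<open>Asymptotics of penalised estimators\<close>

text \<open>For injective \<open>act\<close>, this is the adjoint and a right inverse of \<open>subvec act\<close>.\<close>

definition embed :: "('a::finite \<Rightarrow> 'b::finite) \<Rightarrow> real ^ 'a \<Rightarrow> real ^ 'b" where
  "embed act z = (\<chi> j. if j \<in> range act then z $ inv act j else 0)"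

lemma embed_inner:
  assumes "inj act"
  shows "embed act z \<bullet> w = z \<bullet> subvec act w"
proof -
  have "embed act z \<bullet> w = (\<Sum>j\<in>range act. embed act z $ j * w $ j)"
    unfolding inner_vec_def by (intro sum.mono_neutral_cong_right) (auto simp: embed_def)
  also have "\<dots> = (\<Sum>k\<in>UNIV. z $ k * w $ act k)"
    using assms by (simp add: sum.reindex embed_def)
  finally show ?thesis
    by (simp add: inner_vec_def subvec_def)
qed

lemma submat_mult:
  assumes "inj act"
  shows "submat act A *v z = subvec act (A *v embed act z)"
proof -
  have "(submat act A *v z) $ i = z \<bullet> subvec act (row (act i) A)" for i
    by (simp add: matrix_vector_mult_def submat_def inner_vec_def subvec_def row_def mult.commute)
  moreover have "(A *v embed act z) $ act i = embed act z \<bullet> row (act i) A" for i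
    by (simp add: matrix_vector_mult_def inner_vec_def row_def mult.commute)
  ultimately show ?thesis
    using assms by (simp add: vec_eq_iff subvec_def[of act "A *v embed act z"] embed_inner)
qed

lemma restrict_coords_embed: "restrict_coords (range act) (embed act z) = embed act z"
  by (auto simp: restrict_coords_def embed_def vec_eq_iff)

lemma embed_subvec:
  assumes "inj act"
  shows "embed act (subvec act x) = restrict_coords (range act) x"
  using assms by (auto simp: embed_def subvec_def restrict_coords_def vec_eq_iff)

lemma subvec_embed:
  assumes "inj act"
  shows "subvec act (embed act z) = z"
  using assms by (auto simp: embed_def subvec_def vec_eq_iff)

lemma norm_embed:
  assumes "inj act"
  shows "norm (embed act z) = norm z"
  using embed_inner[OF assms, of z "embed act z"] subvec_embed[OF assms, of z]
  by (simp add: norm_eq_sqrt_inner)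

lemma subvec_diff: "subvec act (x - y) = subvec act x - subvec act y"
  by (simp add: subvec_def vec_eq_iff)

lemma embed_diff: "embed act (x - y) = embed act x - embed act y"
  by (simp add: embed_def vec_eq_iff)

lemma pos_def_submat:
  assumes A: "pos_def_matrix A" and "inj act"
  shows "pos_def_matrix (submat act A)"
proof -
  have "transpose (submat act A) = submat act A"
    using A by (simp add: pos_def_matrix_def submat_def transpose_def vec_eq_iff)
  moreover have "0 < z \<bullet> (submat act A *v z)" if "z \<noteq> 0" for z
  proof -
    have "embed act z \<noteq> 0"
      using norm_embed[OF \<open>inj act\<close>, of z] that by auto
    then have "0 < embed act z \<bullet> (A *v embed act z)"
      using A by (simp add: pos_def_matrix_def)
    then show ?thesis
      using \<open>inj act\<close> by (simp add: embed_inner submat_mult)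
  qed
  ultimately show ?thesis by (simp add: pos_def_matrix_def)
qed

lemma bounded_linear_subvec: "bounded_linear (subvec act)"
proof -
  have "linear (subvec act)"
    by (rule linearI) (simp_all add: subvec_def vec_eq_iff)
  then show ?thesis by (rule linear_conv_bounded_linear[THEN iffD1])
qed

context logistic_sample
begin

text \<open>
  The minimizer of the limiting quadratic form among the vectors supported on the coordinates
  enumerated by \<open>act\<close>. The scaled errors of the estimators below are compared with it.
\<close>

definition limit_error :: "('a::finite \<Rightarrow> 'b) \<Rightarrow> (real \<times> (real ^ 'b)) list \<Rightarrow> real ^ 'a" where
  "limit_error act vs = matrix_inv (submat act Info) *v subvec act (scaled_score \<beta> vs)"

text \<open>The stationarity condition of the quadratic form in the selected coordinates.\<close>

lemma limit_error_normal_equation: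
  assumes "inj act"
  shows "(Info *v embed act (limit_error act vs)) $ act i = scaled_score \<beta> vs $ act i"
proof -
  have "submat act Info *v limit_error act vs = subvec act (scaled_score \<beta> vs)"
    using pos_def_matrix_inv(2)[OF pos_def_submat[OF pos_def_Info assms]]
    by (simp add: limit_error_def matrix_vector_mul_assoc)
  then show ?thesis
    using submat_mult[OF assms, of Info "limit_error act vs"]
    by (simp add: subvec_def vec_eq_iff)
qed

text \<open>
  With \<open>I\<close> the block of the information matrix, \<open>limit_error\<close> is \<open>inverse I\<close> times the score, whose
  covariance is \<open>I\<close>; hence the covariance \<open>inverse I ** I ** inverse I = inverse I\<close>.
\<close>

theorem limit_error_normal:
  fixes act :: "'a::finite \<Rightarrow> 'b"
  assumes "inj act"
  shows "conv_in_distribution M (\<lambda>n w. limit_error act (sample V n w))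
    (mv_normal 0 (matrix_inv (submat act Info)))"
proof -
  let ?C = "matrix_inv (submat act Info)"
  define f where "f ob = ?C *v subvec act (score \<beta> ob)" for ob
  have pd: "pos_def_matrix (submat act Info)"
    by (rule pos_def_submat[OF pos_def_Info assms])
  have pdC: "pos_def_matrix ?C"
    by (rule pos_def_matrix_inv(4)[OF pd])
  have lin: "bounded_linear (\<lambda>s. ?C *v subvec act s)"
    by (rule bounded_linear_compose[OF matrix_vector_mul_bounded_linear bounded_linear_subvec])
  then have "(\<lambda>s. ?C *v subvec act s) \<in> borel_measurable borel"
    by (intro borel_measurable_continuous_onI linear_continuous_on)
  from measurable_compose[OF borel_measurable_score[of \<beta>] this]
  have f_meas [measurable]: "f \<in> borel_measurable borel"
    by (simp add: f_def[abs_def])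
  have tf: "t \<bullet> f ob = embed act (?C *v t) \<bullet> score \<beta> ob" for t ob
    using symmetric_inner_commute[of ?C t "subvec act (score \<beta> ob)"] pdC assms
    by (simp add: f_def embed_inner pos_def_matrix_def)
  obtain K where K: "\<And>ob. ob \<in> Obs \<Longrightarrow> norm (f ob) \<le> K"
    using Obs_bound[of f] by blast
  have "conv_in_distribution M (\<lambda>n w. (1 / sqrt n) *\<^sub>R (\<Sum>i<n. f (V i w))) (mv_normal 0 ?C)"
  proof (rule multivariate_clt[OF _ _ _ _ _ pdC])
    show "indep_vars (\<lambda>_. borel) (\<lambda>i w. f (V i w)) UNIV"
      by (rule indep_vars_compose2[OF V_indep]) simp
    show "distr M borel (\<lambda>w. f (V i w)) = distr M borel (\<lambda>w. f (V 0 w))" for i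
      by (rule distr_comp_eq[OF _ _ V_ident]) simp_all
    show "norm (f (V i w)) \<le> K" if "w \<in> space M" for i w
      using K V_Obs[OF that] by blast
    fix t
    let ?s = "embed act (?C *v t)"
    have "expectation (\<lambda>w. t \<bullet> f (V 0 w)) = expectation (\<lambda>w. ?s \<bullet> score \<beta> (v w))"
      unfolding tf by (rule expectation_eq_of_distr_eq[OF _ _ _ V_copies]) simp_all
    then show "expectation (\<lambda>w. t \<bullet> f (V 0 w)) = 0"
      by (simp add: score_mean)
    have "expectation (\<lambda>w. (t \<bullet> f (V 0 w))\<^sup>2) = expectation (\<lambda>w. (?s \<bullet> score \<beta> (v w))\<^sup>2)"
      unfolding tf by (rule expectation_eq_of_distr_eq[OF _ _ _ V_copies]) simp_all
    also have "\<dots> = ?s \<bullet> (Info *v ?s)"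
      by (rule score_covariance)
    also have "\<dots> = (?C *v t) \<bullet> (submat act Info *v (?C *v t))"
      using assms by (simp add: embed_inner submat_mult)
    also have "\<dots> = t \<bullet> (?C *v t)"
      by (simp add: matrix_vector_mul_assoc pos_def_matrix_inv(2)[OF pd] inner_commute)
    finally show "expectation (\<lambda>w. (t \<bullet> f (V 0 w))\<^sup>2) = t \<bullet> (?C *v t)" .
  qed
  moreover have "limit_error act (sample V n w) = (1 / sqrt n) *\<^sub>R (\<Sum>i<n. f (V i w))" for n w
    unfolding limit_error_def scaled_score_sample f_def
    by (simp only: linear_scale[OF bounded_linear.linear[OF lin]] linear_sum[OF bounded_linear.linear[OF lin]])
  ultimately show ?thesis by simp
qed

lemma scaled_nll_convex: "convex_on UNIV (scaled_nll \<beta> vs)"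
proof -
  have "convex_on UNIV (\<lambda>u. loglik vs \<beta> + (- loglik vs (\<beta> + (1 / sqrt (length vs)) *\<^sub>R u)))"
    by (intro convex_on_add convex_on_affine[OF convex_on_neg_loglik]) (simp add: convex_on_const)
  then show ?thesis
    by (simp add: scaled_nll_def[abs_def])
qed

lemma scaled_nll_0: "scaled_nll \<beta> vs 0 = 0"
  by (simp add: scaled_nll_def)

end

text \<open>
  The penalties are functions of the scaled error \<open>u\<close>, relative to their values at the true
  parameter. The same argument serves twice: with no penalty and all coordinates it gives the
  asymptotic normality of the maximum likelihood estimator, from which the adaptive weights are
  computed, and with the actual penalties it gives the result.
\<close>

locale penalized_sample = logistic_sample M v V \<beta> Obs
  for M :: "'w measure" and v :: "'w \<Rightarrow> real \<times> (real ^ 'b)" and V \<beta> Obs +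
  fixes act :: "'a::finite \<Rightarrow> 'b"
    and N1 N2 P0 :: "(real \<times> (real ^ 'b)) list \<Rightarrow> real ^ 'b \<Rightarrow> real"
  assumes inj_act: "inj act"
    and N1: "convex_on UNIV (N1 vs)" "N1 vs 0 = 0"
    and N2: "convex_on UNIV (N2 vs)" "N2 vs 0 = 0" "0 \<le> N2 vs u"
    and P0: "P0 vs 0 = 0"
    and flat: "restrict_coords (range act) u = u \<Longrightarrow> N2 vs u = 0"
    and N1_small: "\<epsilon> > 0 \<Longrightarrow> whp (\<lambda>vs. \<forall>u. \<bar>N1 vs u\<bar> \<le> \<epsilon> * norm u)"
    and P0_small: "\<epsilon> > 0 \<Longrightarrow> whp (\<lambda>vs. \<forall>u. \<bar>P0 vs u\<bar> \<le> \<epsilon>)"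
    and steep: "whp (\<lambda>vs. \<forall>u. norm u \<le> R \<longrightarrow> C * norm (u - restrict_coords (range act) u) \<le> N2 vs u)"
begin

definition scaled_objective :: "(real \<times> (real ^ 'b)) list \<Rightarrow> real ^ 'b \<Rightarrow> real" where
  "scaled_objective vs u = scaled_nll \<beta> vs u + N1 vs u + N2 vs u + P0 vs u"

lemma whp_perturbed_quadratic:
  obtains \<kappa> \<Lambda> where "\<kappa> > 0" "\<Lambda> \<ge> 0"
    "\<And>B \<epsilon>. B \<ge> 0 \<Longrightarrow> 0 < \<epsilon> \<Longrightarrow> \<epsilon> \<le> 1 / 4 \<Longrightarrow> whp (\<lambda>vs. norm (scaled_score \<beta> vs) \<le> B \<longrightarrow>
      perturbed_quadratic Info \<kappa> \<Lambda> B \<epsilon> (2 * (B + 3) / \<kappa> + 1) (scaled_score \<beta> vs)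
        (scaled_nll \<beta> vs) (N1 vs) (N2 vs) (P0 vs))"
proof -
  obtain \<kappa> \<Lambda> where b: "\<kappa> > 0" "\<Lambda> \<ge> 0" "\<And>u. \<kappa> * (norm u)\<^sup>2 \<le> u \<bullet> (Info *v u)"
    "\<And>u. norm (Info *v u) \<le> \<Lambda> * norm u"
    using pos_def_bounds[OF pos_def_Info] by blast
  show thesis
  proof (rule that[OF b(1,2)])
    fix B \<epsilon> :: real assume B: "B \<ge> 0" and \<epsilon>: "0 < \<epsilon>" "\<epsilon> \<le> 1 / 4"
    let ?R = "2 * (B + 3) / \<kappa> + 1"
    have R: "?R \<ge> 0"
      using b(1) B by simp
    have "whp (\<lambda>vs. (\<forall>u. norm u \<le> ?R \<longrightarrow>
        \<bar>scaled_nll \<beta> vs u - (- (scaled_score \<beta> vs \<bullet> u) + u \<bullet> (Info *v u) / 2)\<bar> \<le> \<epsilon>)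
      \<and> (\<forall>u. \<bar>N1 vs u\<bar> \<le> \<epsilon> * norm u) \<and> (\<forall>u. \<bar>P0 vs u\<bar> \<le> \<epsilon>))"
      using \<epsilon>(1) R by (intro whp_conj whp_local_quadratic N1_small P0_small)
    then show "whp (\<lambda>vs. norm (scaled_score \<beta> vs) \<le> B \<longrightarrow>
        perturbed_quadratic Info \<kappa> \<Lambda> B \<epsilon> ?R (scaled_score \<beta> vs)
          (scaled_nll \<beta> vs) (N1 vs) (N2 vs) (P0 vs))"
    proof (rule whp_mono, intro always_eventually allI impI, goal_cases)
      case (1 n vs)
      then show ?case
        using pos_def_Info b B \<epsilon>
        by unfold_locales (auto simp: pos_def_matrix_def scaled_nll_convex scaled_nll_0 N1 N2 P0)
    qed
  qed
qed

lemma whp_positive_outside_ball: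
  assumes "B \<ge> 0"
  shows "\<exists>R>0. whp (\<lambda>vs. norm (scaled_score \<beta> vs) \<le> B \<longrightarrow> (\<forall>u. R \<le> norm u \<longrightarrow> 0 < scaled_objective vs u))"
proof (rule whp_perturbed_quadratic, goal_cases)
  case (1 \<kappa> \<Lambda>)
  note \<kappa> = 1(1)
  from 1(3)[OF assms, of "1 / 4"]
  have "whp (\<lambda>vs. norm (scaled_score \<beta> vs) \<le> B \<longrightarrow>
    perturbed_quadratic Info \<kappa> \<Lambda> B (1 / 4) (2 * (B + 3) / \<kappa> + 1) (scaled_score \<beta> vs)
      (scaled_nll \<beta> vs) (N1 vs) (N2 vs) (P0 vs))"
    by simp
  then have "whp (\<lambda>vs. norm (scaled_score \<beta> vs) \<le> B \<longrightarrow>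
      (\<forall>u. 2 * (B + 3) / \<kappa> + 1 \<le> norm u \<longrightarrow> 0 < scaled_objective vs u))"
  proof (rule whp_mono, intro always_eventually allI impI, goal_cases)
    case (1 n vs u)
    then interpret Q: perturbed_quadratic Info \<kappa> \<Lambda> B "1 / 4" "2 * (B + 3) / \<kappa> + 1" "scaled_score \<beta> vs"
      "scaled_nll \<beta> vs" "N1 vs" "N2 vs" "P0 vs"
      by blast
    show ?case
      using Q.F_pos_outside[of u] 1 by (simp add: Q.F_def scaled_objective_def)
  qed
  moreover have "0 < 2 * (B + 3) / \<kappa> + 1"
    using \<kappa> assms by (simp add: add_nonneg_pos)
  ultimately show ?thesis by blast
qed

theorem whp_coercive: "whp (\<lambda>vs. \<exists>R>0. \<forall>u. R \<le> norm u \<longrightarrow> 0 < scaled_objective vs u)"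
proof (rule whp_if_bounded_score)
  fix B :: real assume "B \<ge> 0"
  then obtain R where "R > 0"
    "whp (\<lambda>vs. norm (scaled_score \<beta> vs) \<le> B \<longrightarrow> (\<forall>u. R \<le> norm u \<longrightarrow> 0 < scaled_objective vs u))"
    using whp_positive_outside_ball by blast
  then show "whp (\<lambda>vs. norm (scaled_score \<beta> vs) \<le> B \<longrightarrow> (\<exists>R>0. \<forall>u. R \<le> norm u \<longrightarrow> 0 < scaled_objective vs u))"
    by (elim whp_mono) (auto intro!: always_eventually)
qed

lemma whp_minimizer_bounded:
  assumes "B \<ge> 0" and min: "whp (\<lambda>vs. \<forall>u. scaled_objective vs (z vs) \<le> scaled_objective vs u)"
  shows "\<exists>R>0. whp (\<lambda>vs. norm (scaled_score \<beta> vs) \<le> B \<longrightarrow> norm (z vs) < R)"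
proof -
  obtain R where R: "R > 0"
    "whp (\<lambda>vs. norm (scaled_score \<beta> vs) \<le> B \<longrightarrow> (\<forall>u. R \<le> norm u \<longrightarrow> 0 < scaled_objective vs u))"
    using whp_positive_outside_ball[OF assms(1)] by blast
  have 0: "scaled_objective vs 0 = 0" for vs
    by (simp add: scaled_objective_def scaled_nll_0 N1 N2 P0)
  from whp_conj[OF R(2) min]
  have "whp (\<lambda>vs. norm (scaled_score \<beta> vs) \<le> B \<longrightarrow> norm (z vs) < R)"
  proof (rule whp_mono, intro always_eventually allI impI, goal_cases)
    case (1 n vs)
    then have "scaled_objective vs (z vs) \<le> 0"
      using 0[of vs] by metis
    then show ?case
      using 1 by (meson not_le)
  qed
  then show ?thesis using R(1) by blast
qed

lemma whp_minimizer_close: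
  assumes min: "whp (\<lambda>vs. \<forall>u. scaled_objective vs (z vs) \<le> scaled_objective vs u)" and "\<eta> > 0"
  shows "whp (\<lambda>vs. norm (subvec act (z vs) - limit_error act vs) \<le> \<eta>)"
proof (rule whp_if_bounded_score)
  fix B :: real assume "B \<ge> 0"
  show "whp (\<lambda>vs. norm (scaled_score \<beta> vs) \<le> B \<longrightarrow> norm (subvec act (z vs) - limit_error act vs) \<le> \<eta>)"
  proof (rule whp_perturbed_quadratic, goal_cases)
    case (1 \<kappa> \<Lambda>)
    note b = 1(1,2) and Q = 1(3)[OF \<open>B \<ge> 0\<close>]
    let ?R = "2 * (B + 3) / \<kappa> + 1"
    have R: "?R \<ge> 0" using b \<open>B \<ge> 0\<close> by simp
    \<comment> \<open>The tolerance for which the deterministic bound on the squared distance is at most \<open>\<eta>\<^sup>2\<close>.\<close>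
    define \<epsilon> where "\<epsilon> = min (1 / 4) (\<eta>\<^sup>2 * \<kappa> / (4 * (2 + ?R)))"
    have "0 < 4 * (2 + r)" if "0 \<le> r" for r :: real
      using that by simp
    from this[OF R] have den: "0 < 4 * (2 + ?R)" .
    moreover have "0 < \<eta>\<^sup>2 * \<kappa>"
      using \<open>\<eta> > 0\<close> b(1) by simp
    ultimately have "0 < \<eta>\<^sup>2 * \<kappa> / (4 * (2 + ?R))"
      by (rule divide_pos_pos[rotated])
    then have \<epsilon>: "0 < \<epsilon>" "\<epsilon> \<le> 1 / 4"
      unfolding \<epsilon>_def by linarith+
    have small: "4 * \<epsilon> * (2 + ?R) / \<kappa> \<le> \<eta>\<^sup>2"
    proof -
      have "\<epsilon> \<le> \<eta>\<^sup>2 * \<kappa> / (4 * (2 + ?R))" by (simp add: \<epsilon>_def)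
      then have "\<epsilon> * (4 * (2 + ?R)) \<le> \<eta>\<^sup>2 * \<kappa>"
        by (simp only: pos_le_divide_eq[OF den])
      then show ?thesis
        using b(1) by (subst pos_divide_le_eq) (auto simp: mult_ac)
    qed
    from whp_conj[OF whp_conj[OF Q[OF \<epsilon>] min] steep[of ?R "B + \<Lambda> * ?R"]]
    show ?case
    proof (rule whp_mono, intro always_eventually allI impI, goal_cases)
      case (1 n vs)
      then interpret Q: perturbed_quadratic Info \<kappa> \<Lambda> B \<epsilon> ?R "scaled_score \<beta> vs"
        "scaled_nll \<beta> vs" "N1 vs" "N2 vs" "P0 vs"
        by blast
      have "(norm (restrict_coords (range act) (z vs) - embed act (limit_error act vs)))\<^sup>2
          \<le> 4 * \<epsilon> * (2 + ?R) / \<kappa>"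
      proof (rule Q.minimizer_near_quadratic_minimizer)
        show "Q.F (z vs) \<le> Q.F u" for u
          using 1 by (simp add: Q.F_def scaled_objective_def)
        show "(Info *v embed act (limit_error act vs)) $ i = scaled_score \<beta> vs $ i" if "i \<in> range act" for i
          using that limit_error_normal_equation[OF inj_act] by auto
      qed (use 1 in \<open>auto simp: flat restrict_coords_embed\<close>)
      also note small
      also have "restrict_coords (range act) (z vs) - embed act (limit_error act vs)
          = embed act (subvec act (z vs) - limit_error act vs)"
        by (simp add: embed_diff embed_subvec[OF inj_act])
      finally have "(norm (subvec act (z vs) - limit_error act vs))\<^sup>2 \<le> \<eta>\<^sup>2"
        by (simp add: norm_embed[OF inj_act])
      then show ?case
        using \<open>\<eta> > 0\<close> by (simp add: power2_le_iff_abs_le)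
    qed
  qed
qed

theorem minimizer_asymptotically_normal:
  assumes min: "whp (\<lambda>vs. \<forall>u. scaled_objective vs (sqrt (length vs) *\<^sub>R (b vs - \<beta>)) \<le> scaled_objective vs u)"
  shows "conv_in_distribution M
    (\<lambda>n w. sqrt n *\<^sub>R (subvec act (b (sample V n w)) - subvec act \<beta>))
    (mv_normal 0 (matrix_inv (submat act Info)))"
proof (rule conv_in_distribution_slutsky[OF prob_space_axioms _ _ limit_error_normal[OF inj_act]])
  let ?z = "\<lambda>vs. sqrt (length vs) *\<^sub>R (b vs - \<beta>)"
  show "prob_space (mv_normal 0 (matrix_inv (submat act Info)))"
    by (intro mv_normal_prob_space pos_def_matrix_inv(4) pos_def_submat pos_def_Info inj_act)
  show "(\<lambda>w. sqrt n *\<^sub>R (subvec act (b (sample V n w)) - subvec act \<beta>)) \<in> borel_measurable M" for n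
    by (rule measurable_of_sample)
  fix \<epsilon> \<delta> :: real assume "\<epsilon> > 0" "\<delta> > 0"
  have "\<forall>\<^sub>F n in sequentially. prob {w \<in> space M.
      \<not> norm (subvec act (?z (sample V n w)) - limit_error act (sample V n w)) \<le> \<epsilon>} \<le> \<delta>"
    using whp_minimizer_close[OF min \<open>\<epsilon> > 0\<close>] \<open>\<delta> > 0\<close> unfolding whp_iff by simp
  moreover have "subvec act (c *\<^sub>R (x - \<beta>)) = c *\<^sub>R (subvec act x - subvec act \<beta>)" for c x
    by (simp only: linear_scale[OF bounded_linear.linear[OF bounded_linear_subvec]] subvec_diff)
  ultimately show "\<forall>\<^sub>F n in sequentially. prob {w \<in> space M. \<epsilon> <
      norm (sqrt n *\<^sub>R (subvec act (b (sample V n w)) - subvec act \<beta>) - limit_error act (sample V n w))} \<le> \<delta>"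
    by (simp add: not_le)
qed simp

end

lemma subvec_id: "subvec id x = x" and submat_id: "submat id A = A"
  by (simp_all add: subvec_def submat_def vec_eq_iff)

section \<open>The maximum likelihood estimator\<close>

locale mle_sample = logistic_sample M v V \<beta> Obs
  for M :: "'w measure" and v :: "'w \<Rightarrow> real \<times> (real ^ 'b)" and V \<beta> Obs +
  fixes T :: "(real \<times> (real ^ 'b)) list \<Rightarrow> real ^ 'b" and m :: nat
  assumes T: "set vs \<subseteq> Obs \<Longrightarrow> m < length vs \<Longrightarrow> \<exists>b. is_mle vs b \<Longrightarrow> is_mle vs (T vs)"
begin

sublocale unpenalized: penalized_sample M v V \<beta> Obs id "\<lambda>_ _. 0" "\<lambda>_ _. 0" "\<lambda>_ _. 0"
proof
  show "whp (\<lambda>vs. \<forall>u. norm u \<le> R \<longrightarrow> C * norm (u - restrict_coords (range id) u) \<le> 0)" for R C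
    by (simp add: restrict_coords_def whp_def)
qed (simp_all add: convex_on_const whp_def)

lemma scaled_to_parameter:
  assumes "length vs > 0"
  shows "\<beta> + (1 / sqrt (length vs)) *\<^sub>R (sqrt (length vs) *\<^sub>R (b - \<beta>)) = b"
  using assms by simp

lemma whp_is_mle: "whp (\<lambda>vs. is_mle vs (T vs))"
  using unpenalized.whp_coercive
proof (rule whp_mono, intro eventually_mono[OF eventually_gt_at_top[of m]] allI impI, goal_cases)
  case (1 n vs)
  then obtain R where R: "R > 0" "\<And>u. R \<le> norm u \<Longrightarrow> 0 < scaled_nll \<beta> vs u"
    by (auto simp: unpenalized.scaled_objective_def)
  have "\<exists>x. \<forall>y. - loglik vs x \<le> - loglik vs y"
  proof (rule lsc_coercive_attains_min[where a = \<beta> and R = R and c = "1 / sqrt (length vs)"])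
    show "\<forall>\<^sub>F y in nhds x. c < - loglik vs y" if "c < - loglik vs x" for x c
      using that by (intro continuous_imp_lsc continuous_intros continuous_on_loglik)
    show "- loglik vs \<beta> \<le> - loglik vs (\<beta> + (1 / sqrt (length vs)) *\<^sub>R u)" if "R \<le> norm u" for u
      using R(2)[OF that] by (simp add: scaled_nll_def)
    show "0 < 1 / sqrt (length vs)"
      using 1 by auto
  qed (rule R)
  then obtain b where "\<And>y. loglik vs y \<le> loglik vs b" by auto
  then have "is_mle vs b"
    by (simp add: is_mle_def is_arg_max_def not_less)
  then show ?case
    using 1 T[of vs, OF _ _ exI[of _ b]] by simp
qed

lemma whp_mle_minimizes:
  "whp (\<lambda>vs. \<forall>u. unpenalized.scaled_objective vs (sqrt (length vs) *\<^sub>R (T vs - \<beta>))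
    \<le> unpenalized.scaled_objective vs u)"
  using whp_is_mle
proof (rule whp_mono, intro eventually_mono[OF eventually_gt_at_top[of 0]] allI impI, goal_cases)
  case (1 n vs u)
  then have "loglik vs y \<le> loglik vs (T vs)" for y
    by (simp add: is_mle_def is_arg_max_def not_less)
  moreover have "length vs > 0" using 1 by simp
  ultimately show ?case
    using scaled_to_parameter[of vs "T vs"]
    by (simp add: unpenalized.scaled_objective_def scaled_nll_def)
qed

theorem mle_asymptotically_normal:
  "conv_in_distribution M (\<lambda>n w. sqrt n *\<^sub>R (T (sample V n w) - \<beta>)) (mv_normal 0 (matrix_inv Info))"
  using unpenalized.minimizer_asymptotically_normal[OF whp_mle_minimizes]
  by (simp add: subvec_id submat_id)

text \<open>
  The event that the coordinate vanishes says that the scaled error lies in a hyperplane. This is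
  a closed set, and a null set for the limiting normal distribution because that has a density.
  The fact is needed because an inactive block that is estimated as exactly zero has weight
  \<open>0 powr (- \<gamma>) = 0\<close>, so that its group would not be penalised at all.
\<close>

theorem whp_mle_coordinate_nonzero:
  assumes "\<beta> $ i = 0"
  shows "whp (\<lambda>vs. T vs $ i \<noteq> 0)"
proof -
  let ?C = "{z :: real ^ 'b. axis i 1 \<bullet> z = 0}"
  have "closed ?C"
    by (rule closed_hyperplane)
  have "negligible ?C"
    by (rule negligible_hyperplane) simp
  then have "?C \<in> null_sets lborel"
    using borel_closed[OF \<open>closed ?C\<close>]
    by (simp only: negligible_iff_null_sets null_sets_completion_iff sets_lborel)
  then have "measure (mv_normal 0 (matrix_inv Info)) ?C = 0"
    by (rule mv_normal_null)
  then have "(\<lambda>n. prob {w \<in> space M. sqrt n *\<^sub>R (T (sample V n w) - \<beta>) \<in> ?C}) \<longlonglongrightarrow> 0"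
    by (intro conv_in_distribution_closed_null[OF prob_space_axioms _ _ mle_asymptotically_normal \<open>closed ?C\<close>]
        mv_normal_prob_space pos_def_matrix_inv(4) pos_def_Info) simp_all
  then have "whp (\<lambda>vs. sqrt (length vs) *\<^sub>R (T vs - \<beta>) \<notin> ?C)"
    by (simp only: whp_def not_not length_sample)
  then show ?thesis
  proof (rule whp_mono, intro always_eventually allI impI, goal_cases)
    case (1 n vs)
    then show ?case
      using assms by (auto simp: inner_axis')
  qed
qed

end

section \<open>Group norms and the fusion penalty\<close>

lemma finite_obs_space:
  fixes idx :: "nat \<times> nat \<Rightarrow> 'c::finite"
  assumes "coord_layout J p idx"
  shows "finite (obs_space J p idx)"
proof -
  have "dummy_coded J p idx x \<Longrightarrow> x $ i \<in> {0, 1}" for x and i :: "'c option"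
  proof (cases i)
    case (Some c)
    assume x: "dummy_coded J p idx x"
    have "c \<in> idx ` dummy_coords {1..J} p"
      using assms by (simp add: coord_layout_def bij_betw_def)
    then obtain j k where "c = idx (j, k)" "j \<in> {1..J}" "k \<in> {1..p j}"
      by (auto simp: dummy_coords_def)
    with x Some show ?thesis
      by (auto simp: dummy_coded_def)
  qed (simp add: dummy_coded_def)
  then have "vec_nth x \<in> (\<Pi>\<^sub>E i\<in>UNIV. {0, 1})" if "dummy_coded J p idx x" for x :: "real ^ 'c option"
    using that by (simp add: PiE_UNIV_domain Pi_iff)
  then have "{x :: real ^ 'c option. dummy_coded J p idx x} \<subseteq> vec_lambda ` (\<Pi>\<^sub>E i\<in>UNIV. {0, 1})"
    by (intro subsetI image_eqI[of _ vec_lambda "vec_nth _"]) simp_all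
  moreover have "finite (\<Pi>\<^sub>E i\<in>(UNIV :: 'c option set). {0, 1 :: real})"
    by (rule finite_PiE) simp_all
  ultimately have "finite {x :: real ^ 'c option. dummy_coded J p idx x}"
    by (metis finite_imageI finite_subset)
  then show ?thesis
    by (simp add: obs_space_def)
qed

lemma coef_add: "coef idx (x + y) j r = coef idx x j r + coef idx y j r"
  and coef_scale: "coef idx (c *\<^sub>R x) j r = c * coef idx x j r"
  by (simp_all add: coef_def)

lemma continuous_on_coef: "continuous_on UNIV (\<lambda>\<beta>. coef idx \<beta> j r)"
  unfolding coef_def by (cases "r = 0") (auto intro!: continuous_intros)

lemma block_norm_nonneg: "0 \<le> block_norm p idx x j"
  by (simp add: block_norm_def L2_set_nonneg)

lemma block_norm_triangle: "block_norm p idx (x + y) j \<le> block_norm p idx x j + block_norm p idx y j"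
  unfolding block_norm_def coef_add by (rule L2_set_triangle_ineq)

lemma block_norm_scale: "block_norm p idx (c *\<^sub>R x) j = \<bar>c\<bar> * block_norm p idx x j"
proof -
  have "(\<Sum>k\<in>{1..p j}. (coef idx (c *\<^sub>R x) j k)\<^sup>2) = c\<^sup>2 * (\<Sum>k\<in>{1..p j}. (coef idx x j k)\<^sup>2)"
    by (simp add: coef_scale power_mult_distrib sum_distrib_left)
  then show ?thesis
    by (simp add: block_norm_def L2_set_def real_sqrt_mult)
qed

lemma block_norm_minus: "block_norm p idx (- x) j = block_norm p idx x j"
  using block_norm_scale[of p idx "- 1" x j] by simp

lemma block_norm_diff_le: "\<bar>block_norm p idx (x + y) j - block_norm p idx x j\<bar> \<le> block_norm p idx y j"
  using block_norm_triangle[of p idx x y j] block_norm_triangle[of p idx "x + y" "- y" j]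
  by (simp add: block_norm_minus)

lemma convex_on_block_norm: "convex_on UNIV (\<lambda>x. block_norm p idx x j)"
proof (rule convex_onI)
  fix t :: real and x y :: "real ^ 'a option"
  assume "0 < t" "t < 1"
  then show "block_norm p idx ((1 - t) *\<^sub>R x + t *\<^sub>R y) j
      \<le> (1 - t) * block_norm p idx x j + t * block_norm p idx y j"
    using block_norm_triangle[of p idx "(1 - t) *\<^sub>R x" "t *\<^sub>R y" j]
    by (simp add: block_norm_scale)
qed simp

lemma continuous_on_block_norm: "continuous_on UNIV (\<lambda>\<beta>. block_norm p idx \<beta> j)"
  unfolding block_norm_def L2_set_def by (intro continuous_intros continuous_on_coef)

lemma coord_le_block_norm:
  assumes "k \<in> {1..p j}"
  shows "\<bar>x $ Some (idx (j, k))\<bar> \<le> block_norm p idx x j"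
proof -
  have "\<bar>coef idx x j k\<bar> \<le> L2_set (\<lambda>k. \<bar>coef idx x j k\<bar>) {1..p j}"
    using assms by (intro member_le_L2_set) auto
  also have "\<dots> = block_norm p idx x j"
    by (simp add: block_norm_def L2_set_def)
  finally show ?thesis
    using assms by (simp add: coef_def)
qed

lemma block_norm_eq_0_iff: "block_norm p idx x j = 0 \<longleftrightarrow> (\<forall>k\<in>{1..p j}. coef idx x j k = 0)"
  by (simp add: block_norm_def L2_set_eq_0_iff)

lemma block_norm_le_norm:
  assumes "coord_layout J p idx" "j \<in> {1..J}"
  shows "block_norm p idx x j \<le> norm x"
proof -
  let ?g = "\<lambda>k. Some (idx (j, k))"
  have inj: "inj_on idx (dummy_coords {1..J} p)"
    using assms by (simp add: coord_layout_def bij_betw_def)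
  have "inj_on ?g {1..p j}"
  proof (rule inj_onI)
    fix k k' assume "k \<in> {1..p j}" "k' \<in> {1..p j}" "?g k = ?g k'"
    then show "k = k'"
      using inj_onD[OF inj, of "(j, k)" "(j, k')"] assms(2) by (simp add: dummy_coords_def)
  qed
  then have "(\<Sum>k\<in>{1..p j}. (x $ ?g k)\<^sup>2) = (\<Sum>i\<in>?g ` {1..p j}. (x $ i)\<^sup>2)"
    by (simp add: sum.reindex)
  also have "\<dots> \<le> (\<Sum>i\<in>UNIV. (x $ i)\<^sup>2)"
    by (intro sum_mono2) auto
  finally have "sqrt (\<Sum>k\<in>{1..p j}. (x $ ?g k)\<^sup>2) \<le> sqrt (\<Sum>i\<in>UNIV. (x $ i)\<^sup>2)"
    by (rule real_sqrt_le_mono)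
  moreover have "(\<Sum>k\<in>{1..p j}. (coef idx x j k)\<^sup>2) = (\<Sum>k\<in>{1..p j}. (x $ ?g k)\<^sup>2)"
    by (intro sum.cong) (auto simp: coef_def)
  ultimately show ?thesis
    by (simp add: block_norm_def L2_set_def norm_vec_def)
qed

lemma l0_norm_bounds: "0 \<le> l0_norm t" "l0_norm t \<le> 1"
  by (simp_all add: l0_norm_def)

definition l0_part ::
    "nat \<Rightarrow> (nat \<Rightarrow> nat) \<Rightarrow> (nat \<times> nat \<Rightarrow> 'c::finite) \<Rightarrow> (nat \<Rightarrow> nat \<Rightarrow> nat \<Rightarrow> real) \<Rightarrow>
     real ^ 'c option \<Rightarrow> real" where
  "l0_part J p idx w0 \<beta> =
     (\<Sum>j=1..J. \<Sum>s\<le>p j. \<Sum>r<s. w0 j r s * l0_norm (coef idx \<beta> j r - coef idx \<beta> j s))"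

lemma l0_part_bounds:
  assumes w0: "\<forall>j\<in>{1..J}. \<forall>r s. r < s \<and> s \<le> p j \<longrightarrow> w0 j r s > 0"
  shows "0 \<le> l0_part J p idx w0 \<beta>" "l0_part J p idx w0 \<beta> \<le> (\<Sum>j=1..J. \<Sum>s\<le>p j. \<Sum>r<s. w0 j r s)"
  unfolding l0_part_def
proof -
  have w: "0 \<le> w0 j r s" if "j \<in> {1..J}" "s \<in> {..p j}" "r \<in> {..<s}" for j r s
    using w0 that by (auto intro!: less_imp_le)
  show "0 \<le> (\<Sum>j=1..J. \<Sum>s\<le>p j. \<Sum>r<s. w0 j r s * l0_norm (coef idx \<beta> j r - coef idx \<beta> j s))"
    by (intro sum_nonneg mult_nonneg_nonneg w l0_norm_bounds)
  show "(\<Sum>j=1..J. \<Sum>s\<le>p j. \<Sum>r<s. w0 j r s * l0_norm (coef idx \<beta> j r - coef idx \<beta> j s))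
      \<le> (\<Sum>j=1..J. \<Sum>s\<le>p j. \<Sum>r<s. w0 j r s)"
    by (intro sum_mono mult_left_le w l0_norm_bounds)
qed

text \<open>
  Differences that do not vanish at \<open>x\<close> do not vanish near \<open>x\<close>. This lower semicontinuity is what
  the existence of minimizers of the discontinuous objective rests on.
\<close>

lemma l0_part_locally_minimal:
  assumes w0: "\<forall>j\<in>{1..J}. \<forall>r s. r < s \<and> s \<le> p j \<longrightarrow> w0 j r s > 0"
  shows "\<forall>\<^sub>F y in nhds x. l0_part J p idx w0 x \<le> l0_part J p idx w0 y"
proof -
  have one: "\<forall>\<^sub>F y in nhds x. l0_norm (coef idx x j r - coef idx x j s) \<le> l0_norm (coef idx y j r - coef idx y j s)"
    for j r s
  proof (cases "coef idx x j r - coef idx x j s = 0")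
    case True
    then show ?thesis by (simp add: l0_norm_def)
  next
    case False
    have "open {y. coef idx y j r - coef idx y j s \<noteq> 0}"
      by (intro open_Collect_neq continuous_intros continuous_on_coef)
    then have "\<forall>\<^sub>F y in nhds x. y \<in> {y. coef idx y j r - coef idx y j s \<noteq> 0}"
      using False by (intro eventually_nhds_in_open) auto
    then show ?thesis
      by eventually_elim (simp add: l0_norm_def)
  qed
  have "\<forall>\<^sub>F y in nhds x. \<forall>j\<in>{1..J}. \<forall>s\<in>{..p j}. \<forall>r\<in>{..<s}.
      l0_norm (coef idx x j r - coef idx x j s) \<le> l0_norm (coef idx y j r - coef idx y j s)"
    by (intro eventually_ball_finite ballI one) auto
  then show ?thesis
  proof eventually_elim
    case (elim y)
    show ?case
      unfolding l0_part_def
    proof (intro sum_mono mult_left_mono)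
      fix j s r assume jsr: "j \<in> {1..J}" "s \<in> {..p j}" "r \<in> {..<s}"
      show "l0_norm (coef idx x j r - coef idx x j s) \<le> l0_norm (coef idx y j r - coef idx y j s)"
        using elim jsr by blast
      show "0 \<le> w0 j r s"
        using w0 jsr by (auto intro!: less_imp_le)
    qed
  qed
qed

text \<open>
  The maximum in \<open>a0\<close> dominates \<open>lam0 n\<close> times the weight of any pair in its range, which is
  positive and does not change with \<open>n\<close>. Since there is at least one coordinate, there is at least one pair.
\<close>

lemma lam0_tendsto_0:
  fixes idx :: "nat \<times> nat \<Rightarrow> 'c::finite"
  assumes layout: "coord_layout J p idx" and lam0: "\<forall>n. lam0 n \<ge> 0"
    and w0: "\<forall>j\<in>{1..J}. \<forall>r s. r < s \<and> s \<le> p j \<longrightarrow> w0 j r s > 0"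
    and a0: "(\<lambda>n. max_l0_weight J p (lam0 n) w0) \<longlonglongrightarrow> 0"
  shows "lam0 \<longlonglongrightarrow> 0"
proof -
  define LP where "LP = (if level_pairs J p 1 \<noteq> {} then level_pairs J p 1 else level_pairs J p 0)"
  have "LP \<noteq> {}"
  proof -
    have "undefined \<in> idx ` dummy_coords {1..J} p"
      using layout by (simp add: coord_layout_def bij_betw_def)
    then obtain j where "j \<in> {1..J}" "1 \<le> p j"
      by (auto simp: dummy_coords_def)
    then have "(j, 0, 1) \<in> level_pairs J p 0"
      by (auto simp: level_pairs_def)
    then show ?thesis by (auto simp: LP_def)
  qed
  moreover have sub: "LP \<subseteq> level_pairs J p 0"
    by (auto simp: LP_def level_pairs_def)
  ultimately obtain j r s where jrs: "(j, r, s) \<in> LP" "w0 j r s > 0"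
    using w0 by (fastforce simp: level_pairs_def)
  have "level_pairs J p 0 \<subseteq> (SIGMA j:{1..J}. {..p j} \<times> {..p j})"
    by (auto simp: level_pairs_def)
  then have "finite LP"
    by (rule finite_subset[OF subset_trans[OF sub]]) auto
  then have le: "lam0 n * w0 j r s \<le> max_l0_weight J p (lam0 n) w0" for n
    unfolding max_l0_weight_def LP_def[symmetric] using jrs(1) by (intro Max_ge) force+
  have "(\<lambda>n. lam0 n * w0 j r s) \<longlonglongrightarrow> 0"
  proof (rule tendsto_sandwich[OF _ _ tendsto_const a0])
    show "\<forall>\<^sub>F n in sequentially. 0 \<le> lam0 n * w0 j r s"
      using lam0 jrs(2) by simp
    show "\<forall>\<^sub>F n in sequentially. lam0 n * w0 j r s \<le> max_l0_weight J p (lam0 n) w0"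
      using le by simp
  qed
  then have "(\<lambda>n. lam0 n * w0 j r s / w0 j r s) \<longlonglongrightarrow> 0 / w0 j r s"
    using jrs(2) by (intro tendsto_divide tendsto_const) auto
  then show ?thesis using jrs(2) by simp
qed

lemma inverse_sqrt_eq_powr:
  assumes "n > 0"
  shows "1 / sqrt (real n) = real n powr (- 1 / 2)"
  using powr_minus_divide[of "real n" "1 / 2"] assms by (simp add: powr_half_sqrt)

lemma inactive_weight_rate:
  assumes "n > 0" "R > 0"
  shows "1 / sqrt (real n) * (R / sqrt (real n)) powr (- \<gamma>) = R powr (- \<gamma>) * real n powr ((\<gamma> - 1) / 2)"
proof -
  have "ln (sqrt (real n)) = ln (real n) / 2"
    using assms by (simp add: ln_sqrt)
  then have "ln (1 / sqrt (real n) * (R / sqrt (real n)) powr (- \<gamma>))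
      = ln (R powr (- \<gamma>) * real n powr ((\<gamma> - 1) / 2))"
    using assms by (simp add: ln_mult ln_div ln_powr field_simps)
  then show ?thesis
    using assms by (subst (asm) ln_inj_iff) auto
qed

section \<open>The adaptive group penalty\<close>

locale fgl_sample = mle_sample M v V \<beta> "obs_space J p idx" T "\<Sum>j=1..J. p j"
  for M :: "'w measure" and v :: "'w \<Rightarrow> real \<times> (real ^ 'c::finite option)" and V \<beta> J p
    and idx :: "nat \<times> nat \<Rightarrow> 'c::finite" and T +
  fixes act :: "'a::finite \<Rightarrow> 'c option" and lam1 lam0 :: "nat \<Rightarrow> real" and \<gamma> :: real
    and w0 :: "nat \<Rightarrow> nat \<Rightarrow> nat \<Rightarrow> real"
  assumes layout: "coord_layout J p idx"
    and act: "bij_betw act UNIV (active_coords J p idx \<beta>)"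
    and gamma: "\<gamma> > 0"
    and lam_nonneg: "lam1 n \<ge> 0" "lam0 n \<ge> 0"
    and w0_pos: "\<forall>j\<in>{1..J}. \<forall>r s. r < s \<and> s \<le> p j \<longrightarrow> w0 j r s > 0"
    and lam1_upper: "(\<lambda>n. lam1 n * real n powr (- 1 / 2)) \<longlonglongrightarrow> 0"
    and lam1_lower: "filterlim (\<lambda>n. lam1 n * real n powr ((\<gamma> - 1) / 2)) at_top sequentially"
    and lam0_lim: "lam0 \<longlonglongrightarrow> 0"
begin

abbreviation "active \<equiv> active_set J p idx \<beta>"
abbreviation "inactive \<equiv> {1..J} - active_set J p idx \<beta>"
abbreviation "bnorm \<equiv> block_norm p idx"

definition weight :: "(real \<times> (real ^ 'c option)) list \<Rightarrow> nat \<Rightarrow> real" where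
  "weight vs j = bnorm (T vs) j powr (- \<gamma>)"

abbreviation "scaled_weight vs j \<equiv> lam1 (length vs) / sqrt (length vs) * weight vs j"

definition active_penalty :: "(real \<times> (real ^ 'c option)) list \<Rightarrow> real ^ 'c option \<Rightarrow> real" where
  "active_penalty vs u = lam1 (length vs) *
    (\<Sum>j\<in>active. weight vs j * (bnorm (\<beta> + (1 / sqrt (length vs)) *\<^sub>R u) j - bnorm \<beta> j))"

definition inactive_penalty :: "(real \<times> (real ^ 'c option)) list \<Rightarrow> real ^ 'c option \<Rightarrow> real" where
  "inactive_penalty vs u = lam1 (length vs) *
    (\<Sum>j\<in>inactive. weight vs j * bnorm (\<beta> + (1 / sqrt (length vs)) *\<^sub>R u) j)"

definition fusion_penalty :: "(real \<times> (real ^ 'c option)) list \<Rightarrow> real ^ 'c option \<Rightarrow> real" where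
  "fusion_penalty vs u = lam0 (length vs) *
    (l0_part J p idx w0 (\<beta> + (1 / sqrt (length vs)) *\<^sub>R u) - l0_part J p idx w0 \<beta>)"

abbreviation objective :: "(real \<times> (real ^ 'c option)) list \<Rightarrow> real ^ 'c option \<Rightarrow> real" where
  "objective \<equiv> fgl_objective J p idx lam1 lam0 \<gamma> w0 T"

lemma weight_nonneg: "0 \<le> weight vs j"
  by (simp add: weight_def)

lemma active_subset: "active \<subseteq> {1..J}"
  by (auto simp: active_set_def)

lemma finite_active: "finite active"
  using active_subset finite_subset by blast

lemma bnorm_active: "j \<in> active \<Longrightarrow> 0 < bnorm \<beta> j"
proof -
  assume "j \<in> active"
  then have "bnorm \<beta> j \<noteq> 0"
    by (auto simp: active_set_def block_norm_eq_0_iff)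
  then show ?thesis
    using block_norm_nonneg[of p idx \<beta> j] by simp
qed

lemma bnorm_inactive: "j \<in> inactive \<Longrightarrow> bnorm \<beta> j = 0"
  by (auto simp: active_set_def block_norm_eq_0_iff)

lemma bnorm_shift_inactive:
  assumes "j \<in> inactive"
  shows "bnorm (\<beta> + u) j = bnorm u j"
  using block_norm_diff_le[of p idx u \<beta> j] bnorm_inactive[OF assms] by (simp add: add.commute)

lemma objective_eq:
  "objective vs b = - loglik vs b + lam1 (length vs) * (\<Sum>j=1..J. weight vs j * bnorm b j)
    + lam0 (length vs) * l0_part J p idx w0 b"
  by (simp add: fgl_objective_def penalty_def l0_part_def weight_def)

text \<open>
  The penalty of the inactive groups appears without a subtracted term, because their group norms
  vanish at the true parameter.
\<close>

lemma objective_shift: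
  "objective vs (\<beta> + (1 / sqrt (length vs)) *\<^sub>R u) - objective vs \<beta>
    = scaled_nll \<beta> vs u + active_penalty vs u + inactive_penalty vs u + fusion_penalty vs u"
proof -
  let ?b = "\<beta> + (1 / sqrt (length vs)) *\<^sub>R u"
  have split: "(\<Sum>j=1..J. f j) = (\<Sum>j\<in>active. f j) + (\<Sum>j\<in>inactive. f j)" for f :: "nat \<Rightarrow> real"
    using sum.subset_diff[OF active_subset, of f] by simp
  have "(\<Sum>j\<in>inactive. weight vs j * bnorm \<beta> j) = 0"
    by (intro sum.neutral) (simp add: bnorm_inactive)
  then show ?thesis
    unfolding objective_eq scaled_nll_def active_penalty_def inactive_penalty_def fusion_penalty_def split
    by (simp add: algebra_simps sum_subtractf)
qed

lemma range_act: "range act = active_coords J p idx \<beta>"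
  using act by (simp add: bij_betw_def)

lemma inactive_coordE:
  assumes "i \<notin> range act"
  obtains j k where "j \<in> inactive" "k \<in> {1..p j}" "i = Some (idx (j, k))"
proof (cases i)
  case None
  then show ?thesis
    using assms by (simp add: range_act active_coords_def)
next
  case (Some c)
  have "c \<in> idx ` dummy_coords {1..J} p"
    using layout by (simp add: coord_layout_def bij_betw_def)
  then obtain j k where jk: "c = idx (j, k)" "j \<in> {1..J}" "k \<in> {1..p j}"
    by (auto simp: dummy_coords_def)
  have "j \<notin> active"
    using assms Some jk by (auto simp: range_act active_coords_def dummy_coords_def)
  then show ?thesis
    using that jk Some by blast
qed

lemma inactive_coord_notin_range:
  assumes "j \<in> inactive" "k \<in> {1..p j}"
  shows "Some (idx (j, k)) \<notin> range act"
proof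
  assume "Some (idx (j, k)) \<in> range act"
  then obtain j' k' where jk': "idx (j, k) = idx (j', k')" "j' \<in> active" "k' \<in> {1..p j'}"
    by (auto simp: range_act active_coords_def dummy_coords_def)
  have "inj_on idx (dummy_coords {1..J} p)"
    using layout by (simp add: coord_layout_def bij_betw_def)
  moreover have "(j, k) \<in> dummy_coords {1..J} p" "(j', k') \<in> dummy_coords {1..J} p"
    using jk' assms active_subset by (auto simp: dummy_coords_def)
  ultimately have "(j, k) = (j', k')"
    using jk'(1) by (simp only: inj_on_eq_iff)
  then show False using assms jk' by auto
qed

lemma bnorm_restricted:
  assumes "restrict_coords (range act) u = u" "j \<in> inactive"
  shows "bnorm u j = 0"
  unfolding block_norm_eq_0_iff
proof
  fix k assume k: "k \<in> {1..p j}"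
  have "u $ Some (idx (j, k)) = restrict_coords (range act) u $ Some (idx (j, k))"
    by (simp only: assms(1))
  then show "coef idx u j k = 0"
    using inactive_coord_notin_range[OF assms(2) k] by (simp add: coef_def restrict_coords_def)
qed

lemma whp_mle_bounded:
  assumes "B \<ge> 0"
  shows "\<exists>R>0. whp (\<lambda>vs. norm (scaled_score \<beta> vs) \<le> B \<longrightarrow> norm (T vs - \<beta>) \<le> R / sqrt (length vs))"
proof -
  obtain R where R: "R > 0"
    "whp (\<lambda>vs. norm (scaled_score \<beta> vs) \<le> B \<longrightarrow> norm (sqrt (length vs) *\<^sub>R (T vs - \<beta>)) < R)"
    using unpenalized.whp_minimizer_bounded[OF assms whp_mle_minimizes] by blast
  from R(2) have "whp (\<lambda>vs. norm (scaled_score \<beta> vs) \<le> B \<longrightarrow> norm (T vs - \<beta>) \<le> R / sqrt (length vs))"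
  proof (rule whp_mono, intro eventually_mono[OF eventually_gt_at_top[of 0]] allI impI, goal_cases)
    case (1 n vs)
    then have "sqrt (length vs) * norm (T vs - \<beta>) \<le> R" "0 < sqrt (length vs)"
      by auto
    then show ?case
      by (simp add: pos_le_divide_eq mult.commute)
  qed
  then show ?thesis using R(1) by blast
qed

text \<open>
  For an active group, the estimated group norm stays away from zero, so the weight is bounded,
  and \<open>lam1 n / sqrt n\<close> tends to zero.
\<close>

lemma whp_active_weight:
  assumes j: "j \<in> active" and "\<epsilon> > 0"
  shows "whp (\<lambda>vs. scaled_weight vs j \<le> \<epsilon>)"
proof (rule whp_if_bounded_score)
  fix B :: real assume "B \<ge> 0"
  obtain R where R: "R > 0"
    "whp (\<lambda>vs. norm (scaled_score \<beta> vs) \<le> B \<longrightarrow> norm (T vs - \<beta>) \<le> R / sqrt (length vs))"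
    using whp_mle_bounded[OF \<open>B \<ge> 0\<close>] by blast
  define b where "b = bnorm \<beta> j / 2"
  have b: "b > 0" "bnorm \<beta> j = 2 * b" using bnorm_active[OF j] by (auto simp: b_def)
  have "(\<lambda>n. R / sqrt (real n)) \<longlonglongrightarrow> 0"
    by (rule tendsto_divide_0[OF tendsto_const])
      (rule filterlim_at_top_imp_at_infinity[OF filterlim_compose[OF sqrt_at_top filterlim_real_sequentially]])
  then have ev1: "\<forall>\<^sub>F n in sequentially. R / sqrt (real n) < b"
    using b by (intro order_tendstoD) auto
  have "(\<lambda>n. lam1 n * real n powr (- 1 / 2) * b powr (- \<gamma>)) \<longlonglongrightarrow> 0 * b powr (- \<gamma>)"
    by (intro tendsto_mult lam1_upper tendsto_const)
  then have ev2: "\<forall>\<^sub>F n in sequentially. lam1 n * real n powr (- 1 / 2) * b powr (- \<gamma>) < \<epsilon>"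
    using \<open>\<epsilon> > 0\<close> by (intro order_tendstoD) auto
  show "whp (\<lambda>vs. norm (scaled_score \<beta> vs) \<le> B \<longrightarrow> scaled_weight vs j \<le> \<epsilon>)"
    using R(2)
  proof (rule whp_mono, intro eventually_mono[OF eventually_conj[OF eventually_conj[OF ev1 ev2]
          eventually_gt_at_top[of 0]]] allI impI, goal_cases)
    case (1 n vs)
    then have n: "length vs = n" "n > 0" and close: "norm (T vs - \<beta>) \<le> R / sqrt n"
      and small: "R / sqrt n < b" "lam1 n * real n powr (- 1 / 2) * b powr (- \<gamma>) < \<epsilon>"
      by auto
    have "\<bar>bnorm (\<beta> + (T vs - \<beta>)) j - bnorm \<beta> j\<bar> \<le> bnorm (T vs - \<beta>) j"
      by (rule block_norm_diff_le)
    also have "\<dots> \<le> norm (T vs - \<beta>)"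
      using j active_subset by (intro block_norm_le_norm[OF layout]) auto
    also note close
    finally have "\<bar>bnorm (T vs) j - bnorm \<beta> j\<bar> \<le> R / sqrt n"
      by simp
    then have "b \<le> bnorm (T vs) j"
      using small(1) b(2) by linarith
    then have "weight vs j \<le> b powr (- \<gamma>)"
      unfolding weight_def using b gamma by (intro powr_mono2') auto
    then have "lam1 n * (1 / sqrt n) * weight vs j \<le> lam1 n * (1 / sqrt n) * b powr (- \<gamma>)"
      using lam_nonneg by (intro mult_left_mono) auto
    then have "lam1 n * (1 / sqrt n) * weight vs j \<le> \<epsilon>"
      using small(2) unfolding inverse_sqrt_eq_powr[OF n(2)] by linarith
    then show ?case
      by (simp add: n)
  qed
qed

text \<open>
  For an inactive group, the estimated group norm is of order at most \<open>1 / sqrt n\<close>, so its weight, if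
  the norm is not zero, is at least of order \<open>sqrt n powr \<gamma>\<close>; this meets the lower rate condition on
  \<open>lam1\<close>.
\<close>

lemma whp_inactive_weight:
  assumes j: "j \<in> inactive" and "1 \<le> p j"
  shows "whp (\<lambda>vs. C \<le> scaled_weight vs j)"
proof (rule whp_if_bounded_score)
  fix B :: real assume "B \<ge> 0"
  obtain R where R: "R > 0"
    "whp (\<lambda>vs. norm (scaled_score \<beta> vs) \<le> B \<longrightarrow> norm (T vs - \<beta>) \<le> R / sqrt (length vs))"
    using whp_mle_bounded[OF \<open>B \<ge> 0\<close>] by blast
  let ?i = "Some (idx (j, 1))"
  have k: "1 \<in> {1..p j}" using assms by simp
  have "\<beta> $ ?i = 0"
    using coord_le_block_norm[of 1 p j \<beta> idx] k bnorm_inactive[OF j] by simp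
  then have nz: "whp (\<lambda>vs. T vs $ ?i \<noteq> 0)"
    by (rule whp_mle_coordinate_nonzero)
  have "\<forall>\<^sub>F n in sequentially. C / R powr (- \<gamma>) \<le> lam1 n * real n powr ((\<gamma> - 1) / 2)"
    using lam1_lower by (simp add: filterlim_at_top)
  then have ev: "\<forall>\<^sub>F n in sequentially. C \<le> R powr (- \<gamma>) * (lam1 n * real n powr ((\<gamma> - 1) / 2))"
    by eventually_elim (use R(1) in \<open>simp add: pos_divide_le_eq mult.commute\<close>)
  show "whp (\<lambda>vs. norm (scaled_score \<beta> vs) \<le> B \<longrightarrow> C \<le> scaled_weight vs j)"
    using whp_conj[OF R(2) nz]
  proof (rule whp_mono, intro eventually_mono[OF eventually_conj[OF ev eventually_gt_at_top[of 0]]]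
      allI impI, goal_cases)
    case (1 n vs)
    then have n: "length vs = n" "n > 0" and close: "norm (T vs - \<beta>) \<le> R / sqrt n" and Tnz: "T vs $ ?i \<noteq> 0"
      and large: "C \<le> R powr (- \<gamma>) * (lam1 n * real n powr ((\<gamma> - 1) / 2))"
      by auto
    have "bnorm (T vs) j = bnorm (\<beta> + (T vs - \<beta>)) j" by simp
    also have "\<dots> = bnorm (T vs - \<beta>) j"
      by (rule bnorm_shift_inactive[OF j])
    also have "\<dots> \<le> norm (T vs - \<beta>)"
      using j by (intro block_norm_le_norm[OF layout]) auto
    also note close
    finally have "bnorm (T vs) j \<le> R / sqrt n" .
    moreover have "0 < bnorm (T vs) j"
      using coord_le_block_norm[of 1 p j "T vs" idx] k Tnz by linarith
    ultimately have "(R / sqrt n) powr (- \<gamma>) \<le> weight vs j"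
      unfolding weight_def using gamma by (intro powr_mono2') auto
    then have "lam1 n * (1 / sqrt n) * (R / sqrt n) powr (- \<gamma>) \<le> lam1 n * (1 / sqrt n) * weight vs j"
      using lam_nonneg by (intro mult_left_mono) auto
    moreover have "lam1 n * (1 / sqrt n) * (R / sqrt n) powr (- \<gamma>)
        = R powr (- \<gamma>) * (lam1 n * real n powr ((\<gamma> - 1) / 2))"
      using inactive_weight_rate[OF n(2) R(1), of \<gamma>] by (simp only: mult.assoc mult.left_commute)
    ultimately have "C \<le> lam1 n * (1 / sqrt n) * weight vs j"
      using large by linarith
    then show ?case
      by (simp add: n)
  qed
qed

sublocale penalized: penalized_sample M v V \<beta> "obs_space J p idx" act
  active_penalty inactive_penalty fusion_penalty
proof
  show "inj act"
    using act by (simp add: bij_betw_def)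
  have conv: "convex_on UNIV (\<lambda>u. lam1 (length vs) * (\<Sum>j\<in>A. weight vs j * (bnorm (\<beta> + (1 / sqrt (length vs)) *\<^sub>R u) j + c j)))"
    if "finite A" for A vs c
  proof -
    have "convex_on UNIV (\<lambda>u. \<Sum>j\<in>A. weight vs j * (bnorm (\<beta> + (1 / sqrt (length vs)) *\<^sub>R u) j + c j))"
      using that
    proof (induction A rule: finite_induct)
      case empty
      show ?case by (simp add: convex_on_const)
    next
      case (insert j A)
      have "convex_on UNIV (\<lambda>u. weight vs j * (bnorm (\<beta> + (1 / sqrt (length vs)) *\<^sub>R u) j + c j))"
        by (intro convex_on_cmul convex_on_add convex_on_affine[OF convex_on_block_norm] weight_nonneg)
          (simp add: convex_on_const)
      then show ?case
        using insert by (simp add: convex_on_add)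
    qed
    then show ?thesis
      by (intro convex_on_cmul lam_nonneg)
  qed
  show "convex_on UNIV (active_penalty vs)" for vs
    using conv[OF finite_active, of vs "\<lambda>j. - bnorm \<beta> j"] by (simp add: active_penalty_def[abs_def])
  show "convex_on UNIV (inactive_penalty vs)" for vs
    using conv[of inactive vs "\<lambda>j. 0"] by (simp add: inactive_penalty_def[abs_def])
  show "active_penalty vs 0 = 0" "fusion_penalty vs 0 = 0" for vs
    by (simp_all add: active_penalty_def fusion_penalty_def)
  have inact: "inactive_penalty vs u = (\<Sum>j\<in>inactive. scaled_weight vs j * bnorm u j)" for vs u
    unfolding inactive_penalty_def
    by (simp add: bnorm_shift_inactive block_norm_scale sum_distrib_left mult_ac cong: sum.cong_simp)
  show "inactive_penalty vs 0 = 0" for vs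
    using bnorm_inactive by (simp add: inactive_penalty_def)
  show "0 \<le> inactive_penalty vs u" for vs u
    unfolding inactive_penalty_def
    by (intro mult_nonneg_nonneg sum_nonneg lam_nonneg weight_nonneg block_norm_nonneg)
  show "inactive_penalty vs u = 0" if "restrict_coords (range act) u = u" for vs u
    unfolding inact by (intro sum.neutral ballI) (simp add: bnorm_restricted[OF that])
  show "whp (\<lambda>vs. \<forall>u. \<bar>active_penalty vs u\<bar> \<le> \<epsilon> * norm u)" if "\<epsilon> > 0" for \<epsilon>
  proof -
    define e where "e = \<epsilon> / (real (card active) + 1)"
    have "e > 0" using that by (simp add: e_def add_nonneg_pos)
    have e: "real (card active) * e \<le> \<epsilon>"
    proof -
      have "real (card active) * e \<le> (real (card active) + 1) * e"
        using \<open>e > 0\<close> by (intro mult_right_mono) auto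
      also have "\<dots> = \<epsilon>"
        unfolding e_def by (simp add: add_nonneg_pos[of "real (card active)" 1, THEN less_imp_neq, symmetric])
      finally show ?thesis .
    qed
    have "whp (\<lambda>vs. \<forall>j\<in>active. scaled_weight vs j \<le> e)"
      using whp_active_weight \<open>e > 0\<close> by (intro whp_ball_finite finite_active)
    then show ?thesis
    proof (rule whp_mono, intro always_eventually allI impI, goal_cases)
      case (1 n vs u)
      let ?c = "1 / sqrt (length vs)"
      have "\<bar>active_penalty vs u\<bar>
          \<le> lam1 (length vs) * (\<Sum>j\<in>active. \<bar>weight vs j * (bnorm (\<beta> + ?c *\<^sub>R u) j - bnorm \<beta> j)\<bar>)"
        unfolding active_penalty_def abs_mult[of "lam1 _"]
        using lam_nonneg by (auto intro!: mult_left_mono sum_abs)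
      also have "\<dots> \<le> lam1 (length vs) * (\<Sum>j\<in>active. weight vs j * (?c * norm u))"
      proof (intro mult_left_mono sum_mono lam_nonneg)
        fix j assume j: "j \<in> active"
        have "\<bar>bnorm (\<beta> + ?c *\<^sub>R u) j - bnorm \<beta> j\<bar> \<le> bnorm (?c *\<^sub>R u) j"
          by (rule block_norm_diff_le)
        also have "\<dots> \<le> norm (?c *\<^sub>R u)"
          using j active_subset by (intro block_norm_le_norm[OF layout]) auto
        finally have "\<bar>bnorm (\<beta> + ?c *\<^sub>R u) j - bnorm \<beta> j\<bar> \<le> ?c * norm u"
          by simp
        then show "\<bar>weight vs j * (bnorm (\<beta> + ?c *\<^sub>R u) j - bnorm \<beta> j)\<bar> \<le> weight vs j * (?c * norm u)"
          unfolding abs_mult abs_of_nonneg[OF weight_nonneg] by (rule mult_left_mono[OF _ weight_nonneg])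
      qed
      also have "\<dots> = (\<Sum>j\<in>active. scaled_weight vs j * norm u)"
        by (simp add: sum_distrib_left mult_ac)
      also have "\<dots> \<le> (\<Sum>j\<in>active. e * norm u)"
        using 1 by (intro sum_mono mult_right_mono) auto
      also have "\<dots> = (real (card active) * e) * norm u"
        by simp
      also have "\<dots> \<le> \<epsilon> * norm u"
        using e by (rule mult_right_mono) simp
      finally show ?case .
    qed
  qed
  show "whp (\<lambda>vs. \<forall>u. \<bar>fusion_penalty vs u\<bar> \<le> \<epsilon>)" if "\<epsilon> > 0" for \<epsilon>
  proof (rule whp_eventually)
    let ?W = "\<Sum>j=1..J. \<Sum>s\<le>p j. \<Sum>r<s. w0 j r s"
    have "(\<lambda>n. lam0 n * ?W) \<longlonglongrightarrow> 0 * ?W"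
      by (intro tendsto_mult lam0_lim tendsto_const)
    then have "\<forall>\<^sub>F n in sequentially. lam0 n * ?W < \<epsilon>"
      using that by (intro order_tendstoD) auto
    then show "\<forall>\<^sub>F n in sequentially. \<forall>vs. length vs = n \<and> set vs \<subseteq> obs_space J p idx \<longrightarrow>
        (\<forall>u. \<bar>fusion_penalty vs u\<bar> \<le> \<epsilon>)"
    proof eventually_elim
      case (elim n)
      show ?case
      proof (intro allI impI)
        fix vs :: "(real \<times> (real ^ 'c option)) list" and u
        assume "length vs = n \<and> set vs \<subseteq> obs_space J p idx"
        then have n: "length vs = n" by simp
        have "\<bar>l0_part J p idx w0 (\<beta> + (1 / sqrt n) *\<^sub>R u) - l0_part J p idx w0 \<beta>\<bar> \<le> ?W"
          using l0_part_bounds[OF w0_pos, of idx \<beta>] l0_part_bounds[OF w0_pos, of idx "\<beta> + (1 / sqrt n) *\<^sub>R u"]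
          by (simp add: abs_le_iff)
        then have "\<bar>fusion_penalty vs u\<bar> \<le> lam0 n * ?W"
          unfolding fusion_penalty_def abs_mult n using lam_nonneg(2)[of n] by (simp add: mult_left_mono)
        then show "\<bar>fusion_penalty vs u\<bar> \<le> \<epsilon>" using elim by simp
      qed
    qed
  qed
  show "whp (\<lambda>vs. \<forall>u. norm u \<le> R \<longrightarrow> C * norm (u - restrict_coords (range act) u) \<le> inactive_penalty vs u)" for R C
  proof -
    let ?N = "real CARD('c option)"
    let ?I = "{j \<in> inactive. 1 \<le> p j}"
    have "whp (\<lambda>vs. \<forall>j\<in>?I. \<bar>C\<bar> * ?N \<le> scaled_weight vs j)"
    proof (rule whp_ball_finite)
      fix j assume "j \<in> ?I"
      then show "whp (\<lambda>vs. \<bar>C\<bar> * ?N \<le> scaled_weight vs j)"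
        by (intro whp_inactive_weight) simp_all
    qed simp
    then show ?thesis
    proof (rule whp_mono, intro always_eventually allI impI, goal_cases)
      case (1 n vs u)
      \<comment> \<open>Every coordinate outside the active ones belongs to an inactive group, whose norm bounds it.\<close>
      have "norm (u - restrict_coords (range act) u) \<le> (\<Sum>i\<in>UNIV. \<bar>(u - restrict_coords (range act) u) $ i\<bar>)"
        by (rule norm_le_l1_cart)
      also have "\<dots> \<le> (\<Sum>i\<in>(UNIV :: 'c option set). \<Sum>j\<in>?I. bnorm u j)"
      proof (rule sum_mono)
        fix i :: "'c option"
        show "\<bar>(u - restrict_coords (range act) u) $ i\<bar> \<le> (\<Sum>j\<in>?I. bnorm u j)"
        proof (cases "i \<in> range act")
          case True
          then have "(u - restrict_coords (range act) u) $ i = 0"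
            by (simp add: restrict_coords_def)
          then show ?thesis
            by (simp add: sum_nonneg block_norm_nonneg)
        next
          case False
          then obtain j k where jk: "j \<in> inactive" "k \<in> {1..p j}" "i = Some (idx (j, k))"
            by (rule inactive_coordE)
          have "\<bar>(u - restrict_coords (range act) u) $ i\<bar> \<le> bnorm u j"
            using False coord_le_block_norm[of k p j u idx] jk(2,3) by (simp add: restrict_coords_def)
          also have "\<dots> \<le> (\<Sum>j\<in>?I. bnorm u j)"
            using jk by (intro member_le_sum block_norm_nonneg) auto
          finally show ?thesis .
        qed
      qed
      also have "\<dots> = ?N * (\<Sum>j\<in>?I. bnorm u j)" by simp
      finally have "\<bar>C\<bar> * norm (u - restrict_coords (range act) u) \<le> \<bar>C\<bar> * (?N * (\<Sum>j\<in>?I. bnorm u j))"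
        by (rule mult_left_mono) simp
      also have "\<dots> = (\<Sum>j\<in>?I. (\<bar>C\<bar> * ?N) * bnorm u j)"
        by (simp add: sum_distrib_left mult.assoc)
      also have "\<dots> \<le> (\<Sum>j\<in>?I. scaled_weight vs j * bnorm u j)"
        using 1 by (intro sum_mono mult_right_mono block_norm_nonneg) auto
      also have "\<dots> \<le> inactive_penalty vs u"
        unfolding inact
        by (intro sum_mono2 mult_nonneg_nonneg divide_nonneg_nonneg lam_nonneg weight_nonneg block_norm_nonneg) auto
      finally have "\<bar>C\<bar> * norm (u - restrict_coords (range act) u) \<le> inactive_penalty vs u" .
      moreover have "C * norm (u - restrict_coords (range act) u) \<le> \<bar>C\<bar> * norm (u - restrict_coords (range act) u)"
        by (intro mult_right_mono) auto
      ultimately show ?case by linarith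
    qed
  qed
qed

lemma objective_lsc:
  assumes "c < objective vs x"
  shows "\<forall>\<^sub>F y in nhds x. c < objective vs y"
proof -
  let ?K = "\<lambda>b. - loglik vs b + lam1 (length vs) * (\<Sum>j=1..J. weight vs j * bnorm b j)"
  let ?L = "\<lambda>b. lam0 (length vs) * l0_part J p idx w0 b"
  have "\<forall>\<^sub>F y in nhds x. c - ?L x < ?K y"
    using assms
    by (intro continuous_imp_lsc continuous_intros continuous_on_loglik continuous_on_block_norm)
      (simp add: objective_eq)
  with l0_part_locally_minimal[OF w0_pos, of idx x] show ?thesis
  proof eventually_elim
    case (elim y)
    have "?L x \<le> ?L y"
      using elim(1) lam_nonneg(2) by (rule mult_left_mono)
    then show ?case using elim(2) by (simp add: objective_eq)
  qed
qed

lemma whp_fgl_exists: "whp (\<lambda>vs. \<exists>b. is_fgl J p idx lam1 lam0 \<gamma> w0 T vs b)"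
  using penalized.whp_coercive
proof (rule whp_mono, intro eventually_mono[OF eventually_gt_at_top[of 0]] allI impI, goal_cases)
  case (1 n vs)
  then obtain R where R: "R > 0" "\<And>u. R \<le> norm u \<Longrightarrow> 0 < penalized.scaled_objective vs u"
    by blast
  have "\<exists>x. \<forall>y. objective vs x \<le> objective vs y"
  proof (rule lsc_coercive_attains_min[where a = \<beta> and R = R and c = "1 / sqrt (length vs)"])
    show "objective vs \<beta> \<le> objective vs (\<beta> + (1 / sqrt (length vs)) *\<^sub>R u)" if "R \<le> norm u" for u
      using R(2)[OF that] objective_shift[of vs u] by (simp add: penalized.scaled_objective_def)
    show "0 < 1 / sqrt (length vs)"
      using 1 by auto
  qed (use objective_lsc R in auto)
  then show ?case
    by (auto simp: is_fgl_def is_arg_min_def not_less)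
qed

text \<open>
  Whichever minimizers an estimator selects, the conclusions hold for it. It is free only on
  samples that are too short or have no minimizer, and their probability tends to zero.
\<close>

theorem fgl_asymptotically_normal:
  assumes B: "fgl_estimator J p idx lam1 lam0 \<gamma> w0 T B"
  shows "whp (\<lambda>vs. is_fgl J p idx lam1 lam0 \<gamma> w0 T vs (B vs))"
    and "conv_in_distribution M
      (\<lambda>n w. sqrt n *\<^sub>R (subvec act (B (sample V n w)) - subvec act \<beta>))
      (mv_normal 0 (matrix_inv (submat act Info)))"
proof -
  show is_min: "whp (\<lambda>vs. is_fgl J p idx lam1 lam0 \<gamma> w0 T vs (B vs))"
    using whp_fgl_exists
  proof (rule whp_mono, intro eventually_mono[OF eventually_gt_at_top[of "\<Sum>j=1..J. p j"]] allI impI, goal_cases)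
    case (1 n vs)
    then show ?case
      using B unfolding fgl_estimator_def by blast
  qed
  show "conv_in_distribution M
      (\<lambda>n w. sqrt n *\<^sub>R (subvec act (B (sample V n w)) - subvec act \<beta>))
      (mv_normal 0 (matrix_inv (submat act Info)))"
  proof (rule penalized.minimizer_asymptotically_normal)
    show "whp (\<lambda>vs. \<forall>u. penalized.scaled_objective vs (sqrt (length vs) *\<^sub>R (B vs - \<beta>))
        \<le> penalized.scaled_objective vs u)"
      using is_min
    proof (rule whp_mono, intro eventually_mono[OF eventually_gt_at_top[of 0]] allI impI, goal_cases)
      case (1 n vs u)
      then have n: "length vs > 0" by auto
      have "objective vs (B vs) \<le> objective vs y" for y
        using 1 by (simp add: is_fgl_def is_arg_min_def not_less)
      from this[of "\<beta> + (1 / sqrt (length vs)) *\<^sub>R u"] show ?case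
        using objective_shift[of vs u] objective_shift[of vs "sqrt (length vs) *\<^sub>R (B vs - \<beta>)"]
          scaled_to_parameter[OF n, of "B vs"]
        by (simp add: penalized.scaled_objective_def)
    qed
  qed
qed

end

theorem theorem3p7:
  fixes M :: "'w measure"
    and J j0 :: nat and p :: "nat \<Rightarrow> nat"
    and idx :: "nat \<times> nat \<Rightarrow> 'c::finite"
    and act :: "'a::finite \<Rightarrow> 'c option"
    and v :: "'w \<Rightarrow> real \<times> (real ^ 'c option)"
    and V :: "nat \<Rightarrow> 'w \<Rightarrow> real \<times> (real ^ 'c option)"
    and \<beta>star :: "real ^ 'c option"
    and mle :: "(real \<times> (real ^ 'c option)) list \<Rightarrow> real ^ 'c option"
    and lam1 lam0 :: "nat \<Rightarrow> real" and \<gamma> :: real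
    and w0 :: "nat \<Rightarrow> nat \<Rightarrow> nat \<Rightarrow> real"
  assumes prob: "prob_space M"
    and layout: "coord_layout J p idx"
    and v_rv: "v \<in> borel_measurable M" "\<forall>\<omega>\<in>space M. v \<omega> \<in> obs_space J p idx"
    and V_rv: "\<forall>i. V i \<in> borel_measurable M" "\<forall>i. \<forall>\<omega>\<in>space M. V i \<omega> \<in> obs_space J p idx"
    and V_indep: "prob_space.indep_vars M (\<lambda>_. borel) V UNIV"
    and V_copies: "\<forall>i. distr M borel (V i) = distr M borel v"
    and model: "logistic_model M (\<lambda>\<omega>. fst (v \<omega>)) (\<lambda>\<omega>. snd (v \<omega>)) \<beta>star"
    and reg2: "reg2 M (\<lambda>\<omega>. snd (v \<omega>)) \<beta>star"
    and reg3: "reg3 M (\<lambda>\<omega>. snd (v \<omega>)) \<beta>star"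
    and sparse: "active_set J p idx \<beta>star = {1..j0}" "j0 < J"
    and act: "bij_betw act UNIV (active_coords J p idx \<beta>star)"
    and mle: "mle_estimator J p idx mle"
    and gamma: "\<gamma> > 0"
    and lam_nonneg: "\<forall>n. lam1 n \<ge> 0" "\<forall>n. lam0 n \<ge> 0"
    and w0_pos: "\<forall>j\<in>{1..J}. \<forall>r s. r < s \<and> s \<le> p j \<longrightarrow> w0 j r s > 0"
    and lam1_upper: "(\<lambda>n. lam1 n * real n powr (- 1 / 2)) \<longlonglongrightarrow> 0"
    and lam1_lower: "filterlim (\<lambda>n. lam1 n * real n powr ((\<gamma> - 1) / 2)) at_top sequentially"
    and a0: "(\<lambda>n. max_l0_weight J p (lam0 n) w0) \<longlonglongrightarrow> 0"
  shows "\<exists>\<beta>hat :: (real \<times> (real ^ 'c option)) list \<Rightarrow> real ^ 'c option.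
     fgl_estimator J p idx lam1 lam0 \<gamma> w0 mle \<beta>hat \<and>
     (\<lambda>n. measure M {\<omega> \<in> space M.
        is_fgl J p idx lam1 lam0 \<gamma> w0 mle (sample V n \<omega>) (\<beta>hat (sample V n \<omega>))}) \<longlonglongrightarrow> 1 \<and>
     conv_in_distribution M
       (\<lambda>n \<omega>. sqrt (real n) *\<^sub>R (subvec act (\<beta>hat (sample V n \<omega>)) - subvec act \<beta>star))
       (mv_normal 0 (matrix_inv (submat act (fisher_info M (\<lambda>\<omega>. snd (v \<omega>)) \<beta>star))))"
proof -
  interpret prob_space M by (rule prob)
  interpret fgl_sample M v V \<beta>star J p idx mle act lam1 lam0 \<gamma> w0
  proof
    show "finite (obs_space J p idx)"
      by (rule finite_obs_space[OF layout])
    show "fst ob \<in> {0, 1}" if "ob \<in> obs_space J p idx" for ob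
      using that by (auto simp: obs_space_def)
    show "distr M borel (V i) = distr M borel v" for i
      using V_copies by blast
    show "is_mle vs (mle vs)"
      if "set vs \<subseteq> obs_space J p idx" "(\<Sum>j=1..J. p j) < length vs" "\<exists>b. is_mle vs b" for vs
      using mle that by (simp add: mle_estimator_def)
    show "lam0 \<longlonglongrightarrow> 0"
      by (rule lam0_tendsto_0[OF layout lam_nonneg(2) w0_pos a0])
  qed (use v_rv V_rv V_indep model reg2 layout act gamma lam_nonneg w0_pos lam1_upper lam1_lower in auto)
  \<comment> \<open>Where there is no minimizer, the choice is arbitrary; an estimator is free there.\<close>
  define \<beta>hat where "\<beta>hat vs = (SOME b. is_fgl J p idx lam1 lam0 \<gamma> w0 mle vs b)" for vs
  have est: "fgl_estimator J p idx lam1 lam0 \<gamma> w0 mle \<beta>hat"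
    unfolding fgl_estimator_def \<beta>hat_def by (blast intro: someI_ex)
  show ?thesis
    using est whp_tendsto_1[OF fgl_asymptotically_normal(1)[OF est]] fgl_asymptotically_normal(2)[OF est]
    by blast
qed

end
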